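(* Let $G=N(m)$ with positive conductances satisfying $R_1\ge R_2\ge\cdots\ge R_m$. Let $G(1),G(2),\dots$ be truncations of the universal cover $G(\infty)$ such that $G(N)$ contains the boundary vertices $-N,\dots,N$ and $(-N)',\dots,N'$ of $G(\infty)$. Then $$\lim_{K\to\infty}\lim_{N\to\infty}\frac{\overline{\Pr}(\sigma_K)_{G(N)}}{\overline{\Pr}(\tau_K)_{G(N)}}=a,$$ where $a$ is the conductance of the high edge incident to the vertex $1$, i.e. the edge $M^{(0)}_1$–$M^{(1)}_0$.
   Context: Fix $n,m\ge1$. $N(m)$ is the cylindrical network with vertices $M^{(k)}_i$ ($0\le k\le m$, $i\in\mathbb{Z}/n$), boundary vertices $i=M^{(0)}_i$, $i'=M^{(m)}_i$, and edges $M^{(k)}_i$–$M^{(k+1)}_i$ (low) and $M^{(k)}_i$–$M^{(k+1)}_{i-1}$ (high), $0\le k\le m-1$. Its radii are $R_k=\prod_{i=1}^n w(M^{(k-1)}_iM^{(k)}_{i-1})\big/\prod_{i=1}^n w(M^{(k-1)}_iM^{(k)}_i)$ for $k=1,\dots,m$, with $w$ the conductance. The universal cover $G(\infty)$ has the same description with $i\in\mathbb{Z}$ and conductances of period $n$ in $i$; its boundary vertices are $i\in\mathbb{Z}$ and $i'\in\mathbb{Z}'$. A truncation $G(N)$ is determined by a finite vertex set $V_N$ (with $V_1\subseteq V_2\subseteq\cdots$ exhausting $G(\infty)$): it consists of all edges incident to $V_N$, a vertex being interior iff it is in $V_N$ and interior in $G(\infty)$, boundary otherwise. A grove of a finite network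 $H$ is a spanning forest each of whose components contains a boundary vertex; its boundary partition groups boundary vertices by component. For a partition $\pi$ of the boundary vertices of $H$, let $Z_\pi(H)$ be the sum over groves with boundary partition $\pi$ of the product of their edge conductances, and $\overline{\Pr}(\pi)_H=Z_\pi(H)/Z_{\mathrm{sing}}(H)$ where $\mathrm{sing}$ is the partition into singletons. $\tau_K$ is the partition of the boundary vertices of $G(N)$ (for $N\gg K$) whose non-singleton parts are $\{k,(k-1)'\}$ for $2\le k\le K$ and $\{k,k'\}$ for $-K\le k\le 0$ (all other vertices, including $1$, singletons); $\sigma_K$ is obtained from $\tau_K$ by merging $\{1\}$ and $\{0,0'\}$ into the part $\{1,0,0'\}$. *)

theory Defs
  imports Complex_Main
begin

section \<open>Networks, groves and partition functions\<close>

text \<open>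
  A network is an undirected multigraph (parallel edges do occur: the cylinder below has them
  for n = 1). The set \<open>ends G e\<close> consists of the one or two endpoints of \<open>e\<close>. The fields
  \<open>ends\<close> and \<open>cond\<close> are only meaningful on \<open>edges G\<close>.
\<close>

record ('v, 'e) network =
  verts :: "'v set"
  edges :: "'e set"
  ends  :: "'e \<Rightarrow> 'v set"
  bdry  :: "'v set"
  cond  :: "'e \<Rightarrow> real"

text \<open>
  The cycle visits \<open>vs ! 0, es ! 0, vs ! 1, es ! 1, \<dots>\<close> and returns to \<open>vs ! 0\<close>. Since the edges
  are required to be distinct, length 2 means a pair of parallel edges; length 1 means a loop.
\<close>

definition is_cycle :: "('v, 'e) network \<Rightarrow> 'e set \<Rightarrow> 'v list \<Rightarrow> 'e list \<Rightarrow> bool" where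
  "is_cycle G F vs es \<longleftrightarrow>
     es \<noteq> [] \<and> length vs = length es \<and> distinct vs \<and> distinct es \<and> set es \<subseteq> F \<and>
     (\<forall>i<length es. ends G (es ! i) = {vs ! i, vs ! ((i + 1) mod length es)})"

definition is_forest :: "('v, 'e) network \<Rightarrow> 'e set \<Rightarrow> bool" where
  "is_forest G F \<longleftrightarrow> \<not> (\<exists>vs es. is_cycle G F vs es)"

definition joined :: "('v, 'e) network \<Rightarrow> 'e set \<Rightarrow> ('v \<times> 'v) set" where
  "joined G F = {(x, y). \<exists>e\<in>F. ends G e = {x, y}}\<^sup>*"

text \<open>
  A spanning subgraph is given by its edge set \<open>F\<close>; vertices not covered by \<open>F\<close> are components
  of their own.
\<close>

definition grove :: "('v, 'e) network \<Rightarrow> 'e set \<Rightarrow> bool" where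
  "grove G F \<longleftrightarrow> F \<subseteq> edges G \<and> is_forest G F \<and>
     (\<forall>v\<in>verts G. \<exists>b\<in>bdry G. (v, b) \<in> joined G F)"

definition bdry_partition :: "('v, 'e) network \<Rightarrow> 'e set \<Rightarrow> 'v set set" where
  "bdry_partition G F = (\<lambda>b. {b' \<in> bdry G. (b, b') \<in> joined G F}) ` bdry G"

definition Z :: "('v, 'e) network \<Rightarrow> 'v set set \<Rightarrow> real" where
  "Z G \<pi> = (\<Sum>F | grove G F \<and> bdry_partition G F = \<pi>. \<Prod>e\<in>F. cond G e)"

definition sing :: "('v, 'e) network \<Rightarrow> 'v set set" where
  "sing G = (\<lambda>b. {b}) ` bdry G"

definition Prbar :: "('v, 'e) network \<Rightarrow> 'v set set \<Rightarrow> real" where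
  "Prbar G \<pi> = Z G \<pi> / Z G (sing G)"

definition truncation :: "('v, 'e) network \<Rightarrow> 'v set \<Rightarrow> ('v, 'e) network" where
  "truncation G V =
     (let E = {e \<in> edges G. ends G e \<inter> V \<noteq> {}};
          W = V \<union> (\<Union>e\<in>E. ends G e)
      in \<lparr>verts = W, edges = E, ends = ends G, bdry = W - (V - bdry G), cond = cond G\<rparr>)"


section \<open>The cylindrical network and its universal cover\<close>

text \<open>
  \<open>(k, i)\<close> stands for the vertex $M^{(k)}_i$; \<open>Low k i\<close> is the edge from $M^{(k)}_i$ to
  $M^{(k+1)}_i$ and \<open>High k i\<close> the edge from $M^{(k)}_i$ to $M^{(k+1)}_{i-1}$. On the cylinder
  the residues modulo n are represented by \<open>{0..<n}\<close>.
\<close>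

type_synonym vertex = "nat \<times> int"

datatype edge = Low nat int | High nat int

fun cover_ends :: "edge \<Rightarrow> vertex set" where
  "cover_ends (Low k i) = {(k, i), (k + 1, i)}"
| "cover_ends (High k i) = {(k, i), (k + 1, i - 1)}"

definition proj_vertex :: "nat \<Rightarrow> vertex \<Rightarrow> vertex" where
  "proj_vertex n v = (fst v, snd v mod int n)"

fun proj_edge :: "nat \<Rightarrow> edge \<Rightarrow> edge" where
  "proj_edge n (Low k i) = Low k (i mod int n)"
| "proj_edge n (High k i) = High k (i mod int n)"

definition cylinder :: "nat \<Rightarrow> nat \<Rightarrow> (edge \<Rightarrow> real) \<Rightarrow> (vertex, edge) network" where
  "cylinder n m w =
     \<lparr>verts = {0..m} \<times> {0..<int n},
      edges = {Low k i | k i. k < m \<and> i \<in> {0..<int n}} \<union> {High k i | k i. k < m \<and> i \<in> {0..<int n}},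
      ends = (\<lambda>e. proj_vertex n ` cover_ends e),
      bdry = {0, m} \<times> {0..<int n},
      cond = w\<rparr>"

definition universal_cover :: "nat \<Rightarrow> nat \<Rightarrow> (edge \<Rightarrow> real) \<Rightarrow> (vertex, edge) network" where
  "universal_cover n m w =
     \<lparr>verts = {0..m} \<times> UNIV,
      edges = {Low k i | k i. k < m} \<union> {High k i | k i. k < m},
      ends = cover_ends,
      bdry = {0, m} \<times> UNIV,
      cond = (\<lambda>e. w (proj_edge n e))\<rparr>"

definition radius :: "nat \<Rightarrow> (edge \<Rightarrow> real) \<Rightarrow> nat \<Rightarrow> real" where
  "radius n w k =
     (\<Prod>i = 1..int n. w (proj_edge n (High (k - 1) i))) /
     (\<Prod>i = 1..int n. w (proj_edge n (Low (k - 1) i)))"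


section \<open>The partitions \<open>\<tau>\<^sub>K\<close> and \<open>\<sigma>\<^sub>K\<close>\<close>

text \<open>
  The boundary vertices $i$ and $i'$ are \<open>(0, i)\<close> and \<open>(m, i)\<close>. The set \<open>tau m K H\<close> is a
  partition of \<open>bdry H\<close> only if \<open>H\<close> is large enough to contain all the vertices paired;
  otherwise no grove induces it and its partition function is 0.
\<close>

definition tau_pairs :: "nat \<Rightarrow> nat \<Rightarrow> vertex set set" where
  "tau_pairs m K =
     {{(0, k), (m, k - 1)} | k. 2 \<le> k \<and> k \<le> int K} \<union>
     {{(0, k), (m, k)} | k. - int K \<le> k \<and> k \<le> 0}"

definition tau :: "nat \<Rightarrow> nat \<Rightarrow> (vertex, edge) network \<Rightarrow> vertex set set" where
  "tau m K H = tau_pairs m K \<union> {{b} | b. b \<in> bdry H - \<Union> (tau_pairs m K)}"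

definition sigma :: "nat \<Rightarrow> nat \<Rightarrow> (vertex, edge) network \<Rightarrow> vertex set set" where
  "sigma m K H =
     (tau m K H - {{(0, 1)}, {(0, 0), (m, 0)}}) \<union> {{(0, 1), (0, 0), (m, 0)}}"

end

theory Submission
  imports Defs "HOL-Library.FuncSet"
begin

text \<open>
  Rooting every part of a grove turns partition functions into sums over acyclic pointer functions.

  For fixed \<open>K\<close>, both quotients $Z_\pi / Z_{sing}$ increase when an interior vertex is added (a form of
  Rayleigh monotonicity) and are bounded, because deleting the pointers of the non-root boundary
  vertices leaves a grove of singleton type. Hence the limit in \<open>N\<close> exists.

  For large \<open>K\<close>, the $2K$ disjoint paths of a \<open>\<tau>\<^sub>K\<close>- or \<open>\<sigma>\<^sub>K\<close>-grove have to fit into about $2K$ columns of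
  $m + 1$ vertices, so up to a bounded number of exceptions each is straight: a vertical path for
  $k \le 0$, and a path with exactly one high edge, at some level $j$, for $k \ge 2$, where $j$ is weakly
  increasing in $k$. If the paths next to vertex $1$ are vertical and have $j = 1$, its two
  neighbours lie on these paths, and \<open>\<sigma>\<^sub>K\<close>-groves correspond to \<open>\<tau>\<^sub>K\<close>-groves by adding the edge of
  conductance $a$. Otherwise $j \ge 2$ near vertex $1$ and one can trade \<open>s\<close> periods of a long run of
  parallel paths of type $j'$ for \<open>s\<close> periods of paths with $j = 1$ next to vertex $1$. This multiplies
  the weight by $(R_1 / R_{j'})^s \ge 1$ up to a constant. As \<open>s\<close> can be recovered from the result and
  ranges over arbitrarily many values as \<open>K\<close> grows, such groves are negligible.
\<close>

section \<open>Acyclic pointer functions\<close>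

text \<open>Both limits rest on bounds that do not see the truncation. The inner limit needs only
  that a new interior vertex lowers neither quotient, a fact about general finite weighted graphs;
  pointer functions make it accessible because redirecting one pointer keeps acyclicity as long as
  the new target does not lead back. The outer limit needs a bound on the distance of Z_\<sigma> /
  Z_\<tau> from a that is uniform in N. Since the interior is unknown outside the columns -K..K, all
  geometry is extracted from the paths of the non-root vertices alone. The obstacle is that bad
  configurations need not be few; they are only light compared with Z_\<tau>. Both kinds of bad
  configuration are spliced into \<tau>-configurations (vertex 1 becomes a root), so one comparison
  with Z_\<tau> serves numerator and denominator. With B = \<open>defect_bound m\<close>, a splice
  overwrites at most m(2B + 1) vertices and is governed by data whose number of values depends on m
  only. All losses are therefore constants, while the number of available splices grows with
  K.\<close>

text \<open>
  A grove with one boundary vertex of each part chosen as a root is the same as a map sending every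
  non-root vertex (the set \<open>D\<close>) to the next vertex on the way to its root; such maps are taken to be
  the identity off \<open>D\<close>.
\<close>

definition pointers :: "('v \<Rightarrow> 'v set) \<Rightarrow> 'v set \<Rightarrow> ('v \<Rightarrow> 'v) set" where
  "pointers nb D = {f. (\<forall>v\<in>D. f v \<in> nb v) \<and> (\<forall>v. v \<notin> D \<longrightarrow> f v = v) \<and> (\<forall>v. \<exists>i. (f ^^ i) v \<notin> D)}"

definition reaches :: "('v \<Rightarrow> 'v) \<Rightarrow> 'v \<Rightarrow> 'v \<Rightarrow> bool" where
  "reaches f u t \<longleftrightarrow> (\<exists>i. (f ^^ i) u = t)"

definition root_of :: "('v \<Rightarrow> 'v) \<Rightarrow> 'v \<Rightarrow> 'v" where
  "root_of f v = (THE r. f r = r \<and> reaches f v r)"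

definition wt :: "('v \<Rightarrow> 'v \<Rightarrow> real) \<Rightarrow> 'v set \<Rightarrow> ('v \<Rightarrow> 'v) \<Rightarrow> real" where
  "wt c D f = (\<Prod>v\<in>D. c v (f v))"

lemma funpow_fixed: "f r = r \<Longrightarrow> (f ^^ i) r = r"
  by (induction i) auto

lemma reaches_refl [simp]: "reaches f v v"
  unfolding reaches_def by (rule exI[of _ 0]) simp

lemma reaches_trans: "reaches f u v \<Longrightarrow> reaches f v w \<Longrightarrow> reaches f u w"
  unfolding reaches_def by (metis comp_apply funpow_add)

lemma reaches_step: "reaches f v (f v)"
  unfolding reaches_def by (rule exI[of _ 1]) simp

lemma reaches_from_step: "reaches f (f v) w \<Longrightarrow> reaches f v w"
  using reaches_step reaches_trans by metis

text \<open>If the orbit of \<open>v\<close> hits fixed points at times i and j, both are its value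
  at time i + j; this makes the \<open>THE\<close> in \<open>root_of\<close> legitimate.\<close>

lemma root_of_eqI:
  assumes "f r = r" "reaches f v r"
  shows "root_of f v = r"
  unfolding root_of_def
proof (rule the_equality)
  show "f r = r \<and> reaches f v r" using assms by simp
next
  fix s assume s: "f s = s \<and> reaches f v s"
  obtain i j where ij: "(f ^^ i) v = r" "(f ^^ j) v = s"
    using assms s unfolding reaches_def by auto
  have "(f ^^ (i + j)) v = s" "(f ^^ (j + i)) v = r"
    using ij s assms by (simp_all add: funpow_add funpow_fixed)
  then show "s = r" by (simp add: add.commute)
qed

lemma root_of_fixed: "f v = v \<Longrightarrow> root_of f v = v"
  by (rule root_of_eqI) auto

context
  fixes nb :: "'v \<Rightarrow> 'v set" and D :: "'v set" and f :: "'v \<Rightarrow> 'v"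
  assumes f: "f \<in> pointers nb D"
begin

lemma pointers_nb: "v \<in> D \<Longrightarrow> f v \<in> nb v"
  and pointers_out: "v \<notin> D \<Longrightarrow> f v = v"
  using f by (auto simp: pointers_def)

lemma pointers_exit: "\<exists>r. r \<notin> D \<and> reaches f v r"
proof -
  have "\<exists>i. (f ^^ i) v \<notin> D" using f by (simp add: pointers_def)
  then show ?thesis unfolding reaches_def by blast
qed

lemma root_of_notin: "root_of f v \<notin> D"
  and root_of_reaches: "reaches f v (root_of f v)"
  using pointers_exit[of v] root_of_eqI[of f _ v] pointers_out by force+

lemma root_of_cong: "reaches f u v \<Longrightarrow> root_of f u = root_of f v"
  using root_of_notin root_of_reaches pointers_out by (metis reaches_trans root_of_eqI)

lemma root_of_step: "root_of f (f v) = root_of f v"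
  using root_of_cong reaches_step by metis

lemma root_of_out: "v \<notin> D \<Longrightarrow> root_of f v = v"
  by (simp add: pointers_out root_of_fixed)

text \<open>A return to \<open>t\<close> after p steps would put the orbit back at \<open>t\<close>
  at every multiple of p, but from some time k on it is stuck at a point outside \<open>D\<close>.
  Time p * k is of both kinds.\<close>

lemma pointers_acyclic:
  assumes "t \<in> D"
  shows "\<not> reaches f (f t) t"
proof
  assume "reaches f (f t) t"
  then obtain i where i: "(f ^^ Suc i) t = t"
    unfolding reaches_def by (auto simp: funpow_swap1)
  obtain r k where r: "r \<notin> D" "(f ^^ k) t = r"
    using pointers_exit[of t] unfolding reaches_def by auto
  have per: "(f ^^ (Suc i * j)) t = t" for j
  proof (induction j)
    case (Suc j)
    have "Suc i * Suc j = Suc i * j + Suc i" by simp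
    then show ?case using Suc i by (metis comp_apply funpow_add)
  qed simp
  have "k \<le> Suc i * k" by simp
  then have "(f ^^ (Suc i * k)) t = (f ^^ (Suc i * k - k)) ((f ^^ k) t)"
    by (metis add.commute comp_apply funpow_add le_add_diff_inverse)
  also have "\<dots> = r"
    using r pointers_out funpow_fixed by metis
  finally show False
    using per r assms by metis
qed

lemma pointers_fixed_iff: "f v = v \<longleftrightarrow> v \<notin> D"
  using pointers_out pointers_acyclic by (metis reaches_refl)

text \<open>Turning vertices into roots cannot create cycles: an orbit of the restricted map that
  never leaves \<open>D'\<close> would be an orbit of \<open>f\<close> that never leaves
  \<open>D\<close>.\<close>

lemma restrict_pointers:
  assumes "D' \<subseteq> D"
  shows "(\<lambda>v. if v \<in> D' then f v else v) \<in> pointers nb D'"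
proof -
  let ?g = "\<lambda>v. if v \<in> D' then f v else v"
  have "\<exists>i. (?g ^^ i) v \<notin> D'" for v
  proof (rule ccontr)
    assume a: "\<nexists>i. (?g ^^ i) v \<notin> D'"
    have "(?g ^^ i) v = (f ^^ i) v" for i
    proof (induction i)
      case (Suc i)
      have "(?g ^^ i) v \<in> D'" using a by blast
      then show ?case using Suc by simp
    qed simp
    then have "(f ^^ i) v \<in> D" for i
      using a assms by (metis subsetD)
    then show False
      using pointers_exit unfolding reaches_def by metis
  qed
  then show ?thesis
    using assms pointers_nb by (auto simp: pointers_def)
qed

section \<open>Redirecting a single pointer\<close>

lemma upd_pow:
  assumes "\<not> reaches f x t"
  shows "((f(t := u)) ^^ i) x = (f ^^ i) x"
  using assms by (induction i) (auto simp: reaches_def)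

lemma upd_reaches:
  assumes "\<not> reaches f x t"
  shows "reaches (f(t := u)) x y \<longleftrightarrow> reaches f x y"
  using upd_pow[OF assms] by (simp add: reaches_def)

text \<open>Serves both to redirect a pointer (\<open>t\<close> in \<open>D\<close>) and to give a
  root its first pointer (\<open>t\<close> outside \<open>D\<close>). An orbit that meets
  \<open>t\<close> continues at \<open>u\<close>, whose orbit the change does not affect; hence the
  induction on the time of reaching \<open>t\<close>.\<close>

lemma upd_pointers:
  assumes "u \<in> nb t" "\<not> reaches f u t"
  shows "f(t := u) \<in> pointers nb (insert t D)"
proof -
  let ?g = "f(t := u)"
  have good: "\<exists>r. r \<notin> insert t D \<and> reaches ?g v r" if "\<not> reaches f v t" for v
    using that pointers_exit[of v] upd_reaches[OF that] by (metis insertE)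
  have "\<exists>r. r \<notin> insert t D \<and> reaches ?g v r" if "(f ^^ i) v = t" for v i
    using that
  proof (induction i arbitrary: v)
    case 0
    then show ?case
      using good[OF assms(2)] reaches_from_step[of ?g t] by (metis fun_upd_same funpow_0)
  next
    case (Suc i)
    show ?case
    proof (cases "v = t")
      case True
      then show ?thesis using good[OF assms(2)] reaches_from_step[of ?g t] by (metis fun_upd_same)
    next
      case False
      have "(f ^^ i) (f v) = t" using Suc.prems by (simp add: funpow_swap1)
      from Suc.IH[OF this] show ?thesis
        using False reaches_from_step[of ?g v] by (metis fun_upd_other)
    qed
  qed
  then have "\<exists>r. r \<notin> insert t D \<and> reaches ?g v r" for v
    using good unfolding reaches_def by blast
  then have "\<exists>i. (?g ^^ i) v \<notin> insert t D" for v
    unfolding reaches_def by metis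
  then show ?thesis
    using assms pointers_nb pointers_out by (simp add: pointers_def)
qed

lemma upd_root_of:
  assumes "\<not> reaches f x t" "x \<in> D \<or> x \<noteq> t"
  shows "root_of (f(t := u)) x = root_of f x"
proof (rule root_of_eqI)
  show "reaches (f(t := u)) x (root_of f x)"
    using assms upd_reaches root_of_reaches by metis
  have "root_of f x \<noteq> t" using assms root_of_reaches by metis
  then show "(f(t := u)) (root_of f x) = root_of f x"
    using pointers_out root_of_notin by simp
qed

lemma upd_root_of_at:
  assumes "\<not> reaches f u t" 
  shows "root_of (f(t := u)) t = root_of f u"
proof (rule root_of_eqI)
  have "reaches (f(t := u)) u (root_of f u)"
    using assms upd_reaches root_of_reaches by metis
  then show "reaches (f(t := u)) t (root_of f u)"
    using reaches_from_step[of "f(t := u)" t] by simp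
  have "root_of f u \<noteq> t" using assms root_of_reaches by metis
  then show "(f(t := u)) (root_of f u) = root_of f u"
    using pointers_out root_of_notin by simp
qed

end

lemma finite_pointers:
  assumes "finite D" "\<And>v. v \<in> D \<Longrightarrow> finite (nb v)"
  shows "finite (pointers nb D)"
proof (rule finite_imageD)
  show "finite ((\<lambda>f. restrict f D) ` pointers nb D)"
    by (rule finite_subset[OF _ finite_PiE[of D nb]]) (use assms in \<open>auto simp: pointers_def\<close>)
  show "inj_on (\<lambda>f. restrict f D) (pointers nb D)"
  proof (rule inj_onI, rule ext)
    fix f g v assume "f \<in> pointers nb D" "g \<in> pointers nb D" "restrict f D = restrict g D"
    then show "f v = g v"
      by (cases "v \<in> D") (metis restrict_apply, simp add: pointers_out)
  qed
qed

section \<open>Root statistics and monotonicity in the interior\<close>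

text \<open>The vertices of \<open>U\<close> are interior and may have any root; those of
  \<open>P\<close> are the non-root boundary vertices, whose roots encode the boundary partition.
  \<open>P = {}\<close> gives the groves of singleton type.\<close>

definition rooted :: "('v \<Rightarrow> 'v set) \<Rightarrow> ('v \<Rightarrow> 'v) \<Rightarrow> 'v set \<Rightarrow> 'v set \<Rightarrow> ('v \<Rightarrow> 'v) set" where
  "rooted nb \<rho> P U = {f \<in> pointers nb (U \<union> P). \<forall>p\<in>P. root_of f p = \<rho> p}"

definition zsum :: "('v \<Rightarrow> 'v set) \<Rightarrow> ('v \<Rightarrow> 'v \<Rightarrow> real) \<Rightarrow> ('v \<Rightarrow> 'v) \<Rightarrow> 'v set \<Rightarrow> 'v set \<Rightarrow> real" where
  "zsum nb c \<rho> P U = (\<Sum>f\<in>rooted nb \<rho> P U. wt c (U \<union> P) f)"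

text \<open>For \<open>P = {}\<close> and \<open>v\<close> outside \<open>U\<close>,
  \<open>zroot / zsum\<close> is the harmonic measure of \<open>v\<close> seen from
  \<open>t\<close>: the exit distribution from \<open>U\<close> of the walk with weights
  \<open>c\<close>.\<close>

definition zroot :: "('v \<Rightarrow> 'v set) \<Rightarrow> ('v \<Rightarrow> 'v \<Rightarrow> real) \<Rightarrow> ('v \<Rightarrow> 'v) \<Rightarrow> 'v set \<Rightarrow> 'v set \<Rightarrow> 'v \<Rightarrow> 'v \<Rightarrow> real" where
  "zroot nb c \<rho> P U v t = (\<Sum>f\<in>{f \<in> rooted nb \<rho> P U. root_of f t = v}. wt c (U \<union> P) f)"

text \<open>
  Marking an edge at \<open>t\<close> and exchanging it with the pointer of \<open>t\<close> (unless this closes a cycle) is a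
  weight-preserving involution. It shows that the total weight of the configurations in which \<open>t\<close> is
  rooted at \<open>v\<close> is a subharmonic function of \<open>t\<close>, and a harmonic one when no roots are prescribed; the
  maximum principle then compares the two.
\<close>

definition swap :: "'v \<Rightarrow> ('v \<Rightarrow> 'v) \<times> 'v \<Rightarrow> ('v \<Rightarrow> 'v) \<times> 'v" where
  "swap t = (\<lambda>(f, u). if reaches f u t then (f, u) else (f(t := u), f t))"

text \<open>\<open>f t\<close> does not lead back to \<open>t\<close>, before or after the update,
  so the exchanged pair is again exchangeable and swaps back.\<close>

lemma swap_swap:
  assumes f: "f \<in> pointers nb D" and t: "t \<in> D" and u: "u \<in> nb t"
  shows "swap t (swap t (f, u)) = (f, u)"
proof (cases "reaches f u t")
  case False
  have "\<not> reaches (f(t := u)) (f t) t"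
    using upd_reaches[OF f pointers_acyclic[OF f t]] pointers_acyclic[OF f t] by metis
  then show ?thesis using False by (simp add: swap_def)
qed (simp add: swap_def)

lemma wt_upd:
  assumes "finite D" "t \<in> D"
  shows "wt c D (f(t := u)) * c t (f t) = wt c D f * c t u"
proof -
  have "wt c D g = c t (g t) * (\<Prod>v\<in>D - {t}. c v (g v))" for g
    unfolding wt_def using assms by (rule prod.remove)
  moreover have "(\<Prod>v\<in>D - {t}. c v ((f(t := u)) v)) = (\<Prod>v\<in>D - {t}. c v (f v))"
    by (rule prod.cong) auto
  ultimately show ?thesis by (simp add: mult_ac)
qed

locale nbhd =
  fixes nb :: "'v \<Rightarrow> 'v set" and c :: "'v \<Rightarrow> 'v \<Rightarrow> real"
  assumes finite_nb: "finite (nb v)"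
begin

lemma finite_rooted: "finite (U \<union> P) \<Longrightarrow> finite (rooted nb \<rho> P U)"
  unfolding rooted_def by (rule finite_subset[OF _ finite_pointers]) (auto simp: finite_nb)

text \<open>\<open>h\<close> will be the constant \<open>t\<close> or the identity; the two sides of
  the mean value inequality at \<open>t\<close> then become weighted counts of pairs of a
  configuration and a marked edge at \<open>t\<close>.\<close>

lemma zroot_prod:
  assumes "finite (U \<union> P)"
  shows "(\<Sum>u\<in>nb t. c t u * zroot nb c \<rho> P U v (h u)) =
    (\<Sum>(f, u)\<in>{(f, u). f \<in> rooted nb \<rho> P U \<and> u \<in> nb t \<and> root_of f (h u) = v}. wt c (U \<union> P) f * c t u)"
proof -
  have "(\<Sum>u\<in>nb t. c t u * zroot nb c \<rho> P U v (h u)) =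
     (\<Sum>u\<in>nb t. \<Sum>f\<in>{f \<in> rooted nb \<rho> P U. root_of f (h u) = v}. wt c (U \<union> P) f * c t u)"
    unfolding zroot_def by (simp add: sum_distrib_left mult_ac)
  also have "\<dots> = (\<Sum>(u, f)\<in>(SIGMA u:nb t. {f \<in> rooted nb \<rho> P U. root_of f (h u) = v}). wt c (U \<union> P) f * c t u)"
    by (rule sum.Sigma) (use finite_nb finite_rooted[OF assms] in auto)
  also have "\<dots> = (\<Sum>(f, u)\<in>{(f, u). f \<in> rooted nb \<rho> P U \<and> u \<in> nb t \<and> root_of f (h u) = v}. wt c (U \<union> P) f * c t u)"
    by (rule sum.reindex_bij_witness[of _ "\<lambda>(f, u). (u, f)" "\<lambda>(u, f). (f, u)"]) auto
  finally show ?thesis .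
qed

lemma finite_pairs:
  assumes "finite (U \<union> P)"
  shows "finite {(f, u). f \<in> rooted nb \<rho> P U \<and> u \<in> nb t \<and> R f u}"
  by (rule finite_subset[of _ "rooted nb \<rho> P U \<times> nb t"]) (use finite_nb finite_rooted[OF assms] in auto)

text \<open>Redirecting \<open>t\<close> could disturb a prescribed root only if some
  \<open>p\<close> in \<open>P\<close> passed through \<open>t\<close>; but \<open>t\<close> is
  rooted at \<open>v\<close>, which is not a prescribed root. In the opposite direction only
  \<open>u\<close> is known to be rooted at \<open>v\<close>, so \<open>t\<close> may lie on such a
  path; hence only an inequality when roots are prescribed.\<close>

lemma swap_into:
  assumes fu: "f \<in> rooted nb \<rho> P U" "u \<in> nb t" "root_of f t = v"
    and t: "t \<in> U" and v: "v \<notin> \<rho> ` P"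
  shows "swap t (f, u) \<in> {(f, u). f \<in> rooted nb \<rho> P U \<and> u \<in> nb t \<and> root_of f u = v}"
proof -
  have f: "f \<in> pointers nb (U \<union> P)" and \<rho>: "\<And>p. p \<in> P \<Longrightarrow> root_of f p = \<rho> p"
    using fu by (auto simp: rooted_def)
  have tD: "t \<in> U \<union> P" using t by auto
  show ?thesis
  proof (cases "reaches f u t")
    case True
    then show ?thesis using fu root_of_cong[OF f True] by (simp add: swap_def)
  next
    case False
    have np: "\<not> reaches f p t" if "p \<in> P" for p
      using root_of_cong[OF f, of p t] \<rho>[OF that] fu(3) v that by (metis imageI)
    have "root_of (f(t := u)) p = \<rho> p" if "p \<in> P" for p
      using upd_root_of[OF f np[OF that]] \<rho>[OF that] that by simp
    moreover have "f(t := u) \<in> pointers nb (U \<union> P)"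
      using upd_pointers[OF f fu(2) False] tD by (simp add: insert_absorb)
    moreover have "root_of (f(t := u)) (f t) = v"
      using upd_root_of[OF f pointers_acyclic[OF f tD], of u] pointers_acyclic[OF f tD] root_of_step[OF f, of t] fu(3)
      by (metis reaches_refl)
    ultimately show ?thesis
      using False pointers_nb[OF f tD] by (simp add: swap_def rooted_def)
  qed
qed

lemma swap_into_free:
  assumes fu: "f \<in> rooted nb \<rho> {} U" "u \<in> nb t" "root_of f u = v" and t: "t \<in> U"
  shows "swap t (f, u) \<in> {(f, u). f \<in> rooted nb \<rho> {} U \<and> u \<in> nb t \<and> root_of f t = v}"
proof -
  have f: "f \<in> pointers nb U" using fu by (auto simp: rooted_def)
  show ?thesis
  proof (cases "reaches f u t")
    case True
    then show ?thesis using fu root_of_cong[OF f True] by (simp add: swap_def)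
  next
    case False
    then show ?thesis
      using upd_pointers[OF f fu(2) False] t pointers_nb[OF f t] upd_root_of_at[OF f False] fu(3)
      by (simp add: swap_def rooted_def insert_absorb)
  qed
qed

lemma swap_sum_le:
  assumes fin: "finite (U \<union> P)" and t: "t \<in> U"
    and nonneg: "\<And>v u. v \<in> U \<union> P \<Longrightarrow> u \<in> nb v \<Longrightarrow> c v u \<ge> 0"
    and into: "\<And>f u. (f, u) \<in> A \<Longrightarrow> swap t (f, u) \<in> B"
    and A: "A \<subseteq> {(f, u). f \<in> rooted nb \<rho> P U \<and> u \<in> nb t}"
    and B: "B \<subseteq> {(f, u). f \<in> rooted nb \<rho> P U \<and> u \<in> nb t}"
  shows "(\<Sum>(f, u)\<in>A. wt c (U \<union> P) f * c t u) \<le> (\<Sum>(f, u)\<in>B. wt c (U \<union> P) f * c t u)"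
proof -
  let ?g = "\<lambda>(f, u). wt c (U \<union> P) f * c t u"
  have inA: "f \<in> pointers nb (U \<union> P) \<and> u \<in> nb t" if "(f, u) \<in> A" for f u
    using that A by (auto simp: rooted_def)
  have inv: "swap t (swap t x) = x" if "x \<in> A" for x
    using swap_swap[of "fst x" nb "U \<union> P" t "snd x"] inA[of "fst x" "snd x"] t that by simp
  have inj: "inj_on (swap t) A"
    using inv by (rule inj_on_inverseI)
  have wt_swap: "?g (swap t x) = ?g x" if "x \<in> A" for x
    using wt_upd[OF fin, of t c "fst x" "snd x"] t
    by (cases x) (simp add: swap_def split: if_splits)
  have "sum ?g A = sum (?g \<circ> swap t) A"
    by (rule sum.cong) (use wt_swap in \<open>simp_all add: o_def\<close>)
  also have "\<dots> = sum ?g (swap t ` A)"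
    by (rule sum.reindex[OF inj, symmetric])
  also have "\<dots> \<le> sum ?g B"
  proof (rule sum_mono2)
    show "finite B"
      by (rule finite_subset[OF B]) (use finite_pairs[OF fin, of \<rho> t "\<lambda>_ _. True"] in simp)
    show "swap t ` A \<subseteq> B"
      using into by auto
    fix x assume "x \<in> B - swap t ` A"
    then have x: "fst x \<in> pointers nb (U \<union> P)" "snd x \<in> nb t" using B by (auto simp: rooted_def)
    have "wt c (U \<union> P) (fst x) \<ge> 0"
      unfolding wt_def by (rule prod_nonneg) (use nonneg pointers_nb[OF x(1)] in auto)
    then show "0 \<le> ?g x"
      using nonneg[of t "snd x"] x t by (cases x) simp
  qed
  finally show ?thesis .
qed

lemma zroot_subharmonic:
  assumes fin: "finite (U \<union> P)" and t: "t \<in> U" and v: "v \<notin> \<rho> ` P"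
    and nonneg: "\<And>v u. v \<in> U \<union> P \<Longrightarrow> u \<in> nb v \<Longrightarrow> c v u \<ge> 0"
  shows "(\<Sum>u\<in>nb t. c t u * zroot nb c \<rho> P U v t) \<le> (\<Sum>u\<in>nb t. c t u * zroot nb c \<rho> P U v u)"
  unfolding zroot_prod[OF fin, where h = "\<lambda>_. t"] zroot_prod[OF fin, where h = "\<lambda>u. u"]
  by (rule swap_sum_le[OF fin t nonneg]) (use swap_into[OF _ _ _ t v] in auto)

lemma zroot_superharmonic:
  assumes fin: "finite U" and t: "t \<in> U"
    and nonneg: "\<And>v u. v \<in> U \<Longrightarrow> u \<in> nb v \<Longrightarrow> c v u \<ge> 0"
  shows "(\<Sum>u\<in>nb t. c t u * zroot nb c \<rho> {} U v u) \<le> (\<Sum>u\<in>nb t. c t u * zroot nb c \<rho> {} U v t)"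
proof -
  have fin': "finite (U \<union> {})" using fin by simp
  show ?thesis
    unfolding zroot_prod[OF fin', where h = "\<lambda>_. t"] zroot_prod[OF fin', where h = "\<lambda>u. u"]
    by (rule swap_sum_le[OF fin' t]) (use nonneg swap_into_free[OF _ _ _ t] in auto)
qed

text \<open>\<open>g\<close> stands in for connectedness: it provides a way out of \<open>U\<close>
  from every vertex. A positive maximum spreads from a vertex to all its neighbours, hence along
  \<open>g\<close>, and is carried out of \<open>U\<close>, where \<open>\<phi>\<close> is not
  positive.\<close>

lemma maximum_principle:
  fixes \<phi> :: "'v \<Rightarrow> real"
  assumes fin: "finite U" and g: "g \<in> pointers nb U"
    and pos: "\<And>v u. v \<in> U \<Longrightarrow> u \<in> nb v \<Longrightarrow> c v u > 0"
    and sub: "\<And>t. t \<in> U \<Longrightarrow> (\<Sum>u\<in>nb t. c t u * \<phi> t) \<le> (\<Sum>u\<in>nb t. c t u * \<phi> u)"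
    and out: "\<And>v. v \<notin> U \<Longrightarrow> \<phi> v \<le> 0"
  shows "\<phi> x \<le> 0"
proof (rule ccontr)
  assume x: "\<not> \<phi> x \<le> 0"
  define M where "M = Max (\<phi> ` U)"
  have xU: "x \<in> U" using x out by blast
  have le: "\<phi> u \<le> M" if "u \<in> U" for u
    using that fin by (simp add: M_def)
  have Mpos: "M > 0" using le[OF xU] x by simp
  have le': "\<phi> u \<le> M" for u using le out[of u] Mpos by fastforce
  obtain t where t: "t \<in> U" "\<phi> t = M"
    using Max_in[of "\<phi> ` U"] fin xU M_def by fastforce
  have nbM: "\<phi> u = M" if "s \<in> U" "\<phi> s = M" "u \<in> nb s" for s u
  proof -
    have "(\<Sum>u\<in>nb s. c s u * (M - \<phi> u)) \<le> 0"
      using sub[OF that(1)] that(2) by (simp add: right_diff_distrib sum_subtractf)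
    moreover have ge: "c s u * (M - \<phi> u) \<ge> 0" if "u \<in> nb s" for u
      using pos[OF \<open>s \<in> U\<close> that] le'[of u] by simp
    ultimately have "(\<Sum>u\<in>nb s. c s u * (M - \<phi> u)) = 0"
      using sum_nonneg[of "nb s" "\<lambda>u. c s u * (M - \<phi> u)"] by simp
    then have "c s u * (M - \<phi> u) = 0"
      using sum_nonneg_eq_0_iff[OF finite_nb, of s "\<lambda>u. c s u * (M - \<phi> u)"] ge that(3) by auto
    then show ?thesis using pos[OF that(1,3)] by simp
  qed
  have "\<phi> ((g ^^ i) t) = M" for i
  proof (induction i)
    case (Suc i)
    show ?case
      using nbM[OF _ Suc pointers_nb[OF g]] pointers_out[OF g] Suc by (cases "(g ^^ i) t \<in> U") auto
  qed (use t in simp)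
  then show False
    using pointers_exit[OF g, of t] out Mpos unfolding reaches_def by (metis not_less)
qed

section \<open>Adding one interior vertex\<close>

lemma wt_insert:
  assumes "finite D" "v \<notin> D"
  shows "wt c (insert v D) (f(v := u)) = wt c D f * c v u"
proof -
  have "(\<Prod>x\<in>D. c x ((f(v := u)) x)) = (\<Prod>x\<in>D. c x (f x))"
    by (rule prod.cong) (use assms in auto)
  then show ?thesis using assms by (simp add: wt_def mult_ac)
qed

abbreviation extensions where
  "extensions \<rho> P U v \<equiv> {(f, u). f \<in> rooted nb \<rho> P U \<and> u \<in> nb v \<and> root_of f u \<noteq> v}"

text \<open>The root \<open>v\<close> may be given a pointer to \<open>u\<close> exactly when
  \<open>u\<close> is not rooted at \<open>v\<close>; subtracting \<open>zroot\<close> removes the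
  choices that close a cycle.\<close>

lemma zsum_minus_zroot:
  assumes "finite (U \<union> P)"
  shows "(\<Sum>u\<in>nb v. c v u * (zsum nb c \<rho> P U - zroot nb c \<rho> P U v u)) =
    (\<Sum>(f, u)\<in>(extensions \<rho> P U v). wt c (U \<union> P) f * c v u)"
proof -
  have split: "zsum nb c \<rho> P U - zroot nb c \<rho> P U v u =
     (\<Sum>f\<in>{f \<in> rooted nb \<rho> P U. root_of f u \<noteq> v}. wt c (U \<union> P) f)" for u
  proof -
    have "zsum nb c \<rho> P U = (\<Sum>f\<in>{f \<in> rooted nb \<rho> P U. root_of f u = v} \<union> {f \<in> rooted nb \<rho> P U. root_of f u \<noteq> v}. wt c (U \<union> P) f)"
      unfolding zsum_def by (rule sum.cong) auto
    also have "\<dots> = zroot nb c \<rho> P U v u + (\<Sum>f\<in>{f \<in> rooted nb \<rho> P U. root_of f u \<noteq> v}. wt c (U \<union> P) f)"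
      unfolding zroot_def by (rule sum.union_disjoint) (use finite_rooted[OF assms, of \<rho>] in auto)
    finally show ?thesis by simp
  qed
  have "(\<Sum>u\<in>nb v. c v u * (zsum nb c \<rho> P U - zroot nb c \<rho> P U v u)) =
     (\<Sum>u\<in>nb v. \<Sum>f\<in>{f \<in> rooted nb \<rho> P U. root_of f u \<noteq> v}. wt c (U \<union> P) f * c v u)"
    unfolding split by (simp add: sum_distrib_left mult_ac)
  also have "\<dots> = (\<Sum>(u, f)\<in>(SIGMA u:nb v. {f \<in> rooted nb \<rho> P U. root_of f u \<noteq> v}). wt c (U \<union> P) f * c v u)"
    by (rule sum.Sigma) (use finite_nb finite_rooted[OF assms] in auto)
  also have "\<dots> = (\<Sum>(f, u)\<in>(extensions \<rho> P U v). wt c (U \<union> P) f * c v u)"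
    by (rule sum.reindex_bij_witness[of _ "\<lambda>(f, u). (u, f)" "\<lambda>(u, f). (f, u)"]) auto
  finally show ?thesis .
qed

lemma extend_inj:
  assumes "v \<notin> U \<union> P"
  shows "inj_on (\<lambda>(f, u). f(v := u)) (extensions \<rho> P U v)"
proof (rule inj_onI, clarsimp)
  fix f u g w assume a: "f \<in> rooted nb \<rho> P U" "g \<in> rooted nb \<rho> P U" "f(v := u) = g(v := w)"
  have "f v = v" "g v = v" using a assms by (auto simp: rooted_def pointers_def)
  moreover have "u = w" "\<And>x. x \<noteq> v \<Longrightarrow> f x = g x" using a(3) by (metis fun_upd_apply)+
  ultimately show "f = g \<and> u = w" by force
qed

lemma extend_wt:
  assumes "finite (U \<union> P)" "v \<notin> U \<union> P"
  shows "(\<Sum>(f, u)\<in>(extensions \<rho> P U v). wt c (U \<union> P) f * c v u) =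
    sum (wt c (insert v U \<union> P)) ((\<lambda>(f, u). f(v := u)) ` (extensions \<rho> P U v))"
  unfolding sum.reindex[OF extend_inj[OF assms(2)]]
  by (rule sum.cong) (use wt_insert[OF assms] in auto)

text \<open>Only an inequality: once \<open>v\<close> is interior, the path of some \<open>p\<close>
  in \<open>P\<close> may run through \<open>v\<close>, and deleting the pointer of \<open>v\<close>
  would then change the root of \<open>p\<close>. Such configurations are dropped.\<close>

lemma zsum_insert_ge:
  assumes fin: "finite (U \<union> P)" and v: "v \<notin> U \<union> P" "v \<notin> \<rho> ` P"
    and nonneg: "\<And>x u. x \<in> insert v U \<union> P \<Longrightarrow> u \<in> nb x \<Longrightarrow> c x u \<ge> 0"
  shows "(\<Sum>u\<in>nb v. c v u * (zsum nb c \<rho> P U - zroot nb c \<rho> P U v u)) \<le> zsum nb c \<rho> P (insert v U)"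
  unfolding zsum_minus_zroot[OF fin] extend_wt[OF fin v(1)]
  unfolding zsum_def
proof (rule sum_mono2)
  show "finite (rooted nb \<rho> P (insert v U))" using fin by (intro finite_rooted) auto
  show "(\<lambda>(f, u). f(v := u)) ` (extensions \<rho> P U v) \<subseteq> rooted nb \<rho> P (insert v U)"
  proof clarsimp
    fix f u assume a: "f \<in> rooted nb \<rho> P U" "u \<in> nb v" "root_of f u \<noteq> v"
    have f: "f \<in> pointers nb (U \<union> P)" and \<rho>: "\<And>p. p \<in> P \<Longrightarrow> root_of f p = \<rho> p" using a by (auto simp: rooted_def)
    have fv: "f v = v" using pointers_out[OF f v(1)] .
    have nr: "\<not> reaches f u v" using root_of_eqI[of f v u] fv a(3) by auto
    have "root_of (f(v := u)) p = \<rho> p" if "p \<in> P" for p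
    proof -
      have "\<not> reaches f p v" using root_of_eqI[of f v p] fv \<rho>[OF that] v that by auto
      then show ?thesis using upd_root_of[OF f] \<rho>[OF that] that by simp
    qed
    then show "f(v := u) \<in> rooted nb \<rho> P (insert v U)"
      using upd_pointers[OF f a(2) nr] by (simp add: rooted_def)
  qed
  fix f assume "f \<in> rooted nb \<rho> P (insert v U) -
    (\<lambda>(f, u). f(v := u)) ` (extensions \<rho> P U v)"
  then have f: "f \<in> pointers nb (insert v U \<union> P)" by (simp add: rooted_def)
  show "0 \<le> wt c (insert v U \<union> P) f"
    unfolding wt_def by (rule prod_nonneg) (use nonneg pointers_nb[OF f] in auto)
qed

lemma zsum_insert_free:
  assumes fin: "finite U" and v: "v \<notin> U"
  shows "zsum nb c \<rho> {} (insert v U) = (\<Sum>u\<in>nb v. c v u * (zsum nb c \<rho> {} U - zroot nb c \<rho> {} U v u))"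
proof -
  have fin': "finite (U \<union> {})" and v': "v \<notin> U \<union> {}" using fin v by auto
  have "rooted nb \<rho> {} (insert v U) =
    (\<lambda>(f, u). f(v := u)) ` (extensions \<rho> {} U v)" (is "?A = ?B")
  proof
    show "?B \<subseteq> ?A"
    proof clarsimp
      fix f u assume a: "f \<in> rooted nb \<rho> {} U" "u \<in> nb v" "root_of f u \<noteq> v"
      have f: "f \<in> pointers nb U" using a by (auto simp: rooted_def)
      have "\<not> reaches f u v" using root_of_eqI[of f v u] pointers_out[OF f v] a(3) by auto
      then show "f(v := u) \<in> rooted nb \<rho> {} (insert v U)"
        using upd_pointers[OF f a(2)] by (simp add: rooted_def)
    qed
    show "?A \<subseteq> ?B"
    proof
      fix f assume "f \<in> ?A"
      then have f: "f \<in> pointers nb (insert v U)" by (simp add: rooted_def)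
      have "f(v := v) = (\<lambda>x. if x \<in> U then f x else x)"
        using pointers_out[OF f] v by auto
      then have g: "f(v := v) \<in> pointers nb U"
        using restrict_pointers[OF f, of U] by auto
      have nr: "\<not> reaches f (f v) v" using pointers_acyclic[OF f] by auto
      have "root_of (f(v := v)) (f v) \<noteq> v"
        using root_of_reaches[OF g, of "f v"] upd_reaches[OF f nr, of v] nr by metis
      then have "(f(v := v), f v) \<in> (extensions \<rho> {} U v)"
        using g pointers_nb[OF f, of v] by (simp add: rooted_def)
      then show "f \<in> ?B" by (rule rev_image_eqI) simp
    qed
  qed
  then show ?thesis
    unfolding zsum_minus_zroot[OF fin'] extend_wt[OF fin' v'] by (simp add: zsum_def)
qed

lemma zsum_pos:
  assumes fin: "finite (U \<union> P)" and g: "g \<in> rooted nb \<rho> P U"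
    and pos: "\<And>x u. x \<in> U \<union> P \<Longrightarrow> u \<in> nb x \<Longrightarrow> c x u > 0"
  shows "zsum nb c \<rho> P U > 0"
  unfolding zsum_def
proof (rule sum_pos)
  show "finite (rooted nb \<rho> P U)" by (rule finite_rooted[OF fin])
  show "rooted nb \<rho> P U \<noteq> {}" using g by auto
  fix f assume "f \<in> rooted nb \<rho> P U"
  then have f: "f \<in> pointers nb (U \<union> P)" by (simp add: rooted_def)
  show "0 < wt c (U \<union> P) f"
    unfolding wt_def by (rule prod_pos) (use pos pointers_nb[OF f] in auto)
qed

lemma zsum_nonneg:
  assumes pos: "\<And>x u. x \<in> U \<union> P \<Longrightarrow> u \<in> nb x \<Longrightarrow> c x u > 0"
  shows "zsum nb c \<rho> P U \<ge> 0"
  unfolding zsum_def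
proof (rule sum_nonneg)
  fix f assume "f \<in> rooted nb \<rho> P U"
  then have f: "f \<in> pointers nb (U \<union> P)" by (simp add: rooted_def)
  show "0 \<le> wt c (U \<union> P) f"
    unfolding wt_def by (rule prod_nonneg) (use pos pointers_nb[OF f] in \<open>force simp: less_imp_le\<close>)
qed

text \<open>Write Q and h for \<open>zsum\<close> with and without prescribed roots, and q and m for
  the corresponding \<open>zroot\<close> at \<open>v\<close>. Then q h - m Q is subharmonic on
  \<open>U\<close> and vanishes off \<open>U\<close>, so q / Q \<le> m / h: prescribing roots makes
  it less likely that an edge at \<open>v\<close> closes a cycle. Comparing
  \<open>zsum_insert_ge\<close> with the equality \<open>zsum_insert_free\<close> turns this into
  growth of the quotient.\<close>

lemma zsum_ratio_insert:
  assumes fin: "finite (U \<union> P)" and v: "v \<notin> U \<union> P" "v \<notin> \<rho> ` P" and UP: "U \<inter> P = {}"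
    and pos: "\<And>x u. x \<in> insert v U \<union> P \<Longrightarrow> u \<in> nb x \<Longrightarrow> c x u > 0"
    and g: "g \<in> pointers nb U"
  shows "zsum nb c \<rho> P U * zsum nb c \<rho> {} (insert v U) \<le> zsum nb c \<rho> P (insert v U) * zsum nb c \<rho> {} U"
proof -
  let ?Q = "zsum nb c \<rho> P U" and ?h = "zsum nb c \<rho> {} U"
  let ?q = "zroot nb c \<rho> P U v" and ?m = "zroot nb c \<rho> {} U v"
  have finU: "finite U" "v \<notin> U" using fin v by auto
  have nonneg: "c x u \<ge> 0" if "x \<in> insert v U \<union> P" "u \<in> nb x" for x u
    using pos[OF that] by simp
  have h0: "?h \<ge> 0" "?Q \<ge> 0"
    by (rule zsum_nonneg; use pos in auto)+
  have \<phi>: "?q x * ?h - ?m x * ?Q \<le> 0" for x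
  proof (rule maximum_principle[OF finU(1) g])
    show "c v u > 0" if "v \<in> U" "u \<in> nb v" for v u using pos that by auto
  next
    fix t assume t: "t \<in> U"
    have 1: "(\<Sum>u\<in>nb t. c t u * ?q t) \<le> (\<Sum>u\<in>nb t. c t u * ?q u)"
      by (rule zroot_subharmonic[OF fin t v(2)]) (use nonneg in auto)
    have 2: "(\<Sum>u\<in>nb t. c t u * ?m u) \<le> (\<Sum>u\<in>nb t. c t u * ?m t)"
      by (rule zroot_superharmonic[OF finU(1) t]) (use nonneg in auto)
    have "(\<Sum>u\<in>nb t. c t u * (?q t * ?h - ?m t * ?Q)) = (\<Sum>u\<in>nb t. c t u * ?q t) * ?h - (\<Sum>u\<in>nb t. c t u * ?m t) * ?Q"
      by (simp add: sum_subtractf right_diff_distrib sum_distrib_left sum_distrib_right mult_ac)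
    also have "\<dots> \<le> (\<Sum>u\<in>nb t. c t u * ?q u) * ?h - (\<Sum>u\<in>nb t. c t u * ?m u) * ?Q"
      by (intro diff_mono mult_right_mono 1 2 h0)
    also have "\<dots> = (\<Sum>u\<in>nb t. c t u * (?q u * ?h - ?m u * ?Q))"
      by (simp add: sum_subtractf right_diff_distrib sum_distrib_left sum_distrib_right mult_ac)
    finally show "(\<Sum>u\<in>nb t. c t u * (?q t * ?h - ?m t * ?Q)) \<le> (\<Sum>u\<in>nb t. c t u * (?q u * ?h - ?m u * ?Q))" .
  next
    fix x assume x: "x \<notin> U"
    have rtx: "root_of f x = x" if "f \<in> pointers nb U" for f
      using root_of_out[OF that x] .
    show "?q x * ?h - ?m x * ?Q \<le> 0"
    proof (cases "x = v")
      case True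
      have "{f \<in> rooted nb \<rho> P U. root_of f v = v} = rooted nb \<rho> P U" "{f \<in> rooted nb \<rho> {} U. root_of f v = v} = rooted nb \<rho> {} U"
        using root_of_out[of _ nb "U \<union> P" v] rtx v True by (auto simp: rooted_def)
      then have "?q x = ?Q" "?m x = ?h"
        by (simp_all add: zroot_def zsum_def True)
      then show ?thesis by simp
    next
      case False
      \<comment> \<open>A vertex of \<open>P\<close> has a prescribed root, which is not
        \<open>v\<close>; any other vertex outside \<open>U\<close> is its own root.\<close>
      have "{f \<in> rooted nb \<rho> P U. root_of f x = v} = {}"
      proof (cases "x \<in> P")
        case True
        then show ?thesis using v by (auto simp: rooted_def)
      next
        case xP: False
        have "x \<notin> U \<union> P" using x xP by simp
        then show ?thesis using root_of_out[of _ nb "U \<union> P" x] False by (auto simp: rooted_def)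
      qed
      moreover have "{f \<in> rooted nb \<rho> {} U. root_of f x = v} = {}"
        using rtx False by (auto simp: rooted_def)
      ultimately have "?q x = 0" "?m x = 0"
        unfolding zroot_def by (simp_all only: sum.empty)
      then show ?thesis by simp
    qed
  qed
  have "?Q * zsum nb c \<rho> {} (insert v U) = (\<Sum>u\<in>nb v. c v u * (?Q * ?h - ?m u * ?Q))"
    unfolding zsum_insert_free[OF finU] by (simp add: sum_distrib_left algebra_simps)
  also have "\<dots> \<le> (\<Sum>u\<in>nb v. c v u * (?Q * ?h - ?q u * ?h))"
  proof (rule sum_mono, rule mult_left_mono)
    fix u assume "u \<in> nb v"
    then show "0 \<le> c v u" using nonneg by simp
    show "?Q * ?h - ?m u * ?Q \<le> ?Q * ?h - ?q u * ?h" using \<phi>[of u] by simp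
  qed
  also have "\<dots> = (\<Sum>u\<in>nb v. c v u * (?Q - ?q u)) * ?h"
    by (simp add: sum_distrib_left sum_distrib_right algebra_simps)
  also have "\<dots> \<le> zsum nb c \<rho> P (insert v U) * ?h"
    by (intro mult_right_mono zsum_insert_ge[OF fin v] h0 nonneg) auto
  finally show ?thesis .
qed

text \<open>The factor depends on \<open>P\<close> only, so the quotients stay bounded as
  \<open>U\<close> grows. A configuration is recovered from its pointers on \<open>U\<close>, which
  form one of singleton type, together with its pointers on \<open>P\<close>.\<close>

lemma zsum_bounded:
  assumes fin: "finite (U \<union> P)" and UP: "U \<inter> P = {}"
    and pos: "\<And>x u. x \<in> U \<union> P \<Longrightarrow> u \<in> nb x \<Longrightarrow> c x u > 0"
  shows "zsum nb c \<rho> P U \<le> (\<Prod>p\<in>P. \<Sum>u\<in>nb p. c p u) * zsum nb c \<rho> {} U"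
proof -
  have finP: "finite P" "finite U" using fin by auto
  let ?r = "\<lambda>f. ((\<lambda>v. if v \<in> U then f v else v), restrict f P)"
  have inj: "inj_on ?r (rooted nb \<rho> P U)"
  proof (rule inj_onI, rule ext)
    fix f g v assume a: "f \<in> rooted nb \<rho> P U" "g \<in> rooted nb \<rho> P U" "?r f = ?r g"
    have "f \<in> pointers nb (U \<union> P)" "g \<in> pointers nb (U \<union> P)" using a by (auto simp: rooted_def)
    moreover have "(if v \<in> U then f v else v) = (if v \<in> U then g v else v)"
      using fun_cong[OF arg_cong[OF a(3), of fst], of v] by (simp only: fst_conv)
    moreover have "v \<in> P \<Longrightarrow> f v = g v"
      using fun_cong[OF arg_cong[OF a(3), of snd], of v] by (simp only: snd_conv restrict_apply if_True)
    ultimately show "f v = g v"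
      using pointers_out[of f nb "U \<union> P" v] pointers_out[of g nb "U \<union> P" v]
      by (cases "v \<in> P") (simp_all split: if_splits)
  qed
  have "zsum nb c \<rho> P U = (\<Sum>f\<in>rooted nb \<rho> P U. (\<lambda>(g, h). wt c U g * (\<Prod>p\<in>P. c p (h p))) (?r f))"
    unfolding zsum_def
  proof (rule sum.cong)
    fix f assume "f \<in> rooted nb \<rho> P U"
    show "wt c (U \<union> P) f = (\<lambda>(g, h). wt c U g * (\<Prod>p\<in>P. c p (h p))) (?r f)"
      unfolding wt_def prod.union_disjoint[OF finP(2,1) UP] by simp
  qed simp
  also have "\<dots> = (\<Sum>(g, h)\<in>?r ` rooted nb \<rho> P U. wt c U g * (\<Prod>p\<in>P. c p (h p)))"
    by (simp add: sum.reindex[OF inj] o_def)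
  also have "\<dots> \<le> (\<Sum>(g, h)\<in>rooted nb \<rho> {} U \<times> PiE P nb. wt c U g * (\<Prod>p\<in>P. c p (h p)))"
  proof (rule sum_mono2)
    show "finite (rooted nb \<rho> {} U \<times> PiE P nb)"
      using finP finite_nb by (intro finite_cartesian_product finite_rooted finite_PiE) auto
    show "?r ` rooted nb \<rho> P U \<subseteq> rooted nb \<rho> {} U \<times> PiE P nb"
    proof (rule image_subsetI)
      fix f assume "f \<in> rooted nb \<rho> P U"
      then have f: "f \<in> pointers nb (U \<union> P)" by (simp add: rooted_def)
      show "?r f \<in> rooted nb \<rho> {} U \<times> PiE P nb"
        using restrict_pointers[OF f, of U] pointers_nb[OF f] by (auto simp: rooted_def)
    qed
    fix x assume "x \<in> rooted nb \<rho> {} U \<times> PiE P nb - ?r ` rooted nb \<rho> P U"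
    then obtain g h where x: "x = (g, h)" "g \<in> pointers nb U" "h \<in> PiE P nb"
      by (auto simp: rooted_def)
    have "wt c U g \<ge> 0" unfolding wt_def
      by (rule prod_nonneg) (use pos pointers_nb[OF x(2)] in \<open>force simp: less_imp_le\<close>)
    moreover have "(\<Prod>p\<in>P. c p (h p)) \<ge> 0"
      by (rule prod_nonneg) (use pos x(3) in \<open>force simp: less_imp_le\<close>)
    ultimately show "0 \<le> (case x of (g, h) \<Rightarrow> wt c U g * (\<Prod>p\<in>P. c p (h p)))"
      using x by simp
  qed
  also have "\<dots> = zsum nb c \<rho> {} U * (\<Sum>h\<in>PiE P nb. \<Prod>p\<in>P. c p (h p))"
    by (simp add: zsum_def sum_product sum.cartesian_product)
  also have "(\<Sum>h\<in>PiE P nb. \<Prod>p\<in>P. c p (h p)) = (\<Prod>p\<in>P. \<Sum>u\<in>nb p. c p u)"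
    by (rule prod_sum_PiE[symmetric]) (use finP finite_nb in auto)
  finally show ?thesis by (simp add: mult.commute)
qed

end

section \<open>Groves as pointer functions\<close>

definition step_rel :: "('v, 'e) network \<Rightarrow> 'e set \<Rightarrow> ('v \<times> 'v) set" where
  "step_rel G F = {(x, y). \<exists>e\<in>F. ends G e = {x, y}}"

lemma joined_step_rel: "joined G F = (step_rel G F)\<^sup>*"
  by (simp add: joined_def step_rel_def)

lemma sym_joined: "sym (joined G F)"
  unfolding joined_step_rel by (rule sym_rtrancl) (auto simp: sym_def step_rel_def insert_commute)

lemma joined_sym: "(x, y) \<in> joined G F \<Longrightarrow> (y, x) \<in> joined G F"
  using sym_joined by (rule symD)

lemma joined_trans: "(x, y) \<in> joined G F \<Longrightarrow> (y, z) \<in> joined G F \<Longrightarrow> (x, z) \<in> joined G F"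
  unfolding joined_def by (rule rtrancl_trans)

lemma joined_mono: "F \<subseteq> F' \<Longrightarrow> joined G F \<subseteq> joined G F'"
  unfolding joined_step_rel by (rule rtrancl_mono) (auto simp: step_rel_def)

lemma joined_edge: "e \<in> F \<Longrightarrow> ends G e = {x, y} \<Longrightarrow> (x, y) \<in> joined G F"
  unfolding joined_step_rel by (rule r_into_rtrancl) (auto simp: step_rel_def)

lemma shortest_path:
  assumes "(x, y) \<in> R\<^sup>*"
  obtains p :: "nat \<Rightarrow> 'a" and k where "p 0 = x" "p k = y" "\<And>i. i < k \<Longrightarrow> (p i, p (Suc i)) \<in> R" "inj_on p {..k}"
proof -
  define k where "k = (LEAST k. (x, y) \<in> R ^^ k)"
  have "\<exists>k. (x, y) \<in> R ^^ k" using assms by (rule rtrancl_imp_relpow)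
  then have k: "(x, y) \<in> R ^^ k" unfolding k_def by (rule LeastI_ex)
  then obtain p where p: "p 0 = x" "p k = y" "\<And>i. i < k \<Longrightarrow> (p i, p (Suc i)) \<in> R"
    unfolding relpow_fun_conv by auto
  have sub: "(p i, p (i + j)) \<in> R ^^ j" if "i + j \<le> k" for i j
    unfolding relpow_fun_conv by (rule exI[of _ "\<lambda>l. p (i + l)"]) (use p(3) that in auto)
  have "p i \<noteq> p j" if "i < j" "j \<le> k" for i j
  proof
    assume eq: "p i = p j"
    have "(p 0, p i) \<in> R ^^ i" "(p j, p k) \<in> R ^^ (k - j)"
      using sub[of 0 i] sub[of j "k - j"] that by auto
    then have "(x, y) \<in> R ^^ (i + (k - j))"
      using eq p by (auto simp: relpow_add)
    then have "k \<le> i + (k - j)" unfolding k_def by (rule Least_le)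
    then show False using that by simp
  qed
  then have "inj_on p {..k}" by (auto simp: inj_on_def) (metis linorder_neqE_nat)
  then show ?thesis using that p by blast
qed

text \<open>The edge \<open>e\<close> closes a shortest path to a cycle in the sense of
  \<open>is_cycle\<close>; a path of length 0 yields a loop, one of length 1 a pair of parallel
  edges.\<close>

lemma joined_without_edge_imp_cycle:
  assumes e: "e \<in> F" "ends G e = {x, y}" and xy: "(x, y) \<in> joined G (F - {e})"
  shows "\<not> is_forest G F"
proof -
  obtain p k where p: "p 0 = x" "p k = y" "\<And>i. i < k \<Longrightarrow> (p i, p (Suc i)) \<in> step_rel G (F - {e})"
    and inj: "inj_on p {..k}"
    using shortest_path xy unfolding joined_step_rel by metis
  have "\<exists>d. \<forall>i<k. d i \<in> F - {e} \<and> ends G (d i) = {p i, p (Suc i)}"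
    using p(3) unfolding step_rel_def by (intro choice) auto
  then obtain d where d: "\<And>i. i < k \<Longrightarrow> d i \<in> F - {e} \<and> ends G (d i) = {p i, p (Suc i)}" by auto
  have dinj: "i = j" if "i < k" "j < k" "d i = d j" for i j
  proof -
    have "{p i, p (Suc i)} = {p j, p (Suc j)}" using d that by metis
    moreover have "p a = p b \<longleftrightarrow> a = b" if "a \<le> k" "b \<le> k" for a b
      using inj that by (auto simp: inj_on_def)
    ultimately show ?thesis
      using that by (auto simp: doubleton_eq_iff)
  qed
  define vs where "vs = map p [0..<Suc k]"
  define es where "es = map d [0..<k] @ [e]"
  have "is_cycle G F vs es"
    unfolding is_cycle_def
  proof (intro conjI allI impI)
    show "es \<noteq> []" "length vs = length es" by (simp_all add: vs_def es_def)
    have "set [0..<Suc k] = {..k}" by auto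
    then show "distinct vs" unfolding vs_def distinct_map using inj by (simp del: upt_Suc)
    have "inj_on d {0..<k}" using dinj by (auto intro!: inj_onI)
    moreover have "e \<notin> d ` {0..<k}" using d by fastforce
    ultimately show "distinct es" by (simp add: es_def distinct_map)
    show "set es \<subseteq> F" using d e by (auto simp: es_def)
    fix i assume "i < length es"
    then have i: "i \<le> k" by (simp add: es_def)
    show "ends G (es ! i) = {vs ! i, vs ! ((i + 1) mod length es)}"
    proof (cases "i = k")
      case True
      then show ?thesis using e p by (auto simp: es_def vs_def nth_append simp del: upt_Suc)
    next
      case False
      then show ?thesis using i d by (simp add: es_def vs_def nth_append del: upt_Suc)
    qed
  qed
  then show ?thesis by (auto simp: is_forest_def)
qed

definition net_nb :: "('v, 'e) network \<Rightarrow> 'v \<Rightarrow> 'v set" where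
  "net_nb G v = {u. \<exists>e\<in>edges G. ends G e = {v, u}}"

definition edge_between :: "('v, 'e) network \<Rightarrow> 'v \<Rightarrow> 'v \<Rightarrow> 'e" where
  "edge_between G v u = (THE e. e \<in> edges G \<and> ends G e = {v, u})"

definition pointer_edges :: "('v, 'e) network \<Rightarrow> 'v set \<Rightarrow> ('v \<Rightarrow> 'v) \<Rightarrow> 'e set" where
  "pointer_edges G D f = {e \<in> edges G. \<exists>v\<in>D. ends G e = {v, f v}}"

text \<open>When \<open>\<rho>\<close> maps \<open>A\<close> into \<open>bdry G - A\<close>, every
  part contains exactly one boundary vertex outside \<open>A\<close>, its root.\<close>

definition root_partition :: "('v, 'e) network \<Rightarrow> 'v set \<Rightarrow> ('v \<Rightarrow> 'v) \<Rightarrow> 'v set set" where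
  "root_partition G A \<rho> = (\<lambda>r. {r} \<union> {a \<in> A. \<rho> a = r}) ` (bdry G - A)"

text \<open>Without loops and parallel edges a pointer determines an edge. The universal cover is
  simple even for n = 1, when the cylinder is not.\<close>

locale simple_network =
  fixes G :: "('v, 'e) network"
  assumes finite_verts: "finite (verts G)"
    and finite_edges: "finite (edges G)"
    and ends: "e \<in> edges G \<Longrightarrow> \<exists>x\<in>verts G. \<exists>y\<in>verts G. x \<noteq> y \<and> ends G e = {x, y}"
    and ends_inj: "inj_on (ends G) (edges G)"
    and bdry_verts: "bdry G \<subseteq> verts G"
begin

lemma edge_between_eq: "e \<in> edges G \<Longrightarrow> ends G e = {v, u} \<Longrightarrow> edge_between G v u = e"
  unfolding edge_between_def using ends_inj by (intro the_equality) (auto simp: inj_on_def)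

lemma edge_between: "u \<in> net_nb G v \<Longrightarrow> edge_between G v u \<in> edges G \<and> ends G (edge_between G v u) = {v, u}"
  unfolding net_nb_def using edge_between_eq by auto

lemma net_nb_verts: "u \<in> net_nb G v \<Longrightarrow> u \<in> verts G"
proof -
  assume "u \<in> net_nb G v"
  then obtain e where e: "e \<in> edges G" "u \<in> ends G e" by (auto simp: net_nb_def)
  then show "u \<in> verts G" using ends[OF e(1)] by auto
qed

context
  fixes A :: "'v set" and D :: "'v set" and \<rho> :: "'v \<Rightarrow> 'v"
  assumes A: "A \<subseteq> bdry G" and \<rho>: "\<rho> ` A \<subseteq> bdry G - A"
    and D: "D = verts G - (bdry G - A)"
begin

lemma pointer_edges_eq:
  assumes f: "f \<in> pointers (net_nb G) D"
  shows "pointer_edges G D f = (\<lambda>v. edge_between G v (f v)) ` D"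
  unfolding pointer_edges_def
proof
  show "{e \<in> edges G. \<exists>v\<in>D. ends G e = {v, f v}} \<subseteq> (\<lambda>v. edge_between G v (f v)) ` D"
    using edge_between_eq by fastforce
  show "(\<lambda>v. edge_between G v (f v)) ` D \<subseteq> {e \<in> edges G. \<exists>v\<in>D. ends G e = {v, f v}}"
    using edge_between[OF pointers_nb[OF f]] by fastforce
qed

lemma pointer_edges_inj:
  assumes f: "f \<in> pointers (net_nb G) D"
  shows "inj_on (\<lambda>v. edge_between G v (f v)) D"
proof (rule inj_onI, rule ccontr)
  fix u v assume uv: "u \<in> D" "v \<in> D" "edge_between G u (f u) = edge_between G v (f v)" "u \<noteq> v"
  have "{u, f u} = {v, f v}"
    using edge_between[OF pointers_nb[OF f uv(1)]] edge_between[OF pointers_nb[OF f uv(2)]] uv(3) by metis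
  then have "f u = v" "f v = u" using uv(4) by (auto simp: doubleton_eq_iff)
  then show False using pointers_acyclic[OF f uv(1)] reaches_step by metis
qed

lemma prod_pointer_edges:
  assumes f: "f \<in> pointers (net_nb G) D"
  shows "(\<Prod>e\<in>pointer_edges G D f. cond G e) = wt (\<lambda>v u. cond G (edge_between G v u)) D f"
  unfolding pointer_edges_eq[OF f] prod.reindex[OF pointer_edges_inj[OF f]] wt_def by (simp add: o_def)

lemma root_of_root:
  assumes f: "f \<in> pointers (net_nb G) D" and v: "v \<in> verts G"
  shows "root_of f v \<in> bdry G - A"
proof -
  have "(f ^^ i) v \<in> verts G" for i
  proof (induction i)
    case (Suc i)
    then show ?case
      using pointers_out[OF f, of "(f ^^ i) v"] net_nb_verts[OF pointers_nb[OF f, of "(f ^^ i) v"]]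
      by (cases "(f ^^ i) v \<in> D") auto
  qed (use v in simp)
  then have "root_of f v \<in> verts G" using root_of_reaches[OF f, of v] unfolding reaches_def by metis
  then show ?thesis using root_of_notin[OF f, of v] D by auto
qed

lemma joined_pointer_edges:
  assumes f: "f \<in> pointers (net_nb G) D"
  shows "(x, y) \<in> joined G (pointer_edges G D f) \<longleftrightarrow> root_of f x = root_of f y"
proof
  assume "(x, y) \<in> joined G (pointer_edges G D f)"
  then show "root_of f x = root_of f y"
    unfolding joined_def
  proof (induction rule: rtrancl_induct)
    case (step y z)
    obtain e v where "ends G e = {y, z}" "ends G e = {v, f v}"
      using step(2) unfolding pointer_edges_def by auto
    then have "root_of f y = root_of f z" using root_of_step[OF f, of v] by (auto simp: doubleton_eq_iff)
    then show ?case using step by simp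
  qed simp
next
  have to_root: "(x, root_of f x) \<in> joined G (pointer_edges G D f)" for x
  proof -
    have "(x, (f ^^ i) x) \<in> joined G (pointer_edges G D f)" for i
    proof (induction i)
      case 0
      then show ?case by (simp add: joined_def)
    next
      case (Suc i)
      let ?v = "(f ^^ i) x"
      have "(?v, f ?v) \<in> joined G (pointer_edges G D f)"
      proof (cases "?v \<in> D")
        case True
        note e = edge_between[OF pointers_nb[OF f True]]
        show ?thesis
          by (rule joined_edge[of "edge_between G ?v (f ?v)"]) (use e True in \<open>auto simp: pointer_edges_def\<close>)
      next
        case False
        then show ?thesis using pointers_out[OF f] by (simp add: joined_def)
      qed
      then show ?case using Suc joined_trans by fastforce
    qed
    then show ?thesis using root_of_reaches[OF f, of x] unfolding reaches_def by metis
  qed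
  assume "root_of f x = root_of f y"
  then show "(x, y) \<in> joined G (pointer_edges G D f)"
    using to_root[of x] to_root[of y] joined_sym joined_trans by metis
qed

text \<open>Let the rank of a vertex be the number of steps it needs to leave \<open>D\<close>. At a
  vertex of maximal rank on a cycle both cycle edges are its own pointer, since a pointer into it
  would start at higher rank. So the cycle is a loop, which acyclicity rules out.\<close>

lemma forest_pointer_edges:
  assumes f: "f \<in> pointers (net_nb G) D"
  shows "is_forest G (pointer_edges G D f)"
  unfolding is_forest_def
proof (intro notI, elim exE)
  fix vs es assume c: "is_cycle G (pointer_edges G D f) vs es"
  define rk where "rk v = (LEAST i. (f ^^ i) v \<notin> D)" for v
  have rk: "rk (f v) < rk v" if "v \<in> D" for v
  proof -
    have ex: "\<exists>i. (f ^^ i) v \<notin> D" using pointers_exit[OF f, of v] unfolding reaches_def by auto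
    have out: "(f ^^ rk v) v \<notin> D" unfolding rk_def using ex by (rule LeastI_ex)
    then have "rk v \<noteq> 0" using that by (metis funpow_0)
    then obtain j where j: "rk v = Suc j" using not0_implies_Suc by blast
    then have "(f ^^ j) (f v) \<notin> D" using out by (simp add: funpow_swap1)
    then have "rk (f v) \<le> j" unfolding rk_def by (rule Least_le)
    then show ?thesis using j by simp
  qed
  define k where "k = length es"
  have k: "k > 0" "length vs = k" "distinct es" "set es \<subseteq> pointer_edges G D f"
    and en: "\<And>i. i < k \<Longrightarrow> ends G (es ! i) = {vs ! i, vs ! ((i + 1) mod k)}"
    using c unfolding is_cycle_def k_def by auto
  obtain p where p: "p < k" "\<And>q. q < k \<Longrightarrow> rk (vs ! q) \<le> rk (vs ! p)"
  proof -
    define M where "M = Max ((\<lambda>q. rk (vs ! q)) ` {..<k})"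
    have "M \<in> (\<lambda>q. rk (vs ! q)) ` {..<k}" unfolding M_def using k(1) by (intro Max_in) auto
    then obtain p where "p < k" "M = rk (vs ! p)" by auto
    moreover have "rk (vs ! q) \<le> M" if "q < k" for q unfolding M_def using that by auto
    ultimately show ?thesis using that by metis
  qed
  have key: "ends G (es ! i) = {vs ! p, f (vs ! p)}" "vs ! p \<in> D" if a: "i < k" "ends G (es ! i) = {vs ! p, vs ! q}" "q < k" for i q
  proof -
    have "es ! i \<in> pointer_edges G D f" using that k by (metis k_def nth_mem subsetD)
    then obtain v where v: "v \<in> D" "{vs ! p, vs ! q} = {v, f v}" using a(2) unfolding pointer_edges_def by auto
    have "vs ! p = v"
    proof (rule ccontr)
      assume "vs ! p \<noteq> v"
      then have "vs ! p = f v" "vs ! q = v" using v(2) by (auto simp: doubleton_eq_iff)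
      then show False using rk[OF v(1)] p(2)[OF that(3)] by simp
    qed
    then show "ends G (es ! i) = {vs ! p, f (vs ! p)}" "vs ! p \<in> D" using v that(2) by auto
  qed
  \<comment> \<open>The position before \<open>p\<close> on the cycle; adding \<open>k\<close> keeps
    the subtraction of natural numbers exact at \<open>p = 0\<close>.\<close>
  define q where "q = (p + k - 1) mod k"
  have q: "q < k" using k(1) by (simp add: q_def)
  have qp: "(q + 1) mod k = p"
  proof (cases "p = 0")
    case True
    then have "q = k - 1" using k(1) by (simp add: q_def)
    then show ?thesis using True k(1) by simp
  next
    case False
    have "p + k - 1 = (p - 1) + k" using False by simp
    then have "q = (p - 1 + k) mod k" unfolding q_def by (rule arg_cong)
    then have "q = p - 1" using p(1) by simp
    then show ?thesis using False p(1) by simp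
  qed
  have 1: "ends G (es ! p) = {vs ! p, f (vs ! p)}" "vs ! p \<in> D"
    using key[OF p(1) en[OF p(1)]] k(1) by auto
  have 2: "ends G (es ! q) = {vs ! p, f (vs ! p)}"
    using key[OF q, of q] en[OF q] qp q by (auto simp: insert_commute)
  have "es ! i \<in> edges G" if "i < k" for i
    using subsetD[OF k(4) nth_mem, of i] that by (simp add: k_def pointer_edges_def)
  then have "es ! p \<in> edges G" "es ! q \<in> edges G" using p(1) q by blast+
  then have "es ! p = es ! q" using 1 2 by (intro inj_onD[OF ends_inj]) simp_all
  then have "p = q" using nth_eq_iff_index_eq[OF k(3), of p q] p(1) q by (simp add: k_def)
  then have "ends G (es ! p) = {vs ! p}" using en[OF p(1)] qp by simp
  then have "f (vs ! p) = vs ! p" using 1 by auto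
  then show False using pointers_fixed_iff[OF f] 1 by auto
qed

lemma grove_pointer_edges:
  assumes f: "f \<in> rooted (net_nb G) \<rho> A (verts G - bdry G)"
  shows "grove G (pointer_edges G D f)" "bdry_partition G (pointer_edges G D f) = root_partition G A \<rho>"
proof -
  have D': "verts G - bdry G \<union> A = D" using A bdry_verts D by auto
  have f': "f \<in> pointers (net_nb G) D" and r: "\<And>a. a \<in> A \<Longrightarrow> root_of f a = \<rho> a" using f unfolding rooted_def D' by auto
  show "grove G (pointer_edges G D f)"
    unfolding grove_def
  proof (intro conjI ballI)
    show "pointer_edges G D f \<subseteq> edges G" by (auto simp: pointer_edges_def)
    show "is_forest G (pointer_edges G D f)" by (rule forest_pointer_edges[OF f'])
    fix v assume v: "v \<in> verts G"
    have "root_of f v \<in> bdry G" using root_of_root[OF f' v] by auto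
    moreover have "(v, root_of f v) \<in> joined G (pointer_edges G D f)"
      unfolding joined_pointer_edges[OF f'] using root_of_cong[OF f' root_of_reaches[OF f']] .
    ultimately show "\<exists>b\<in>bdry G. (v, b) \<in> joined G (pointer_edges G D f)" by blast
  qed
  have rb: "root_of f b = (if b \<in> A then \<rho> b else b)" if "b \<in> bdry G" for b
    using r root_of_out[OF f', of b] that D by auto
  have cls: "{b' \<in> bdry G. r = root_of f b'} = {r} \<union> {a \<in> A. \<rho> a = r}" if "r \<in> bdry G - A" for r
  proof (intro set_eqI)
    fix x
    show "x \<in> {b' \<in> bdry G. r = root_of f b'} \<longleftrightarrow> x \<in> {r} \<union> {a \<in> A. \<rho> a = r}"
      using that A rb[of x] by (cases "x \<in> A") auto
  qed
  have "bdry_partition G (pointer_edges G D f) = (\<lambda>r. {r} \<union> {a \<in> A. \<rho> a = r}) ` (root_of f ` bdry G)"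
    unfolding bdry_partition_def joined_pointer_edges[OF f'] image_image
    by (rule image_cong[OF refl]) (use cls root_of_root[OF f'] bdry_verts in blast)
  moreover have "root_of f ` bdry G = bdry G - A"
  proof
    show "root_of f ` bdry G \<subseteq> bdry G - A" using root_of_root[OF f'] bdry_verts by blast
    show "bdry G - A \<subseteq> root_of f ` bdry G"
    proof
      fix r assume "r \<in> bdry G - A"
      then show "r \<in> root_of f ` bdry G" using rb[of r] by (intro image_eqI[of _ _ r]) auto
    qed
  qed
  ultimately show "bdry_partition G (pointer_edges G D f) = root_partition G A \<rho>"
    by (simp add: root_partition_def)
qed

text \<open>Where \<open>f\<close> and \<open>g\<close> differ at \<open>v\<close>, the edge from
  \<open>v\<close> to \<open>f v\<close> must occur in \<open>g\<close> as the pointer from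
  \<open>f v\<close> back to \<open>v\<close>. Then they differ at \<open>f v\<close> too, and the
  disagreement follows the orbit of \<open>f\<close> forever, inside \<open>D\<close>.\<close>

lemma pointer_edges_determine:
  assumes f: "f \<in> pointers (net_nb G) D" and g: "g \<in> pointers (net_nb G) D"
    and eq: "pointer_edges G D f = pointer_edges G D g"
  shows "f = g"
proof (rule ext, rule ccontr)
  fix v assume v: "f v \<noteq> g v"
  have rev: "g (f u) = u \<and> f u \<in> D" if "u \<in> D" "f u \<noteq> g u" for u
  proof -
    note e = edge_between[OF pointers_nb[OF f that(1)]]
    have "edge_between G u (f u) \<in> pointer_edges G D g"
      using e that(1) unfolding eq[symmetric] by (auto simp: pointer_edges_def)
    then obtain w where "w \<in> D" "{u, f u} = {w, g w}" using e unfolding pointer_edges_def by auto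
    then show ?thesis using that by (auto simp: doubleton_eq_iff)
  qed
  have vD: "v \<in> D" using v pointers_out[OF f, of v] pointers_out[OF g, of v] by metis
  have "(f ^^ i) v \<in> D \<and> f ((f ^^ i) v) \<noteq> g ((f ^^ i) v)" for i
  proof (induction i)
    case (Suc i)
    let ?u = "(f ^^ i) v"
    have b: "g (f ?u) = ?u" "f ?u \<in> D" using rev Suc by auto
    have "f (f ?u) \<noteq> ?u" using pointers_acyclic[OF f, of ?u] Suc reaches_step by metis
    then show ?case using b by simp
  qed (use v vD in simp)
  then show False using pointers_exit[OF f, of v] unfolding reaches_def by metis
qed

text \<open>Every component of \<open>F\<close> contains exactly one root, so pointing each vertex
  to an \<open>F\<close>-neighbour nearer to the roots gives a pointer function. Its edges already
  join all vertices of a component; one more edge of \<open>F\<close> would close a cycle.\<close>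

lemma grove_imp_pointers:
  assumes F: "grove G F" and part: "bdry_partition G F = root_partition G A \<rho>"
  shows "\<exists>f\<in>rooted (net_nb G) \<rho> A (verts G - bdry G). pointer_edges G D f = F"
proof -
  have D': "verts G - bdry G \<union> A = D" using A bdry_verts D by auto
  have FE: "F \<subseteq> edges G" and forest: "is_forest G F" using F by (auto simp: grove_def)
  let ?R = "bdry G - A" and ?cls = "\<lambda>b. {b' \<in> bdry G. (b, b') \<in> joined G F}"
  have to_root: "\<exists>r\<in>?R. (v, r) \<in> joined G F" if v: "v \<in> verts G" for v
  proof -
    obtain b where b: "b \<in> bdry G" "(v, b) \<in> joined G F" using F v by (auto simp: grove_def)
    then have "?cls b \<in> root_partition G A \<rho>" using part by (auto simp: bdry_partition_def)
    then obtain r where r: "r \<in> ?R" "?cls b = {r} \<union> {a \<in> A. \<rho> a = r}" by (auto simp: root_partition_def)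
    then have "(b, r) \<in> joined G F" by blast
    then show ?thesis using r(1) joined_trans[OF b(2)] by blast
  qed
  have root_unique: "r = s" if "r \<in> ?R" "s \<in> ?R" "(r, s) \<in> joined G F" for r s
  proof -
    have "?cls r \<in> root_partition G A \<rho>" using part that by (auto simp: bdry_partition_def)
    then obtain t where t: "?cls r = {t} \<union> {a \<in> A. \<rho> a = t}" by (auto simp: root_partition_def)
    have "r \<in> ?cls r" "s \<in> ?cls r" using that by (auto simp: joined_def)
    then show ?thesis using that unfolding t by auto
  qed
  have \<rho>_joined: "(a, \<rho> a) \<in> joined G F" if "a \<in> A" for a
  proof -
    have "{\<rho> a} \<union> {a' \<in> A. \<rho> a' = \<rho> a} \<in> bdry_partition G F"
      using part that \<rho> by (auto simp: root_partition_def)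
    then obtain b where "?cls b = {\<rho> a} \<union> {a' \<in> A. \<rho> a' = \<rho> a}" by (auto simp: bdry_partition_def)
    then have "a \<in> ?cls b" "\<rho> a \<in> ?cls b" using that by auto
    then have "(b, a) \<in> joined G F" "(b, \<rho> a) \<in> joined G F" by simp_all
    then show ?thesis by (rule joined_trans[OF joined_sym])
  qed
  define d where "d v = (LEAST k. \<exists>r\<in>?R. (v, r) \<in> step_rel G F ^^ k)" for v
  have closer: "\<exists>u. (v, u) \<in> step_rel G F \<and> d u < d v" if "v \<in> D" for v
  proof -
    have "\<exists>k. \<exists>r\<in>?R. (v, r) \<in> step_rel G F ^^ k"
      using to_root[of v] that D rtrancl_imp_relpow unfolding joined_step_rel by blast
    then have "\<exists>r\<in>?R. (v, r) \<in> step_rel G F ^^ d v" unfolding d_def by (rule LeastI_ex)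
    then obtain r where r: "r \<in> ?R" "(v, r) \<in> step_rel G F ^^ d v" by auto
    have "d v \<noteq> 0"
    proof
      assume "d v = 0"
      then have "v = r" using r by simp
      then show False using r that D by auto
    qed
    then obtain j where j: "d v = Suc j" by (cases "d v") auto
    then obtain u where u: "(v, u) \<in> step_rel G F" "(u, r) \<in> step_rel G F ^^ j"
      using r relpow_Suc_D2 by metis
    then have "d u \<le> j" unfolding d_def using r by (intro Least_le) blast
    then show ?thesis using u j by auto
  qed
  define f where "f v = (if v \<in> D then SOME u. (v, u) \<in> step_rel G F \<and> d u < d v else v)" for v
  have f1: "(v, f v) \<in> step_rel G F" "d (f v) < d v" if "v \<in> D" for v
    using someI_ex[OF closer[OF that]] that by (auto simp: f_def)
  have f: "f \<in> pointers (net_nb G) D"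
  proof -
    have "\<exists>i. (f ^^ i) v \<notin> D" for v
    proof (rule ccontr)
      assume "\<nexists>i. (f ^^ i) v \<notin> D"
      then have a: "(f ^^ i) v \<in> D" for i by auto
      have "d ((f ^^ i) v) + i \<le> d v" for i
      proof (induction i)
        case (Suc i)
        then show ?case using f1(2)[OF a[of i]] by simp
      qed simp
      from this[of "Suc (d v)"] show False by simp
    qed
    moreover have "f v \<in> net_nb G v" if "v \<in> D" for v
      using f1(1)[OF that] FE by (auto simp: step_rel_def net_nb_def)
    ultimately show ?thesis by (auto simp: pointers_def f_def)
  qed
  have sub: "pointer_edges G D f \<subseteq> F"
  proof
    fix e assume "e \<in> pointer_edges G D f"
    then obtain v where v: "e \<in> edges G" "v \<in> D" "ends G e = {v, f v}" by (auto simp: pointer_edges_def)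
    obtain e' where "e' \<in> F" "ends G e' = {v, f v}" using f1(1)[OF v(2)] by (auto simp: step_rel_def)
    moreover from this have "e = e'" using v(1,3) FE by (intro inj_onD[OF ends_inj]) auto
    ultimately show "e \<in> F" by simp
  qed
  have v_root_of: "(v, root_of f v) \<in> joined G F" for v
    using joined_pointer_edges[OF f, of v "root_of f v"] root_of_cong[OF f root_of_reaches[OF f]] joined_mono[OF sub] by auto
  have "F \<subseteq> pointer_edges G D f"
  proof (rule ccontr)
    assume "\<not> F \<subseteq> pointer_edges G D f"
    then obtain e where e: "e \<in> F" "e \<notin> pointer_edges G D f" by auto
    obtain x y where xy: "x \<in> verts G" "y \<in> verts G" "ends G e = {x, y}" using ends e FE by blast
    have "(root_of f x, root_of f y) \<in> joined G F"
      using v_root_of[of x] v_root_of[of y] joined_edge[OF e(1) xy(3)] joined_sym joined_trans by metis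
    then have "root_of f x = root_of f y"
      by (rule root_unique[OF root_of_root[OF f xy(1)] root_of_root[OF f xy(2)]])
    then have "(x, y) \<in> joined G (pointer_edges G D f)" using joined_pointer_edges[OF f] by auto
    then have "(x, y) \<in> joined G (F - {e})"
      using joined_mono[of "pointer_edges G D f" "F - {e}"] sub e by auto
    then show False using joined_without_edge_imp_cycle[OF e(1) xy(3)] forest by auto
  qed
  then have "pointer_edges G D f = F" using sub by auto
  moreover have "root_of f a = \<rho> a" if "a \<in> A" for a
  proof (rule root_unique)
    show "root_of f a \<in> ?R" using root_of_root[OF f, of a] A bdry_verts that by auto
    show "\<rho> a \<in> ?R" using \<rho> that by auto
    show "(root_of f a, \<rho> a) \<in> joined G F" using v_root_of[of a] \<rho>_joined[OF that] joined_sym joined_trans by metis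
  qed
  ultimately show ?thesis using f by (auto simp: rooted_def D')
qed

end

theorem Z_root_partition:
  assumes A: "A \<subseteq> bdry G" and \<rho>: "\<rho> ` A \<subseteq> bdry G - A"
  shows "Z G (root_partition G A \<rho>) =
    zsum (net_nb G) (\<lambda>v u. cond G (edge_between G v u)) \<rho> A (verts G - bdry G)"
proof -
  define D where "D = verts G - (bdry G - A)"
  have D': "verts G - bdry G \<union> A = D" using A bdry_verts D_def by auto
  let ?S = "rooted (net_nb G) \<rho> A (verts G - bdry G)"
  have S: "f \<in> pointers (net_nb G) D" if "f \<in> ?S" for f using that by (auto simp: rooted_def D')
  have img: "{F. grove G F \<and> bdry_partition G F = root_partition G A \<rho>} = pointer_edges G D ` ?S" (is "?L = ?M")
  proof
    show "?L \<subseteq> ?M" using grove_imp_pointers[OF A \<rho> D_def] by fastforce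
    show "?M \<subseteq> ?L" using grove_pointer_edges[OF A \<rho> D_def] by blast
  qed
  have inj: "inj_on (pointer_edges G D) ?S"
    using pointer_edges_determine[OF A \<rho> D_def] S by (auto simp: inj_on_def)
  show ?thesis
    unfolding Z_def img sum.reindex[OF inj] zsum_def D'
    by (rule sum.cong) (use prod_pointer_edges[OF A \<rho> D_def] S in \<open>auto simp: o_def\<close>)
qed

end

section \<open>Paths in the strip\<close>

text \<open>The formula has no cut-off at level m; it is applied to pointers that start below level
  m, where it agrees with the universal cover.\<close>

fun nbrs :: "vertex \<Rightarrow> vertex set" where
  "nbrs (l, i) = {(Suc l, i), (Suc l, i - 1)} \<union> (if l = 0 then {} else {(l - 1, i), (l - 1, i + 1)})"

text \<open>
  The root of the bottom vertex $k$ in both \<open>\<tau>\<^sub>K\<close> and \<open>\<sigma>\<^sub>K\<close>; vertex $1$ is not a root only in \<open>\<sigma>\<^sub>K\<close>.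
\<close>

definition target :: "nat \<Rightarrow> vertex \<Rightarrow> vertex" where
  "target m v = (m, if snd v \<le> 0 then snd v else snd v - 1)"

definition starts :: "nat \<Rightarrow> vertex set" where
  "starts K = {0} \<times> {- int K..int K}"

text \<open>
  \<open>col c j\<close> is the directed path that ends at $(m, c)$ and takes its only high edge from level $j - 1$ to
  level $j$; for \<open>j = 0\<close> it is the vertical path.
\<close>

definition col :: "int \<Rightarrow> nat \<Rightarrow> nat \<Rightarrow> int" where
  "col c j l = c + (if l < j then 1 else 0)"

definition tight :: "nat \<Rightarrow> (vertex \<Rightarrow> vertex) \<Rightarrow> int \<Rightarrow> nat \<Rightarrow> bool" where
  "tight m f c j \<longleftrightarrow> (\<forall>l<m. f (l, col c j l) = (Suc l, col c j (Suc l)))"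

lemma nbrs_cases:
  assumes "u \<in> nbrs (l, i)"
  obtains "u = (Suc l, i)" | "u = (Suc l, i - 1)" | "l > 0" "u = (l - 1, i)" | "l > 0" "u = (l - 1, i + 1)"
  using assms by (auto split: if_splits)

lemma nbrs_props:
  assumes "u \<in> nbrs v"
  shows "fst u \<le> Suc (fst v)" "even (fst u + Suc (fst v))" "\<bar>snd u - snd v\<bar> \<le> 1"
    "fst u = Suc (fst v) \<Longrightarrow> snd u = snd v \<or> snd u = snd v - 1"
  using assms by (cases v; auto split: if_splits)+

lemma finite_nbrs: "finite (nbrs v)"
  by (cases v) auto

text \<open>Origin of the factor 5 in \<open>spl_sum\<close>: at most four neighbours, and the
  vertex itself in case it is fixed.\<close>

lemma card_nbrs: "card (insert v (nbrs v)) \<le> 5"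
proof (cases v)
  case (Pair l i)
  have "card (insert v (nbrs v)) \<le> card (set [v, (Suc l, i), (Suc l, i - 1), (l - 1, i), (l - 1, i + 1)])"
    by (rule card_mono) (auto simp: Pair)
  also have "\<dots> \<le> 5" using card_length[of "[v, (Suc l, i), (Suc l, i - 1), (l - 1, i), (l - 1, i + 1)]"] by simp
  finally show ?thesis .
qed

section \<open>Levels and columns along a path\<close>

lemma path_level:
  assumes step: "\<And>i. i < T \<Longrightarrow> x (Suc i) \<in> nbrs (x i)" and x0: "fst (x 0) = 0" and i: "i \<le> T"
  shows "fst (x i) \<le> i \<and> even (fst (x i) + i)"
  using i
proof (induction i)
  case (Suc i)
  then have "x (Suc i) \<in> nbrs (x i)" "fst (x i) \<le> i \<and> even (fst (x i) + i)" using step by auto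
  then show ?case using nbrs_props(1,2)[of "x (Suc i)" "x i"] by simp
qed (simp add: x0)

lemma path_level_up:
  assumes step: "\<And>i. i < T \<Longrightarrow> x (Suc i) \<in> nbrs (x i)" and i: "i + d \<le> T"
  shows "fst (x (i + d)) \<le> fst (x i) + d"
  using i
proof (induction d)
  case (Suc d)
  then have "x (Suc (i + d)) \<in> nbrs (x (i + d))" using step by auto
  then show ?case using Suc nbrs_props(1)[of "x (Suc (i + d))" "x (i + d)"] by simp
qed simp

lemma path_avoid_column:
  fixes x :: "nat \<Rightarrow> vertex"
  assumes step: "\<And>i. i < T \<Longrightarrow> x (Suc i) \<in> nbrs (x i)"
    and avoid: "\<And>i. i \<le> T \<Longrightarrow> snd (x i) \<noteq> y" and i: "i \<le> T"
  shows "snd (x i) < y \<longleftrightarrow> snd (x 0) < y"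
  using i
proof (induction i)
  case (Suc i)
  then have "\<bar>snd (x (Suc i)) - snd (x i)\<bar> \<le> 1" using nbrs_props(3) step by auto
  moreover have "snd (x i) \<noteq> y" "snd (x (Suc i)) \<noteq> y" using avoid Suc.prems by auto
  ultimately show ?case using Suc by auto
qed simp

text \<open>A path of exactly m steps from level 0 to level m has to rise at every step, so its
  column never increases. A total drop of 0 or 1 leaves the vertical path or one with a single high
  edge, whose upper end is the first vertex in the final column.\<close>

lemma straight_path:
  fixes x :: "nat \<Rightarrow> vertex"
  assumes step: "\<And>i. i < m \<Longrightarrow> x (Suc i) \<in> nbrs (x i)"
    and x0: "fst (x 0) = 0" and xm: "x m = (m, c)"
  shows "i \<le> m \<Longrightarrow> fst (x i) = i"
    and "snd (x 0) = c \<Longrightarrow> i \<le> m \<Longrightarrow> x i = (i, c)"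
    and "snd (x 0) = c + 1 \<Longrightarrow> \<exists>j\<in>{1..m}. \<forall>i\<le>m. x i = (i, col c j i)"
proof -
  have lv: "fst (x i) = i" if "i \<le> m" for i
  proof -
    have "fst (x (i + (m - i))) \<le> fst (x i) + (m - i)"
      by (rule path_level_up[of m]) (use that step in auto)
    moreover have "fst (x i) \<le> i" using path_level[OF step x0 that] by simp
    ultimately show ?thesis using that xm by simp
  qed
  then show "i \<le> m \<Longrightarrow> fst (x i) = i" .
  have dn: "snd (x (Suc i)) = snd (x i) \<or> snd (x (Suc i)) = snd (x i) - 1" if "i < m" for i
    using nbrs_props(4)[OF step[OF that]] lv that by auto
  have anti: "snd (x (i + d)) \<le> snd (x i)" if "i + d \<le> m" for i d
    using that
  proof (induction d)
    case (Suc d)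
    then show ?case using dn[of "i + d"] by auto
  qed simp
  have anti': "snd (x k) \<le> snd (x i)" if "i \<le> k" "k \<le> m" for i k
    using anti[of i "k - i"] that by simp
  have range: "c \<le> snd (x i)" "snd (x i) \<le> snd (x 0)" if "i \<le> m" for i
    using anti'[of i m] anti'[of 0 i] that xm by auto
  show "x i = (i, c)" if "snd (x 0) = c" "i \<le> m"
    using range[OF that(2)] lv[OF that(2)] that(1) by (simp add: prod_eq_iff)
  assume s: "snd (x 0) = c + 1"
  define j where "j = (LEAST j. snd (x j) = c)"
  have j: "snd (x j) = c" "j \<le> m"
    unfolding j_def using xm by (auto intro: LeastI[of _ m] Least_le)
  have "j \<noteq> 0" using j s by (intro notI) simp
  have "x i = (i, col c j i)" if "i \<le> m" for i
  proof (cases "i < j")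
    case True
    then have "snd (x i) \<noteq> c" unfolding j_def by (metis not_less_Least)
    then have "snd (x i) = c + 1" using range[OF that] s by simp
    then show ?thesis using True lv[OF that] by (simp add: prod_eq_iff col_def)
  next
    case False
    then have "snd (x i) \<le> c" using anti'[of j i] that j by simp
    then have "snd (x i) = c" using range[OF that] by simp
    then show ?thesis using False lv[OF that] by (simp add: prod_eq_iff col_def)
  qed
  then show "\<exists>j\<in>{1..m}. \<forall>i\<le>m. x i = (i, col c j i)"
    using \<open>j \<noteq> 0\<close> j by (intro bexI[of _ j]) auto
qed

lemma finite_filter_set: "finite A \<Longrightarrow> finite {x \<in> A. R x}"
  by (rule finite_subset[of _ A]) auto

lemma card_disjoint_meet:
  fixes Q :: "int \<Rightarrow> vertex set"
  assumes "finite Y" and disj: "\<And>c d. c \<in> C \<Longrightarrow> d \<in> C \<Longrightarrow> c \<noteq> d \<Longrightarrow> Q c \<inter> Q d = {}"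
    and meet: "\<And>c. c \<in> C \<Longrightarrow> Q c \<inter> Y \<noteq> {}"
  shows "card C \<le> card Y"
proof -
  have "\<forall>c\<in>C. \<exists>y. y \<in> Q c \<inter> Y" using meet by blast
  then obtain h where h: "\<And>c. c \<in> C \<Longrightarrow> h c \<in> Q c \<inter> Y" by metis
  have "inj_on h C"
  proof (rule inj_onI, rule ccontr)
    fix c d assume "c \<in> C" "d \<in> C" "h c = h d" "c \<noteq> d"
    then show False using h[of c] h[of d] disj[of c d] by auto
  qed
  then show ?thesis using card_inj_on_le[of h C Y] h assms(1) by auto
qed

text \<open>Arises in \<open>few_defects\<close> as (m + 1)(2m + 1) + 2(m + 1): the first term
  bounds the defects among paths strictly inside the window, the second the paths that touch column
  -K or K.\<close>

definition defect_bound :: "nat \<Rightarrow> nat" where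
  "defect_bound m = (m + 1) * (2 * m + 3)"

text \<open>One setting for both partitions: (0, 1) is a non-root for \<sigma> and a root for
  \<tau>. Outside the window the interior \<open>U\<close> is arbitrary, as truncations can
  be.\<close>

locale strip_grove =
  fixes m K :: nat and U P :: "vertex set" and f :: "vertex \<Rightarrow> vertex"
  assumes m: "m \<ge> 1"
    and U: "U \<subseteq> {0<..<m} \<times> UNIV"
    and window: "{0<..<m} \<times> {- int K..int K} \<subseteq> U"
    and P: "P = starts K \<or> P = starts K - {(0, 1)}"
    and f: "f \<in> rooted nbrs (target m) P U"
begin

lemma ptr: "f \<in> pointers nbrs (U \<union> P)"
  and root: "p \<in> P \<Longrightarrow> root_of f p = target m p"
  using f by (auto simp: rooted_def)

lemma level: "v \<in> U \<union> P \<Longrightarrow> fst v < m"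
  using U P m by (auto simp: starts_def)

lemma top: "m \<le> fst v \<Longrightarrow> f v = v"
  using level[of v] pointers_out[OF ptr, of v] by force

text \<open>Discrete planarity: one step from strictly left of a straight path reaches at most the
  path itself, and on the path the pointers follow it.\<close>

lemma barrier_left:
  assumes t: "tight m f c j" and v: "snd v \<le> col c j (fst v)"
  shows "snd (f v) \<le> col c j (fst (f v))"
proof (cases "v \<in> U \<union> P")
  case True
  obtain l i where li: "v = (l, i)" by (cases v)
  have l: "l < m" using level[OF True] li by simp
  show ?thesis
  proof (cases "i = col c j l")
    case True
    then show ?thesis using t l li by (simp add: tight_def)
  next
    case False
    then have i: "i < col c j l" using v li by simp
    have "f v \<in> nbrs (l, i)" using pointers_nb[OF ptr True] li by simp
    then show ?thesis by (cases rule: nbrs_cases) (use i in \<open>auto simp: col_def split: if_splits\<close>)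
  qed
next
  case False
  then show ?thesis using pointers_out[OF ptr] v by simp
qed

lemma barrier_right:
  assumes t: "tight m f c j" and v: "col c j (fst v) \<le> snd v"
  shows "col c j (fst (f v)) \<le> snd (f v)"
proof (cases "v \<in> U \<union> P")
  case True
  obtain l i where li: "v = (l, i)" by (cases v)
  have l: "l < m" using level[OF True] li by simp
  show ?thesis
  proof (cases "i = col c j l")
    case True
    then show ?thesis using t l li by (simp add: tight_def)
  next
    case False
    then have i: "i > col c j l" using v li by simp
    have "f v \<in> nbrs (l, i)" using pointers_nb[OF ptr True] li by simp
    then show ?thesis by (cases rule: nbrs_cases) (use i in \<open>auto simp: col_def split: if_splits\<close>)
  qed
next
  case False
  then show ?thesis using pointers_out[OF ptr] v by simp
qed

lemma barrier_left_pow: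
  assumes "tight m f c j" "snd v \<le> col c j (fst v)"
  shows "snd ((f ^^ k) v) \<le> col c j (fst ((f ^^ k) v))"
  using assms(2) by (induction k) (auto intro: barrier_left[OF assms(1)])

lemma barrier_right_pow:
  assumes "tight m f c j" "col c j (fst v) \<le> snd v"
  shows "col c j (fst ((f ^^ k) v)) \<le> snd ((f ^^ k) v)"
  using assms(2) by (induction k) (auto intro: barrier_right[OF assms(1)])

text \<open>Paths are indexed by the column of their top end, which gives 2K pairwise disjoint paths
  for either partition; vertex 1, whose path in the \<sigma> case also ends at 0', is left
  out.\<close>

definition st :: "int \<Rightarrow> vertex" where
  "st c = (0, if c \<le> 0 then c else c + 1)"

definition len :: "int \<Rightarrow> nat" where
  "len c = (LEAST i. (f ^^ i) (st c) \<notin> U \<union> P)"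

definition orb :: "int \<Rightarrow> vertex set" where
  "orb c = (\<lambda>i. (f ^^ i) (st c)) ` {..len c}"

abbreviation C :: "int set" where "C \<equiv> {- int K..int K - 1}"

lemma st_P: "c \<in> C \<Longrightarrow> st c \<in> P"
  using P by (auto simp: starts_def st_def)

lemma root_of_st: "c \<in> C \<Longrightarrow> root_of f (st c) = (m, c)"
  using root[OF st_P] by (auto simp: target_def st_def)

lemma before_len: "i < len c \<Longrightarrow> (f ^^ i) (st c) \<in> U \<union> P"
  unfolding len_def using not_less_Least by blast

lemma at_len:
  assumes "c \<in> C"
  shows "(f ^^ len c) (st c) = (m, c)"
proof -
  have "\<exists>i. (f ^^ i) (st c) \<notin> U \<union> P" using pointers_exit[OF ptr, of "st c"] unfolding reaches_def by metis
  then have "(f ^^ len c) (st c) \<notin> U \<union> P" unfolding len_def by (rule LeastI_ex)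
  then have "root_of f ((f ^^ len c) (st c)) = (f ^^ len c) (st c)" by (rule root_of_out[OF ptr])
  moreover have "root_of f (st c) = root_of f ((f ^^ len c) (st c))"
    by (rule root_of_cong[OF ptr]) (auto simp: reaches_def)
  ultimately show ?thesis using root_of_st[OF assms] by simp
qed

lemma orb_step: "i < len c \<Longrightarrow> (f ^^ Suc i) (st c) \<in> nbrs ((f ^^ i) (st c))"
  using pointers_nb[OF ptr before_len] by simp

lemma orb_inj: "inj_on (\<lambda>i. (f ^^ i) (st c)) {..len c}"
proof -
  have "(f ^^ i) (st c) \<noteq> (f ^^ j) (st c)" if "i < j" "j \<le> len c" for i j
  proof
    assume eq: "(f ^^ i) (st c) = (f ^^ j) (st c)"
    let ?v = "(f ^^ i) (st c)"
    have "(f ^^ (j - Suc i)) (f ?v) = (f ^^ (j - Suc i + Suc i)) (st c)"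
      by (simp only: funpow_add o_apply funpow.simps)
    then have "reaches f (f ?v) ?v" using eq that unfolding reaches_def by auto
    then show False using pointers_acyclic[OF ptr before_len[of i c]] that by simp
  qed
  then show ?thesis by (intro inj_onI) (metis atMost_iff linorder_neqE_nat)
qed

lemma card_orb: "card (orb c) = Suc (len c)"
  unfolding orb_def by (simp add: card_image[OF orb_inj])

lemma finite_orb: "finite (orb c)"
  by (simp add: orb_def)

lemma root_of_orb: "c \<in> C \<Longrightarrow> v \<in> orb c \<Longrightarrow> root_of f v = (m, c)"
proof -
  assume a: "c \<in> C" "v \<in> orb c"
  then have "reaches f (st c) v" by (auto simp: orb_def reaches_def)
  then show "root_of f v = (m, c)" using root_of_cong[OF ptr] root_of_st[OF a(1)] by metis
qed

lemma orb_disjoint: "c \<in> C \<Longrightarrow> d \<in> C \<Longrightarrow> c \<noteq> d \<Longrightarrow> orb c \<inter> orb d = {}"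
  using root_of_orb[of c] root_of_orb[of d] by fastforce

lemma orb_level: "c \<in> C \<Longrightarrow> v \<in> orb c \<Longrightarrow> fst v \<le> m"
proof -
  assume a: "c \<in> C" "v \<in> orb c"
  then obtain i where i: "i \<le> len c" "v = (f ^^ i) (st c)" by (auto simp: orb_def)
  then show "fst v \<le> m"
    using at_len[OF a(1)] level[OF before_len[of i c]] by (cases "i = len c") auto
qed

lemma len_props: "c \<in> C \<Longrightarrow> m \<le> len c \<and> even (m + len c)"
  using path_level[where T = "len c" and x = "\<lambda>i. (f ^^ i) (st c)" and i = "len c", OF orb_step] at_len
  by (simp add: st_def)

lemma len_neq: "c \<in> C \<Longrightarrow> len c \<noteq> m \<Longrightarrow> m + 2 \<le> len c"
  using len_props[of c] by (metis Suc_leI add_2_eq_Suc' even_Suc even_add le_neq_implies_less odd_even_add order_antisym_conv not_less_eq_eq)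

lemma tight_if_len:
  assumes c: "c \<in> C" and len: "len c = m"
  shows "c \<le> 0 \<Longrightarrow> tight m f c 0" "c \<ge> 1 \<Longrightarrow> \<exists>j\<in>{1..m}. tight m f c j"
proof -
  let ?x = "\<lambda>i. (f ^^ i) (st c)"
  have step: "?x (Suc i) \<in> nbrs (?x i)" if "i < m" for i using orb_step that len by simp
  have x0: "fst (?x 0) = 0" by (simp add: st_def)
  have xm: "?x m = (m, c)" using at_len[OF c] len by simp
  have tI: "tight m f c j" if "\<And>i. i \<le> m \<Longrightarrow> ?x i = (i, col c j i)" for j
    unfolding tight_def
  proof (intro allI impI)
    fix l assume "l < m"
    then show "f (l, col c j l) = (Suc l, col c j (Suc l))"
      using that[of l] that[of "Suc l"] by simp
  qed
  show "tight m f c 0" if "c \<le> 0"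
    by (rule tI, subst straight_path(2)[of m ?x c, OF step x0 xm]) (use that in \<open>auto simp: st_def col_def\<close>)
  show "\<exists>j\<in>{1..m}. tight m f c j" if "c \<ge> 1"
    using straight_path(3)[of m ?x c, OF step x0 xm] that tI by (auto simp: st_def)
qed

text \<open>The types j for which \<open>col c j\<close> starts at the bottom vertex
  \<open>st c\<close>.\<close>

definition shape :: "int \<Rightarrow> nat \<Rightarrow> bool" where
  "shape c j \<longleftrightarrow> (if c \<le> 0 then j = 0 else j \<in> {1..m})"

lemma tight_pow:
  assumes "shape c j" "tight m f c j" "l \<le> m"
  shows "(f ^^ l) (st c) = (l, col c j l)"
  using assms(3)
proof (induction l)
  case 0
  then show ?case using assms(1) by (auto simp: st_def col_def shape_def split: if_splits)
next
  case (Suc l)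
  then show ?case using assms(2) by (simp add: tight_def)
qed

lemma tight_orb:
  assumes "c \<in> C" "shape c j" "tight m f c j" "l \<le> m"
  shows "(l, col c j l) \<in> orb c"
proof -
  have "m \<le> len c" using len_props assms by simp
  then show ?thesis unfolding orb_def using tight_pow[OF assms(2,3,4), symmetric] assms(4) by auto
qed

text \<open>If \<open>j' < j\<close>, then at level \<open>j'\<close> the path of \<open>c\<close>
  has not yet moved left while that of \<open>c + 1\<close> has, and both sit in column
  \<open>c + 1\<close>.\<close>

lemma tight_mono:
  assumes c: "c \<in> C" "c + 1 \<in> C" "c \<ge> 1"
    and t: "tight m f c j" "tight m f (c + 1) j'" and j: "j \<in> {1..m}" "j' \<in> {1..m}"
  shows "j \<le> j'"
proof (rule ccontr)
  assume a: "\<not> j \<le> j'"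
  have "(j', col c j j') \<in> orb c" "(j', col (c + 1) j' j') \<in> orb (c + 1)"
    using tight_orb[OF c(1) _ t(1)] tight_orb[OF c(2) _ t(2)] c j by (auto simp: shape_def)
  then show False using orb_disjoint[OF c(1,2)] a by (auto simp: col_def)
qed

lemma between_tight:
  assumes a: "a \<in> C" "shape a j" "tight m f a j" and b: "b \<in> C" "shape b j'" "tight m f b j'"
    and c: "a < c" "c < b" and v: "v \<in> orb c"
  shows "fst v \<le> m" "col a j (fst v) < snd v" "snd v < col b j' (fst v)"
proof -
  have cC: "c \<in> C" using a b c by auto
  show lv: "fst v \<le> m" using orb_level[OF cC v] .
  have "snd v \<noteq> col a j (fst v)"
    using orb_disjoint[OF a(1) cC] c tight_orb[OF a lv] v by (metis disjoint_iff less_irrefl prod.collapse)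
  moreover have "snd v \<noteq> col b j' (fst v)"
    using orb_disjoint[OF b(1) cC] c tight_orb[OF b lv] v by (metis disjoint_iff less_irrefl prod.collapse)
  moreover obtain i where i: "v = (f ^^ i) (st c)" using v by (auto simp: orb_def)
  have "col a j (fst (st c)) \<le> snd (st c)" "snd (st c) \<le> col b j' (fst (st c))"
    using a(2) b(2) c by (auto simp: st_def col_def shape_def split: if_splits)
  then have "col a j (fst v) \<le> snd v" "snd v \<le> col b j' (fst v)"
    using barrier_right_pow[OF a(3)] barrier_left_pow[OF b(3)] i by auto
  ultimately show "col a j (fst v) < snd v" "snd v < col b j' (fst v)" by auto
qed

section \<open>Counting vertices of disjoint paths\<close>

lemma card_orb_union:
  assumes "J \<subseteq> C" "finite Y" "\<And>c. c \<in> J \<Longrightarrow> orb c \<subseteq> Y"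
  shows "(\<Sum>c\<in>J. Suc (len c)) \<le> card Y"
proof -
  have finJ: "finite J" using assms(1) finite_subset by blast
  have "(\<Sum>c\<in>J. Suc (len c)) = card (\<Union>c\<in>J. orb c)"
    unfolding card_orb[symmetric]
    by (rule card_UN_disjoint[symmetric]) (use finJ finite_orb orb_disjoint subsetD[OF assms(1)] in blast)+
  also have "\<dots> \<le> card Y" using assms by (intro card_mono) auto
  finally show ?thesis .
qed

lemma sum_len_ge:
  assumes "J \<subseteq> C"
  shows "(m + 1) * card J + 2 * card {c \<in> J. len c \<noteq> m} \<le> (\<Sum>c\<in>J. Suc (len c))"
proof -
  have finJ: "finite J" using assms finite_subset by blast
  have "(m + 1) * card J + 2 * card {c \<in> J. len c \<noteq> m} = (\<Sum>c\<in>J. (m + 1) + (if len c \<noteq> m then 2 else 0))"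
    unfolding sum.distrib using finJ by (simp add: sum.If_cases Int_def)
  also have "\<dots> \<le> (\<Sum>c\<in>J. Suc (len c))"
  proof (rule sum_mono)
    fix c assume "c \<in> J"
    then have "c \<in> C" using assms by auto
    then show "(m + 1) + (if len c \<noteq> m then 2 else 0) \<le> Suc (len c)"
      using len_props[of c] len_neq[of c] by auto
  qed
  finally show ?thesis .
qed

text \<open>
  The region between the two straight paths has room for only one vertex besides directed paths, and
  by parity a path that is not directed uses at least two more.
\<close>

lemma all_tight_between:
  assumes a: "a \<in> C" "a \<le> 0" "tight m f a 0" and b: "b \<in> C" "b \<ge> 1" "tight m f b 1"
    and c: "a < c" "c < b"
  shows "len c = m"
proof (rule ccontr)
  assume ne: "len c \<noteq> m"
  \<comment> \<open>The path \<open>col b 1\<close> is in column b + 1 at level 0 and in column b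
    from level 1 on, so (0, b) is the only vertex of column b to its left.\<close>
  let ?J = "{a<..<b}" and ?Y = "{..m} \<times> {a<..<b} \<union> {(0, b)}"
  have shift: "shape a 0" "shape b 1" using a b m by (auto simp: shape_def)
  have J: "?J \<subseteq> C" using a b by auto
  have "orb d \<subseteq> ?Y" if "d \<in> ?J" for d
  proof
    fix v assume "v \<in> orb d"
    then have "fst v \<le> m" "a < snd v" "snd v < col b 1 (fst v)"
      using between_tight[OF a(1) shift(1) a(3) b(1) shift(2) b(3), of d v] that by (simp_all add: col_def)
    then show "v \<in> ?Y" by (cases v) (auto simp: col_def split: if_splits)
  qed
  then have "(\<Sum>d\<in>?J. Suc (len d)) \<le> card ?Y" using J by (intro card_orb_union) auto
  also have "card ?Y \<le> (m + 1) * card ?J + 1"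
    using card_Un_le[of "{..m} \<times> {a<..<b}" "{(0, b)}"] by (simp add: card_cartesian_product)
  finally have "2 * card {d \<in> ?J. len d \<noteq> m} \<le> 1" using sum_len_ge[OF J] by linarith
  then have "card {d \<in> ?J. len d \<noteq> m} = 0" by simp
  moreover have "c \<in> {d \<in> ?J. len d \<noteq> m}" using ne c by auto
  ultimately show False using finite_filter_set[of ?J "\<lambda>d. len d \<noteq> m"] by (metis card_0_eq empty_iff finite_greaterThanLessThan_int)
qed

text \<open>
  Columns $-K$ and $K$ contain $m + 1$ vertices each, so all but $2(m + 1)$ of the disjoint paths stay
  strictly between them, where there is almost no room beyond the $m + 1$ vertices that every path
  needs.
\<close>

lemma few_defects: "card {c \<in> C. len c \<noteq> m} \<le> defect_bound m"
proof -
  define touch where "touch y = {c \<in> C. orb c \<inter> ({..m} \<times> {y}) \<noteq> {}}" for y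
  have card_touch: "card (touch y) \<le> m + 1" for y
  proof -
    have "card (touch y) \<le> card ({..m} \<times> {y})"
      by (rule card_disjoint_meet[of _ _ orb]) (use orb_disjoint in \<open>auto simp: touch_def\<close>)
    then show ?thesis by (simp add: card_cartesian_product)
  qed
  let ?a = "- int K" and ?b = "int K"
  define J where "J = C - touch ?a - touch ?b"
  have JC: "J \<subseteq> C" and finC: "finite C" by (auto simp: J_def)
  have fin: "finite (touch y)" "finite J" for y
    by (rule finite_subset[OF _ finC]; auto simp: touch_def J_def)+
  have "orb c \<subseteq> {..m} \<times> {?a<..<?b}" if "c \<in> J" for c
  proof
    fix v assume v: "v \<in> orb c"
    have cC: "c \<in> C" using that JC by auto
    obtain i where i: "i \<le> len c" "v = (f ^^ i) (st c)" using v by (auto simp: orb_def)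
    have av: "snd ((f ^^ i) (st c)) \<noteq> y" if y: "c \<notin> touch y" and i: "i \<le> len c" for y i
    proof
      assume "snd ((f ^^ i) (st c)) = y"
      moreover have "(f ^^ i) (st c) \<in> orb c" using i by (auto simp: orb_def)
      ultimately have "(f ^^ i) (st c) \<in> orb c \<inter> ({..m} \<times> {y})"
        using orb_level[OF cC] by (cases "(f ^^ i) (st c)") auto
      then show False using y cC by (auto simp: touch_def)
    qed
    have ca: "c \<notin> touch ?a" "c \<notin> touch ?b" using that by (auto simp: J_def)
    have 1: "snd v < ?a \<longleftrightarrow> snd (st c) < ?a"
      using path_avoid_column[of "len c" "\<lambda>i. (f ^^ i) (st c)" ?a i, OF orb_step av[OF ca(1)] i(1)] i(2) by simp
    have 2: "snd v < ?b \<longleftrightarrow> snd (st c) < ?b"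
      using path_avoid_column[of "len c" "\<lambda>i. (f ^^ i) (st c)" ?b i, OF orb_step av[OF ca(2)] i(1)] i(2) by simp
    have "snd (st c) \<noteq> ?b" "snd v \<noteq> ?a" using av[OF ca(2), of 0] av[OF ca(1) i(1)] i(2) by auto
    then have "?a < snd v" "snd v < ?b" using 1 2 cC by (auto simp: st_def split: if_splits)
    then show "v \<in> {..m} \<times> {?a<..<?b}" using orb_level[OF cC v] by (cases v) auto
  qed
  then have "(\<Sum>c\<in>J. Suc (len c)) \<le> card ({..m} \<times> {?a<..<?b})" by (intro card_orb_union JC) auto
  also have "\<dots> = (m + 1) * (2 * K - 1)"
  proof -
    have "nat (2 * int K - 1) = 2 * K - 1" by simp
    then show ?thesis by (simp add: card_cartesian_product)
  qed
  finally have le: "(m + 1) * card J + 2 * card {c \<in> J. len c \<noteq> m} \<le> (m + 1) * (2 * K - 1)"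
    using sum_len_ge[OF JC] by linarith
  have "card C \<le> card J + (card (touch ?a) + card (touch ?b))"
  proof -
    have "C \<subseteq> J \<union> (touch ?a \<union> touch ?b)" by (auto simp: J_def)
    then have "card C \<le> card (J \<union> (touch ?a \<union> touch ?b))" using fin by (intro card_mono) auto
    also have "\<dots> \<le> card J + (card (touch ?a) + card (touch ?b))"
      using card_Un_le[of J "touch ?a \<union> touch ?b"] card_Un_le[of "touch ?a" "touch ?b"] by linarith
    finally show ?thesis .
  qed
  \<comment> \<open>There are 2K paths against 2K - 1 columns strictly between -K and K; this
    off-by-one helps to pass from 2(m + 1) to 2m + 1.\<close>
  then have "2 * K \<le> card J + 2 * (m + 1)" using card_touch[of ?a] card_touch[of ?b] by simp
  then have "2 * K - 1 \<le> card J + (2 * m + 1)" by simp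
  then have "(m + 1) * (2 * K - 1) \<le> (m + 1) * (card J + (2 * m + 1))" by (rule mult_le_mono2)
  also have "\<dots> = (m + 1) * card J + (m + 1) * (2 * m + 1)" by (rule add_mult_distrib2)
  finally have "2 * card {c \<in> J. len c \<noteq> m} \<le> (m + 1) * (2 * m + 1)" using le by linarith
  then have J1: "card {c \<in> J. len c \<noteq> m} \<le> (m + 1) * (2 * m + 1)" by linarith
  have "{c \<in> C. len c \<noteq> m} \<subseteq> {c \<in> J. len c \<noteq> m} \<union> (touch ?a \<union> touch ?b)" by (auto simp: J_def)
  then have "card {c \<in> C. len c \<noteq> m} \<le> card ({c \<in> J. len c \<noteq> m} \<union> (touch ?a \<union> touch ?b))"
    using fin by (intro card_mono) auto
  also have "\<dots> \<le> card {c \<in> J. len c \<noteq> m} + (card (touch ?a) + card (touch ?b))"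
    using card_Un_le[of "{c \<in> J. len c \<noteq> m}" "touch ?a \<union> touch ?b"] card_Un_le[of "touch ?a" "touch ?b"] by linarith
  also have "\<dots> \<le> (m + 1) * (2 * m + 1) + 2 * (m + 1)" using J1 card_touch[of ?a] card_touch[of ?b] by presburger
  also have "\<dots> = defect_bound m" by (simp add: defect_bound_def algebra_simps)
  finally show ?thesis .
qed

section \<open>Pigeonhole for straight and parallel paths\<close>

lemma straight_exists:
  assumes "I \<subseteq> C" "card I > defect_bound m"
  shows "\<exists>c\<in>I. len c = m"
proof (rule ccontr)
  assume "\<not> (\<exists>c\<in>I. len c = m)"
  then have "I \<subseteq> {c \<in> C. len c \<noteq> m}" using assms(1) by auto
  then have "card I \<le> card {c \<in> C. len c \<noteq> m}" by (intro card_mono finite_filter_set) auto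
  then show False using few_defects assms(2) by simp
qed

text \<open>Of \<open>defect_bound m + 1\<close> disjoint blocks of length \<open>N\<close>, one
  contains no defect.\<close>

lemma straight_block:
  fixes N :: nat
  assumes N: "N \<ge> 1" and a: "a \<ge> 0" "a + int ((defect_bound m + 1) * N) \<le> int K"
  shows "\<exists>b\<le>defect_bound m. \<forall>c\<in>{a + int (b * N)..<a + int ((b + 1) * N)}. c \<in> C \<and> len c = m"
proof (rule ccontr)
  let ?I = "\<lambda>b. {a + int (b * N)..<a + int ((b + 1) * N)}"
  have IC: "?I b \<subseteq> C" if "b \<le> defect_bound m" for b
  proof -
    have "(b + 1) * N \<le> (defect_bound m + 1) * N" using that by (intro mult_le_mono1) simp
    then have "int ((b + 1) * N) \<le> int ((defect_bound m + 1) * N)" by (simp only: of_nat_le_iff)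
    moreover have "0 \<le> int (b * N)" by simp
    ultimately show ?thesis using a by (intro subsetI) (simp only: atLeastLessThan_iff atLeastAtMost_iff, linarith)
  qed
  assume "\<not> (\<exists>b\<le>defect_bound m. \<forall>c\<in>?I b. c \<in> C \<and> len c = m)"
  then have "\<forall>b\<in>{..defect_bound m}. \<exists>c. c \<in> ?I b \<and> len c \<noteq> m" using IC by blast
  then obtain g where g: "\<And>b. b \<le> defect_bound m \<Longrightarrow> g b \<in> ?I b \<and> len (g b) \<noteq> m" by (metis atMost_iff)
  have less: "g b < g b'" if "b < b'" "b' \<le> defect_bound m" for b b'
  proof -
    have "(b + 1) * N \<le> b' * N" using that by (intro mult_le_mono1) simp
    then have "int ((b + 1) * N) \<le> int (b' * N)" by (simp only: of_nat_le_iff)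
    then show ?thesis using g[of b] g[of b'] that by auto
  qed
  have "inj_on g {..defect_bound m}"
    by (rule inj_onI) (metis atMost_iff less less_irrefl linorder_neqE_nat)
  then have "card {..defect_bound m} \<le> card {c \<in> C. len c \<noteq> m}"
  proof (rule card_inj_on_le)
    show "g ` {..defect_bound m} \<subseteq> {c \<in> C. len c \<noteq> m}" using g IC by blast
    show "finite {c \<in> C. len c \<noteq> m}" by (rule finite_filter_set) simp
  qed
  then show False using few_defects by simp
qed

text \<open>The types of successive straight paths increase weakly and lie in {1..m}, so they cannot
  change within each of m consecutive blocks.\<close>

lemma constant_subblock:
  fixes a :: int and L :: nat
  assumes L: "L \<ge> 1" and a: "a \<ge> 1"
    and str: "\<And>c. c \<in> {a..<a + int (m * L)} \<Longrightarrow> c \<in> C \<and> len c = m"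
  shows "\<exists>q<m. \<exists>j\<in>{1..m}. \<forall>c\<in>{a + int (q * L)..<a + int (q * L) + int L}. tight m f c j"
proof -
  let ?I = "{a..<a + int (m * L)}"
  have "\<exists>j\<in>{1..m}. tight m f c j" if "c \<in> ?I" for c
    using tight_if_len(2)[of c] str[OF that] that a by auto
  then obtain js where js: "\<And>c. c \<in> ?I \<Longrightarrow> js c \<in> {1..m} \<and> tight m f c (js c)" by metis
  have mono1: "js (c + int d) \<ge> js c" if "c \<in> ?I" "c + int d \<in> ?I" for c d
    using that(2)
  proof (induction d)
    case (Suc d)
    then have i: "c + int d \<in> ?I" "c + int d + 1 \<in> ?I" using that(1) by auto
    have "js (c + int d) \<le> js (c + int d + 1)"
    proof (rule tight_mono)
      show "c + int d \<in> C" "c + int d + 1 \<in> C" using str[OF i(1)] str[OF i(2)] by auto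
      show "1 \<le> c + int d" using i a by auto
      show "tight m f (c + int d) (js (c + int d))" "js (c + int d) \<in> {1..m}"
        "tight m f (c + int d + 1) (js (c + int d + 1))" "js (c + int d + 1) \<in> {1..m}"
        using js[OF i(1)] js[OF i(2)] by auto
    qed
    moreover have "c + int (Suc d) = c + int d + 1" by simp
    ultimately show ?case using Suc.IH[OF i(1)] by (metis order_trans)
  qed simp
  have mono: "js c \<le> js d" if "c \<in> ?I" "d \<in> ?I" "c \<le> d" for c d
    using mono1[of c "nat (d - c)"] that by simp
  have inI: "c \<in> ?I" if "q < m" "c \<in> {a + int (q * L)..<a + int (q * L) + int L}" for q c
  proof -
    have "(q + 1) * L \<le> m * L" using that(1) by (intro mult_le_mono1) simp
    then have "q * L + L \<le> m * L" by simp
    then have "int (q * L) + int L \<le> int (m * L)" by (simp only: of_nat_add[symmetric] of_nat_le_iff)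
    moreover have "0 \<le> int (q * L)" by simp
    ultimately show ?thesis using that(2) by (simp only: atLeastLessThan_iff) linarith
  qed
  have "\<exists>q<m. \<forall>c\<in>{a + int (q * L)..<a + int (q * L) + int L}. js c = js (a + int (q * L))"
  proof (rule ccontr)
    assume con: "\<not> ?thesis"
    \<comment> \<open>A change in every block raises the type by at least one per block, starting
      from type 1.\<close>
    have "q < m \<Longrightarrow> js (a + int (q * L) + int (L - 1)) \<ge> q + 2" for q
    proof (induction q)
      case 0
      have i0: "a \<in> ?I" using inI[of 0 a] 0 L by auto
      obtain c where c: "c \<in> {a + int (0 * L)..<a + int (0 * L) + int L}" "js c \<noteq> js a" using con 0 by auto
      have "js a < js c" using mono[OF i0 inI[OF 0 c(1)]] c by auto
      moreover have "js c \<le> js (a + int (L - 1))"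
        by (rule mono[OF inI[OF 0 c(1)]]) (use c(1) L inI[OF 0, of "a + int (L - 1)"] in auto)
      ultimately show ?case using js[OF i0] by auto
    next
      case (Suc q)
      let ?e = "a + int (q * L) + int (L - 1)" and ?s = "a + int (Suc q * L)"
      have e: "?e \<in> ?I" by (rule inI[of q]) (use Suc.prems L in auto)
      have s: "?s \<in> ?I" by (rule inI[OF Suc.prems]) (use L in auto)
      obtain c where c: "c \<in> {?s..<?s + int L}" "js c \<noteq> js ?s" using con Suc.prems by blast
      note ci = inI[OF Suc.prems c(1)]
      have "q + 2 \<le> js ?e" using Suc by simp
      also have "\<dots> \<le> js ?s" by (rule mono[OF e s]) (use L in \<open>simp add: of_nat_diff\<close>)
      also have "js ?s < js c" using mono[OF s ci] c by auto
      also have "js c \<le> js (?s + int (L - 1))"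
        by (rule mono[OF ci inI[OF Suc.prems]]) (use c(1) L in \<open>auto simp: of_nat_diff\<close>)
      finally show ?case by simp
    qed
    from this[of "m - 1"] have "m + 1 \<le> js (a + int ((m - 1) * L) + int (L - 1))" using m by simp
    moreover have "a + int ((m - 1) * L) + int (L - 1) \<in> ?I" by (rule inI[of "m - 1"]) (use m L in auto)
    ultimately show False using js by fastforce
  qed
  then obtain q where q: "q < m" "\<And>c. c \<in> {a + int (q * L)..<a + int (q * L) + int L} \<Longrightarrow> js c = js (a + int (q * L))"
    by blast
  have "js (a + int (q * L)) \<in> {1..m}" using js inI[OF q(1), of "a + int (q * L)"] L by auto
  moreover have "tight m f c (js (a + int (q * L)))" if "c \<in> {a + int (q * L)..<a + int (q * L) + int L}" for c
    using js[OF inI[OF q(1) that]] q(2)[OF that] by simp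
  ultimately show ?thesis using q(1) by blast
qed

text \<open>\<open>a\<close> and \<open>r\<close> are the straight paths nearest to vertex 1 on
  either side. If \<open>r\<close> had type 1, everything between them would be straight by
  \<open>all_tight_between\<close>, hence \<open>a = 0\<close> and \<open>r = 1\<close>, and the
  configuration would not be bad. The run of parallel paths starts at B + 2 or later, so to the
  right of \<open>r\<close>, and only at multiples of M + 1 from there; this keeps the number of
  possible data independent of \<open>M\<close> and \<open>K\<close>.\<close>

lemma bad_structure:
  fixes M :: nat
  defines "B \<equiv> defect_bound m"
  assumes K: "int B + 2 + int ((B + 1) * (m * (M + 1))) \<le> int K"
    and bad: "\<not> (tight m f 0 0 \<and> tight m f 1 1)"
  shows "\<exists>a\<in>{- int B..0}. \<exists>r\<in>{1..int B + 1}. \<exists>j\<in>{2..m}. \<exists>q<(B + 1) * m. \<exists>j'\<in>{1..m}.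
    tight m f a 0 \<and> tight m f r j \<and>
    (\<forall>c\<in>{int B + 2 + int (q * (M + 1))..int B + 2 + int (q * (M + 1)) + int M}. tight m f c j')"
proof -
  have KB: "int B + 2 \<le> int K" using K by linarith
  let ?S = "{c \<in> {- int B..0}. len c = m}" and ?R = "{c \<in> {1..int B + 1}. len c = m}"
  have "\<exists>c\<in>{- int B..0}. len c = m" by (rule straight_exists) (use KB in \<open>auto simp: B_def\<close>)
  moreover have "finite ?S" by (rule finite_filter_set) simp
  ultimately have Sne: "?S \<noteq> {}" "finite ?S" by blast+
  have "\<exists>c\<in>{1..int B + 1}. len c = m" by (rule straight_exists) (use KB in \<open>auto simp: B_def\<close>)
  moreover have "finite ?R" by (rule finite_filter_set) simp
  ultimately have Rne: "?R \<noteq> {}" "finite ?R" by blast+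
  define a where "a = Max ?S"
  define r where "r = Min ?R"
  have a: "a \<in> {- int B..0}" "len a = m" using Max_in[OF Sne(2,1)] by (auto simp: a_def)
  have r: "r \<in> {1..int B + 1}" "len r = m" using Min_in[OF Rne(2,1)] by (auto simp: r_def)
  have amax: "c \<le> a" if "c \<in> {- int B..0}" "len c = m" for c
    unfolding a_def using that Sne by (intro Max_ge) auto
  have rmin: "r \<le> c" if "c \<in> {1..int B + 1}" "len c = m" for c
    unfolding r_def using that Rne by (intro Min_le) auto
  have aC: "a \<in> C" and rC: "r \<in> C" using a r KB by auto
  have ta: "tight m f a 0" using tight_if_len(1)[OF aC a(2)] a by auto
  obtain j where j: "j \<in> {1..m}" "tight m f r j" using tight_if_len(2)[OF rC r(2)] r by auto
  have "j \<noteq> 1"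
  proof
    assume j1: "j = 1"
    have str: "len c = m" if "a < c" "c < r" for c
      using all_tight_between[OF aC _ ta rC, of c] a r j j1 that by auto
    have "a = 0"
    proof (rule ccontr)
      assume "a \<noteq> 0"
      then have "a + 1 \<le> 0" "a < a + 1" "a + 1 < r" using a r by auto
      then show False using amax[of "a + 1"] str[of "a + 1"] a by auto
    qed
    moreover have "r = 1"
    proof (rule ccontr)
      assume "r \<noteq> 1"
      then have "1 \<le> r - 1" "a < r - 1" using a r by auto
      then show False using rmin[of "r - 1"] str[of "r - 1"] r by auto
    qed
    ultimately show False using bad ta j j1 by simp
  qed
  then have j2: "j \<in> {2..m}" using j by auto
  obtain b where b: "b \<le> B" "\<And>c. c \<in> {int B + 2 + int (b * (m * (M + 1)))..<int B + 2 + int ((b + 1) * (m * (M + 1)))} \<Longrightarrow> c \<in> C \<and> len c = m"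
    using straight_block[of "m * (M + 1)" "int B + 2"] K m unfolding B_def by auto
  have "\<exists>q<m. \<exists>j\<in>{1..m}. \<forall>c\<in>{int B + 2 + int (b * (m * (M + 1))) + int (q * (M + 1))..<int B + 2 + int (b * (m * (M + 1))) + int (q * (M + 1)) + int (M + 1)}. tight m f c j"
  proof (rule constant_subblock)
    show "1 \<le> int B + 2 + int (b * (m * (M + 1)))" by linarith
    fix c assume "c \<in> {int B + 2 + int (b * (m * (M + 1)))..<int B + 2 + int (b * (m * (M + 1))) + int (m * (M + 1))}"
    then show "c \<in> C \<and> len c = m" using b(2)[of c] by (simp add: distrib_right)
  qed simp
  then obtain q j' where q: "q < m" "j' \<in> {1..m}" and t: "\<And>c. c \<in> {int B + 2 + int (b * (m * (M + 1))) + int (q * (M + 1))..<int B + 2 + int (b * (m * (M + 1))) + int (q * (M + 1)) + int (M + 1)} \<Longrightarrow> tight m f c j'"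
    by blast
  define p where "p = b * m + q"
  have "p < (b + 1) * m" using q by (simp add: p_def)
  also have "\<dots> \<le> (B + 1) * m" using b(1) by (intro mult_le_mono1) simp
  finally have p: "p < (B + 1) * m" .
  have eq: "int (b * (m * (M + 1))) + int (q * (M + 1)) = int (p * (M + 1))"
    unfolding of_nat_add[symmetric] p_def by (simp add: algebra_simps)
  have "tight m f c j'" if "c \<in> {int B + 2 + int (p * (M + 1))..int B + 2 + int (p * (M + 1)) + int M}" for c
    by (rule t) (use that eq in auto)
  then show ?thesis using a(1) r(1) j2 p q(2) ta j(2) by blast
qed

end

section \<open>Splicing along straight paths\<close>

text \<open>The standard configuration: vertical pointers, except that the bottom vertices from 2 on
  start with their high edge. Vertex (0, 1) is fixed, as \<tau> demands.\<close>

definition upward :: "nat \<Rightarrow> vertex \<Rightarrow> vertex" where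
  "upward m v = (if m \<le> fst v \<or> v = (0, 1) then v
    else if fst v = 0 \<and> 2 \<le> snd v then (1, snd v - 1) else (Suc (fst v), snd v))"

definition shift :: "int \<Rightarrow> vertex \<Rightarrow> vertex" where
  "shift d v = (fst v, snd v + d)"

text \<open>
  Insert \<open>d\<close> copies of the straight path with \<open>j = 1\<close> to the left of the path \<open>col r j\<close>, move everything
  between \<open>col r j\<close> and \<open>col r' j'\<close> to the right by \<open>d\<close>, and drop \<open>d\<close> of the parallel paths that follow
  \<open>col r' j'\<close>. The configuration between column \<open>a\<close> and \<open>col r j\<close> is overwritten by the standard one.
\<close>

definition splice :: "nat \<Rightarrow> int \<Rightarrow> int \<Rightarrow> nat \<Rightarrow> int \<Rightarrow> nat \<Rightarrow> int \<Rightarrow> (vertex \<Rightarrow> vertex) \<Rightarrow> vertex \<Rightarrow> vertex" where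
  "splice m a r j r' j' d f v =
    (if snd v \<le> a then f v
     else if snd v < col r j (fst v) + d then upward m v
     else if snd v < col r' j' (fst v) + d then shift d (f (shift (- d) v))
     else f v)"

lemma fst_shift [simp]: "fst (shift d v) = fst v" and snd_shift [simp]: "snd (shift d v) = snd v + d"
  by (simp_all add: shift_def)

lemma shift_shift [simp]: "shift d (shift e v) = shift (d + e) v"
  by (simp add: shift_def)

lemma shift_0 [simp]: "shift 0 v = v"
  by (simp add: shift_def)

lemma shift_nbrs: "u \<in> nbrs v \<Longrightarrow> shift d u \<in> nbrs (shift d v)"
  by (cases v) (auto simp: shift_def split: if_splits)

lemma col_bounds: "c \<le> col c j l" "col c j l \<le> c + 1"
  by (auto simp: col_def)

lemma upward_nbrs: "fst v < m \<Longrightarrow> v \<noteq> (0, 1) \<Longrightarrow> upward m v \<in> nbrs v"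
  by (cases v) (auto simp: upward_def)

text \<open>Used to read off roots after splicing: on a region \<open>S\<close> closed under
  \<open>f\<close>, the map \<open>h\<close> (the identity or a shift) carries orbits of
  \<open>f\<close> to orbits of the spliced map.\<close>

lemma conj_pow:
  assumes "\<And>v. v \<in> S \<Longrightarrow> f v \<in> S \<and> g (h v) = h (f v)" "v \<in> S"
  shows "(f ^^ i) v \<in> S \<and> (g ^^ i) (h v) = h ((f ^^ i) v)"
  using assms by (induction i) auto

lemma conj_reaches:
  assumes "\<And>v. v \<in> S \<Longrightarrow> f v \<in> S \<and> g (h v) = h (f v)" "v \<in> S" "reaches f v w"
  shows "w \<in> S \<and> reaches g (h v) (h w)"
  using conj_pow[of S f g h v, OF assms(1,2)] assms(3) unfolding reaches_def by metis

text \<open>The paths at \<open>r'\<close> and \<open>r' + d\<close> have the same type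
  \<open>j'\<close>, so \<open>col r' j'\<close> shifted by \<open>d\<close> is the path at
  \<open>r' + d\<close>, and the moved block closes up against the unchanged right part.\<close>

locale splicing = strip_grove +
  fixes a r r' d :: int and j j' :: nat
  assumes a: "a \<le> 0" "- int K \<le> a" and r: "1 \<le> r" "r < r'" "r' + d \<le> int K - 1" and d: "0 \<le> d"
    and j: "j \<in> {2..m}" and j': "j' \<in> {1..m}"
    and ta: "tight m f a 0" and tr: "tight m f r j" and tr': "tight m f r' j'"
    and trd: "tight m f (r' + d) j'"
begin

abbreviation g where "g \<equiv> splice m a r j r' j' d f"

abbreviation D where "D \<equiv> U \<union> P"

text \<open>After splicing, (0, 1) is a root even if \<open>f\<close> is a \<sigma>-configuration,
  so that both kinds are compared with \<tau>-configurations.\<close>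

abbreviation D' where "D' \<equiv> U \<union> (starts K - {(0, 1)})"

lemma D'_D: "D' \<subseteq> D"
  using P by auto

lemma in_D':
  assumes "\<bar>snd v\<bar> \<le> int K" "fst v < m" "v \<noteq> (0, 1)"
  shows "v \<in> D'"
proof (cases "fst v = 0")
  case True
  then show ?thesis using assms by (cases v) (auto simp: starts_def)
next
  case False
  then have "v \<in> {0<..<m} \<times> {- int K..int K}" using assms by (cases v) auto
  then show ?thesis using window by auto
qed

lemma level_D': "v \<in> D' \<Longrightarrow> fst v < m"
  using level D'_D by blast

lemma not_01_D': "(0, 1) \<notin> D'"
  using U by auto

lemma mid_shift_in_D':
  assumes "col r j (fst v) \<le> snd v" "snd v \<le> col r' j' (fst v)" "fst v < m"
  shows "v \<in> D'"
proof (rule in_D')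
  show "\<bar>snd v\<bar> \<le> int K" using assms r d col_bounds[of r j "fst v"] col_bounds[of r' j' "fst v"] by linarith
  show "v \<noteq> (0, 1)" using assms r j by (auto simp: col_def)
qed (rule assms(3))

section \<open>The spliced map as a \<tau>-configuration\<close>

lemma splice_nb:
  assumes v: "v \<in> D'"
  shows "g v \<in> nbrs v"
proof -
  have vD: "v \<in> D" using v D'_D by auto
  have lv: "fst v < m" using level_D'[OF v] .
  have v01: "v \<noteq> (0, 1)" using v not_01_D' by auto
  have "shift d (f (shift (- d) v)) \<in> nbrs v" if c: "col r j (fst v) + d \<le> snd v" "snd v < col r' j' (fst v) + d"
  proof -
    have "shift (- d) v \<in> D'" by (rule mid_shift_in_D') (use c lv in auto)
    then have "f (shift (- d) v) \<in> nbrs (shift (- d) v)" using pointers_nb[OF ptr] D'_D by blast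
    from shift_nbrs[OF this, of d] show ?thesis by simp
  qed
  then show ?thesis
    using pointers_nb[OF ptr vD] upward_nbrs[OF lv v01] unfolding splice_def by simp
qed

lemma splice_out:
  assumes v: "v \<notin> D'"
  shows "g v = v"
proof (cases "v = (0, 1)")
  case True
  then show ?thesis using a r d col_bounds(1)[of r j 0] j by (simp add: splice_def upward_def col_def)
next
  case False
  have fv: "f v = v" using v False P by (intro pointers_out[OF ptr]) auto
  have big: "m \<le> fst v" if "a < snd v" "snd v \<le> col r' j' (fst v) + d"
    using in_D'[of v] False v that a r d col_bounds[of r' j' "fst v"] by force
  have "upward m v = v" if "a < snd v" "snd v < col r j (fst v) + d"
    using big[OF that(1)] that r col_bounds[of r j "fst v"] col_bounds[of r' j' "fst v"]
    by (auto simp: upward_def)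
  moreover have "shift d (f (shift (- d) v)) = v" if "a < snd v" "snd v < col r' j' (fst v) + d"
    using top[of "shift (- d) v"] big[OF that(1)] that by simp
  ultimately show ?thesis using fv unfolding splice_def by simp
qed

lemma left_region: "v \<in> {v. snd v \<le> a} \<Longrightarrow> f v \<in> {v. snd v \<le> a} \<and> g (id v) = id (f v)"
  using barrier_left[OF ta, of v] by (simp add: splice_def col_def)

lemma right_region:
  "v \<in> {v. col r' j' (fst v) + d \<le> snd v} \<Longrightarrow>
    f v \<in> {v. col r' j' (fst v) + d \<le> snd v} \<and> g (id v) = id (f v)"
proof -
  assume v: "v \<in> {v. col r' j' (fst v) + d \<le> snd v}"
  have "col (r' + d) j' l = col r' j' l + d" for l by (simp add: col_def)
  then have 1: "f v \<in> {v. col r' j' (fst v) + d \<le> snd v}" using barrier_right[OF trd, of v] v by simp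
  have "a < snd v" "col r j (fst v) + d \<le> snd v"
    using v a r d col_bounds[of r j "fst v"] col_bounds[of r' j' "fst v"] by auto
  then show ?thesis using v 1 by (simp add: splice_def)
qed

lemma mid_region:
  "v \<in> {v. col r j (fst v) \<le> snd v \<and> snd v \<le> col r' j' (fst v)} \<Longrightarrow>
    f v \<in> {v. col r j (fst v) \<le> snd v \<and> snd v \<le> col r' j' (fst v)} \<and> g (shift d v) = shift d (f v)"
proof -
  assume v: "v \<in> {v. col r j (fst v) \<le> snd v \<and> snd v \<le> col r' j' (fst v)}"
  have 1: "f v \<in> {v. col r j (fst v) \<le> snd v \<and> snd v \<le> col r' j' (fst v)}"
    using barrier_right[OF tr, of v] barrier_left[OF tr', of v] v by simp
  have 2: "\<not> snd v + d \<le> a" using v a r d col_bounds[of r j "fst v"] by auto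
  have "g (shift d v) = shift d (f v)"
  proof (cases "snd v < col r' j' (fst v)")
    case True
    then show ?thesis using v 2 by (simp add: splice_def)
  next
    case False
    \<comment> \<open>On the right seam the splice already uses \<open>f\<close> at
      \<open>r' + d\<close>; both paths have type \<open>j'\<close>, so the values agree.\<close>
    then have eq: "snd v = col r' j' (fst v)" using v by auto
    have g: "g (shift d v) = f (shift d v)" using v 2 eq by (simp add: splice_def)
    show ?thesis
    proof (cases "fst v < m")
      case True
      have "f (shift d v) = (Suc (fst v), col (r' + d) j' (Suc (fst v)))"
        using trd True eq by (simp add: tight_def shift_def col_def add_ac)
      moreover have "f v = (Suc (fst v), col r' j' (Suc (fst v)))"
        using tr' True eq by (metis tight_def prod.collapse)
      ultimately show ?thesis using g by (simp add: shift_def col_def)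
    next
      case False
      then show ?thesis using g top[of v] top[of "shift d v"] by simp
    qed
  qed
  then show ?thesis using 1 by simp
qed

lemma left_reaches: "snd v \<le> a \<Longrightarrow> reaches g v (root_of f v)"
  using conj_reaches[of "{v. snd v \<le> a}" f g id v "root_of f v", OF left_region] root_of_reaches[OF ptr] by simp

lemma right_reaches: "col r' j' (fst v) + d \<le> snd v \<Longrightarrow> reaches g v (root_of f v)"
  using conj_reaches[of "{v. col r' j' (fst v) + d \<le> snd v}" f g id v "root_of f v", OF right_region]
    root_of_reaches[OF ptr] by simp

lemma mid_reaches:
  assumes v: "col r j (fst v) \<le> snd v" "snd v \<le> col r' j' (fst v)"
  shows "reaches g (shift d v) (shift d (root_of f v))" "shift d (root_of f v) \<notin> D'"
proof -
  let ?S = "{v. col r j (fst v) \<le> snd v \<and> snd v \<le> col r' j' (fst v)}"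
  have *: "root_of f v \<in> ?S \<and> reaches g (shift d v) (shift d (root_of f v))"
    using conj_reaches[of ?S f g "shift d" v "root_of f v", OF mid_region] v root_of_reaches[OF ptr] by simp
  then show "reaches g (shift d v) (shift d (root_of f v))" by simp
  have "root_of f v \<notin> D'" using root_of_notin[OF ptr, of v] D'_D by auto
  then have "m \<le> fst (root_of f v)" using mid_shift_in_D'[of "root_of f v"] * by force
  then show "shift d (root_of f v) \<notin> D'" using level_D'[of "shift d (root_of f v)"] by auto
qed

text \<open>In the overwritten zone the level grows until the orbit meets the top, vertex (0, 1), or
  the moved path \<open>col r j\<close>. The last can happen because that path steps one column to
  the left on reaching level \<open>j\<close>.\<close>

lemma std_exit:
  assumes "a < snd v" "snd v < col r j (fst v) + d"
  shows "\<exists>w. w \<notin> D' \<and> reaches g v w"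
  using assms
proof (induction "m - fst v" arbitrary: v)
  case 0
  then have "v \<notin> D'" using level_D'[of v] by auto
  then show ?case by (intro exI[of _ v]) simp
next
  case (Suc k)
  show ?case
  proof (cases "v = (0, 1)")
    case True
    then show ?thesis using not_01_D' by (intro exI[of _ v]) simp
  next
    case False
    have lv: "fst v < m" using Suc.hyps by simp
    have gv: "g v = upward m v" using Suc.prems by (simp add: splice_def)
    have w: "fst (g v) = Suc (fst v)" "a < snd (g v)" "snd (g v) \<le> snd v"
      using gv lv False Suc.prems a by (auto simp: upward_def)
    show ?thesis
    proof (cases "snd (g v) < col r j (fst (g v)) + d")
      case True
      have "k = m - fst (g v)" using Suc.hyps w by simp
      from Suc.hyps(1)[OF this w(2) True] show ?thesis using reaches_from_step by metis
    next
      case False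
      have "col r j (fst (shift (- d) (g v))) \<le> snd (shift (- d) (g v))" using False by simp
      moreover have "snd (shift (- d) (g v)) \<le> col r' j' (fst (shift (- d) (g v)))"
        using w Suc.prems r col_bounds[of r j "fst v"] col_bounds[of r' j' "fst (g v)"] by simp
      ultimately have "\<exists>w. w \<notin> D' \<and> reaches g (g v) w"
        using mid_reaches[of "shift (- d) (g v)"] by (intro exI[of _ "shift d (root_of f (shift (- d) (g v)))"] conjI) simp_all
      then show ?thesis using reaches_from_step by metis
    qed
  qed
qed

lemma splice_exit: "\<exists>w. w \<notin> D' \<and> reaches g v w"
proof -
  consider "snd v \<le> a" | "a < snd v" "snd v < col r j (fst v) + d"
    | "col r j (fst v) + d \<le> snd v" "snd v \<le> col r' j' (fst v) + d" | "col r' j' (fst v) + d \<le> snd v"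
    by linarith
  then show ?thesis
  proof cases
    case 1
    then show ?thesis using left_reaches root_of_notin[OF ptr, of v] D'_D by blast
  next
    case 2
    then show ?thesis by (rule std_exit)
  next
    case 3
    then show ?thesis
      using mid_reaches[of "shift (- d) v"] by (intro exI[of _ "shift d (root_of f (shift (- d) v))"] conjI) simp_all
  next
    case 4
    then show ?thesis using right_reaches root_of_notin[OF ptr, of v] D'_D by blast
  qed
qed

lemma splice_pointers: "g \<in> pointers nbrs D'"
proof -
  have "\<exists>i. (g ^^ i) v \<notin> D'" for v
  proof -
    obtain w i where "w \<notin> D'" "(g ^^ i) v = w" using splice_exit[of v] unfolding reaches_def by force
    then show ?thesis by (intro exI[of _ i]) simp
  qed
  then show ?thesis unfolding pointers_def using splice_nb splice_out by auto
qed

lemma splice_vertical: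
  assumes "a < x" "x < r + d" "l + i \<le> m" "l \<ge> 1 \<or> x \<le> 0"
  shows "(g ^^ i) (l, x) = (l + i, x)"
  using assms(3)
proof (induction i)
  case (Suc i)
  have "g (l + i, x) = upward m (l + i, x)"
    using assms col_bounds[of r j "l + i"] by (simp add: splice_def)
  also have "\<dots> = (Suc (l + i), x)" using assms Suc.prems by (auto simp: upward_def)
  finally show ?case using Suc by simp
qed simp

lemma splice_roots:
  assumes p: "p \<in> starts K - {(0, 1)}"
  shows "root_of g p = target m p"
proof -
  obtain k where pk: "p = (0, k)" "- int K \<le> k" "k \<le> int K" "k \<noteq> 1"
  proof -
    have "p \<in> {0} \<times> {- int K..int K}" "p \<noteq> (0, 1)" using p by (simp_all add: starts_def)
    then show thesis using that[of "snd p"] by (cases p) simp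
  qed
  have pP: "p \<in> P" using p P by auto
  have gm: "g (m, x) = (m, x)" for x
    by (rule splice_out) (use level_D'[of "(m, x)"] in \<open>simp only: fst_conv less_irrefl, blast\<close>)
  have c0: "col r j 0 = r + 1" "col r' j' 0 = r' + 1" using j j' by (auto simp: col_def)
  have "reaches g p (target m p)"
  proof -
    consider "k \<le> a" | "a < k" "k \<le> 0" | "2 \<le> k" "k < r + 1 + d"
      | "r + 1 + d \<le> k" "k \<le> r' + 1 + d" | "r' + 1 + d \<le> k" using pk by linarith
    then show ?thesis
    proof cases
      case 1
      then show ?thesis using left_reaches[of p] root[OF pP] pk by simp
    next
      case 2
      then have "(g ^^ m) (0, k) = (0 + m, k)" using r d by (intro splice_vertical) auto
      then show ?thesis using pk 2 by (auto simp: reaches_def target_def)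
    next
      case 3
      have "g p = upward m p" using 3 c0 a pk by (simp add: splice_def)
      also have "\<dots> = (1, k - 1)" using 3 pk m by (simp add: upward_def)
      finally have "g p = (1, k - 1)" .
      moreover have "(g ^^ (m - 1)) (1, k - 1) = (1 + (m - 1), k - 1)"
        using 3 a m by (intro splice_vertical) auto
      then have "reaches g (1, k - 1) (m, k - 1)" using m by (auto simp: reaches_def)
      ultimately have "reaches g p (m, k - 1)" using reaches_from_step by metis
      then show ?thesis using 3 pk by (simp add: target_def)
    next
      case 4
      \<comment> \<open>The start moved back by \<open>d\<close> is still at least 2, and there
        \<open>target\<close> commutes with the shift.\<close>
      have k: "(0, k - d) \<in> P" using 4 P r d pk by (auto simp: starts_def)
      have "reaches g (shift d (0, k - d)) (shift d (root_of f (0, k - d)))"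
        by (rule mid_reaches) (use 4 c0 in auto)
      then show ?thesis using root[OF k] 4 pk r d by (simp add: target_def shift_def)
    next
      case 5
      then show ?thesis using right_reaches[of p] root[OF pP] pk c0 by simp
    qed
  qed
  then show ?thesis by (intro root_of_eqI) (simp_all add: target_def gm)
qed

lemma splice_rooted: "g \<in> rooted nbrs (target m) (starts K - {(0, 1)}) U"
  unfolding rooted_def using splice_pointers splice_roots by simp

text \<open>Makes \<open>d\<close> readable at the bottom: the inserted paths leave by a high edge,
  and the first path of the moved block leaves by a low edge because
  \<open>j \<ge> 2\<close>.\<close>

lemma splice_signature:
  "g (0, r + d + 1) = (1, r + d + 1)"
  "1 \<le> c \<Longrightarrow> c < r + d \<Longrightarrow> g (0, c + 1) = (1, c)"
proof -
  have c0: "col r j 0 = r + 1" "col r j 1 = r + 1" "col r' j' 0 = r' + 1" using j j' by (auto simp: col_def)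
  have f: "f (0, r + 1) = (1, r + 1)" using tr m c0 unfolding tight_def by force
  then show "g (0, r + d + 1) = (1, r + d + 1)"
    using c0 a r d by (simp add: splice_def shift_def)
  show "g (0, c + 1) = (1, c)" if "1 \<le> c" "c < r + d"
    using c0 a that m by (simp add: splice_def upward_def)
qed

end

section \<open>Weights of spliced configurations\<close>

lemma prod_period:
  fixes F :: "int \<Rightarrow> real"
  assumes per: "\<And>i. F (i + int n) = F i" and n: "n \<ge> 1"
  shows "prod F {x..<x + int (n * s)} = prod F {1..int n} ^ s"
proof -
  have step: "prod F {x + 1..<x + 1 + int n} = prod F {x..<x + int n}" for x
  proof -
    have "{x + 1..<x + 1 + int n} = insert (x + int n) {x + 1..<x + int n}"
      "{x..<x + int n} = insert x {x + 1..<x + int n}" using n by auto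
    then show ?thesis by (simp add: per)
  qed
  have one: "prod F {x..<x + int n} = prod F {1..int n}" for x
  proof (induction x rule: int_induct[of _ 1])
    case base
    have "{1..<1 + int n} = {1..int n}" by auto
    then show ?case by simp
  next
    case (step1 i)
    then show ?case using step[of i] by simp
  next
    case (step2 i)
    then show ?case using step[of "i - 1"] by simp
  qed
  show ?thesis
  proof (induction s)
    case (Suc s)
    have "{x..<x + int (n * Suc s)} = {x..<x + int (n * s)} \<union> {x + int (n * s)..<x + int (n * s) + int n}"
    proof -
      have "int (n * Suc s) = int (n * s) + int n" by (simp add: algebra_simps)
      moreover have "0 \<le> int (n * s)" by simp
      ultimately show ?thesis by (simp only: set_eq_iff Un_iff atLeastLessThan_iff) linarith
    qed
    then have "prod F {x..<x + int (n * Suc s)} = prod F {x..<x + int (n * s)} * prod F {x + int (n * s)..<x + int (n * s) + int n}"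
      by (simp only:) (rule prod.union_disjoint; auto)
    then show ?case using Suc one by simp
  qed simp
qed

lemma prod_five:
  assumes "finite D" "D = A1 \<union> A2 \<union> A3 \<union> A4 \<union> A5"
    and "A1 \<inter> A2 = {}" "(A1 \<union> A2) \<inter> A3 = {}" "(A1 \<union> A2 \<union> A3) \<inter> A4 = {}" "(A1 \<union> A2 \<union> A3 \<union> A4) \<inter> A5 = {}"
  shows "prod F D = prod F A1 * prod F A2 * prod F A3 * prod F A4 * (prod F A5 :: real)"
proof -
  have "finite A1" "finite A2" "finite A3" "finite A4" "finite A5" using assms(1,2) by auto
  then show ?thesis unfolding assms(2) using assms(3-) by (simp add: prod.union_disjoint)
qed

text \<open>\<open>radii\<close> says that the radius at level l + 1 is at most R_1, with
  denominators cleared. Having \<open>lo \<le> 1 \<le> hi\<close> makes powers of both monotone in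
  the right direction, so that upper bounds on vertex counts suffice.\<close>

locale strip_weights =
  fixes n m :: nat and c :: "vertex \<Rightarrow> vertex \<Rightarrow> real" and lo hi :: real
  assumes n_ge: "n \<ge> 1" and m_ge: "m \<ge> 1"
    and lo: "0 < lo" "lo \<le> 1" and hi: "1 \<le> hi"
    and c_bounds: "fst v < m \<Longrightarrow> u \<in> nbrs v \<Longrightarrow> lo \<le> c v u \<and> c v u \<le> hi"
    and c_periodic: "c (l, i + int n) (l', i' + int n) = c (l, i) (l', i')"
    and radii: "l < m \<Longrightarrow> (\<Prod>i = 1..int n. c (l, i) (Suc l, i - 1)) * (\<Prod>i = 1..int n. c (0, i) (1, i))
      \<le> (\<Prod>i = 1..int n. c (0, i) (1, i - 1)) * (\<Prod>i = 1..int n. c (l, i) (Suc l, i))"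
begin

text \<open>The quotient \<open>highp l / lowp l\<close> is the radius with index l + 1.\<close>

definition lowp where "lowp l = (\<Prod>i = 1..int n. c (l, i) (Suc l, i))"
definition highp where "highp l = (\<Prod>i = 1..int n. c (l, i) (Suc l, i - 1))"

lemma c_pos: "fst v < m \<Longrightarrow> u \<in> nbrs v \<Longrightarrow> 0 < c v u"
  using c_bounds[of v u] lo by simp

lemma lowp_pos: "l < m \<Longrightarrow> 0 < lowp l"
  unfolding lowp_def by (rule prod_pos) (auto intro: c_pos)

lemma highp_pos: "l < m \<Longrightarrow> 0 < highp l"
  unfolding highp_def by (rule prod_pos) (auto intro: c_pos)

lemma c_shift: "c (shift (int (n * s)) v) (shift (int (n * s)) u) = c v u"
proof (induction s)
  case (Suc s)
  have "shift (int (n * Suc s)) w = (fst w, snd (shift (int (n * s)) w) + int n)" for w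
    by (simp add: shift_def algebra_simps)
  then show ?case using Suc by (simp add: c_periodic) (simp add: shift_def)
qed simp

lemma low_interval: "(\<Prod>i\<in>{x..<x + int (n * s)}. c (l, i) (Suc l, i)) = lowp l ^ s"
  unfolding lowp_def by (rule prod_period) (use c_periodic n_ge in auto)

lemma high_interval: "(\<Prod>i\<in>{x..<x + int (n * s)}. c (l, i) (Suc l, i - 1)) = highp l ^ s"
  unfolding highp_def
proof (rule prod_period)
  fix i show "c (l, i + int n) (Suc l, i + int n - 1) = c (l, i) (Suc l, i - 1)"
    using c_periodic[of l i "Suc l" "i - 1"] by (simp add: algebra_simps)
qed (rule n_ge)

text \<open>The weight of one period of parallel paths with high edge leaving level k: a constant
  times the radius with index k + 1.\<close>

lemma one_high:
  assumes "k < m"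
  shows "(\<Prod>l<m. if l = k then highp l else lowp l) = (\<Prod>l<m. lowp l) * (highp k / lowp k)"
proof -
  have "(\<Prod>l<m. if l = k then highp l else lowp l) = highp k * (\<Prod>l\<in>{..<m} - {k}. lowp l)"
    by (subst prod.remove[of _ k]) (use assms in \<open>auto intro!: prod.cong\<close>)
  moreover have "(\<Prod>l<m. lowp l) = lowp k * (\<Prod>l\<in>{..<m} - {k}. lowp l)"
    by (rule prod.remove) (use assms in auto)
  ultimately show ?thesis using lowp_pos[OF assms] by simp
qed

text \<open>
  The only place where the order of the radii enters.
\<close>

lemma high_first_max:
  assumes "k < m"
  shows "(\<Prod>l<m. if l = k then highp l else lowp l) \<le> (\<Prod>l<m. if l = 0 then highp l else lowp l)"
proof -
  have "highp k / lowp k \<le> highp 0 / lowp 0"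
    using radii[OF assms] lowp_pos[OF assms] lowp_pos[of 0] m_ge
    by (simp add: lowp_def highp_def divide_simps mult_ac)
  moreover have "0 \<le> (\<Prod>l<m. lowp l)" by (rule prod_nonneg) (use lowp_pos in \<open>force simp: less_imp_le\<close>)
  ultimately have "(\<Prod>l<m. lowp l) * (highp k / lowp k) \<le> (\<Prod>l<m. lowp l) * (highp 0 / lowp 0)"
    by (rule mult_left_mono)
  then show ?thesis using one_high[OF assms] one_high[of 0] m_ge by simp
qed

end

text \<open>\<open>d\<close> is a multiple of the period, so the shift preserves conductances;
  \<open>N\<close> bounds the number of overwritten vertices between column \<open>a\<close> and
  \<open>col r j\<close>.\<close>

locale weighted_splicing = splicing m K U P f a r r' d j j' + strip_weights n m c lo hi
  for n m K U P f a r r' d j j' c lo hi +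
  fixes N s :: nat
  assumes d_eq: "d = int (n * s)"
    and run: "\<And>b. r' \<le> b \<Longrightarrow> b \<le> r' + d \<Longrightarrow> tight m f b j'"
    and finU: "finite U" and N: "m * nat (r - a) \<le> N"
begin

abbreviation pf where "pf A \<equiv> \<Prod>v\<in>A. c v (f v)"

abbreviation pg where "pg A \<equiv> \<Prod>v\<in>A. c v (g v)"

abbreviation reg where "reg A B \<equiv> SIGMA l:{..<m}. {A l..<(B l :: int)}"

lemma prod_reg: "(\<Prod>v\<in>reg A B. F v) = (\<Prod>l<m. \<Prod>i\<in>{A l..<B l}. (F (l, i) :: real))"
  by (subst prod.Sigma) auto

lemma finite_D: "finite (U \<union> P)" and finite_D': "finite (U \<union> (starts K - {(0, 1)}))"
  using finU P by (auto simp: starts_def)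

text \<open>\<open>f\<close> lives on \<open>Lf\<close>, \<open>Lm\<close>, \<open>Md\<close>,
  \<open>Rn\<close>, \<open>Rt\<close> and the spliced map on \<open>Lf\<close>, \<open>Lm'\<close>,
  \<open>Nw\<close>, the shifted \<open>Md\<close>, \<open>Rt\<close>. The regions
  \<open>Lf\<close>, \<open>Md\<close>, \<open>Rt\<close> contribute equal factors, the dropped
  \<open>Rn\<close> and the new \<open>Nw\<close> contribute s-th powers compared by
  \<open>high_first_max\<close>, and \<open>Lm\<close>, \<open>Lm'\<close> have at most
  \<open>N\<close> vertices.\<close>

definition "Lf = {v \<in> D. snd v \<le> a}"
definition "Lm = {v \<in> D. a < snd v \<and> snd v < col r j (fst v)}"
definition "Lm' = {v \<in> D'. a < snd v \<and> snd v < col r j (fst v)}"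
definition "Md = reg (col r j) (col r' j')"
definition "Rn = reg (col r' j') (\<lambda>l. col r' j' l + d)"
definition "Nw = reg (col r j) (\<lambda>l. col r j l + d)"
definition "Rt = {v \<in> D. col r' j' (fst v) + d \<le> snd v}"

lemma order: "a < col r j l" "col r j l \<le> col r' j' l" "col r j l + d \<le> col r' j' l + d"
  using a r col_bounds[of r j l] col_bounds[of r' j' l] by auto

lemma reg_D':
  assumes "l < m" "col r j l \<le> i" "i < col r' j' l + d"
  shows "(l, i) \<in> D'"
proof (rule in_D')
  show "\<bar>snd (l, i)\<bar> \<le> int K"
    using assms r d col_bounds[of r j l] col_bounds[of r' j' l] by simp
  show "(l, i) \<noteq> (0, 1)" using assms r j by (auto simp: col_def)
qed (use assms in simp)

lemma D_split: "D = Lf \<union> Lm \<union> Md \<union> Rn \<union> Rt"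
proof
  have "v \<in> D" if vM: "v \<in> Md \<union> Rn" for v
  proof -
    obtain l i where v: "v = (l, i)" "l < m" "col r j l \<le> i" "i < col r' j' l + d"
      using vM order[of "fst v"] d by (cases v) (auto simp: Md_def Rn_def)
    then show ?thesis using reg_D'[of l i] D'_D by blast
  qed
  then show "Lf \<union> Lm \<union> Md \<union> Rn \<union> Rt \<subseteq> D" by (auto simp: Lf_def Lm_def Rt_def)
  show "D \<subseteq> Lf \<union> Lm \<union> Md \<union> Rn \<union> Rt"
  proof
    fix v assume "v \<in> D"
    then show "v \<in> Lf \<union> Lm \<union> Md \<union> Rn \<union> Rt"
      using level[of v] by (cases v) (simp add: Lf_def Lm_def Md_def Rn_def Rt_def not_less, linarith)
  qed
qed

lemma D'_split: "D' = Lf \<union> Lm' \<union> Nw \<union> shift (d) ` Md \<union> Rt"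
proof
  have 1: "v \<in> D'" if v: "v \<in> Lf \<union> Rt" for v
  proof -
    have "v \<noteq> (0, 1)" using v a r d col_bounds[of r' j' 0] by (cases v) (auto simp: Lf_def Rt_def)
    then show ?thesis using v P by (auto simp: Lf_def Rt_def)
  qed
  have 2: "v \<in> D'" if vM: "v \<in> Nw" for v
  proof -
    obtain l i where v: "v = (l, i)" "l < m" "col r j l \<le> i" "i < col r' j' l + d"
      using vM order[of "fst v"] d by (cases v) (auto simp: Nw_def)
    then show ?thesis using reg_D'[of l i] by blast
  qed
  have 3: "shift d v \<in> D'" if vM: "v \<in> Md" for v
  proof -
    obtain l i where v: "v = (l, i)" "l < m" "col r j l \<le> i" "i < col r' j' l"
      using vM by (cases v) (auto simp: Md_def)
    then have "(l, i + d) \<in> D'" using d by (intro reg_D') auto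
    then show ?thesis using v by (simp add: shift_def)
  qed
  have "Lm' \<subseteq> D'" by (auto simp: Lm'_def)
  moreover have "Lf \<subseteq> D'" "Rt \<subseteq> D'" using 1 by (meson UnI1 UnI2 subsetI)+
  moreover have "Nw \<subseteq> D'" "shift d ` Md \<subseteq> D'" using 2 3 by (meson subsetI image_subsetI)+
  ultimately show "Lf \<union> Lm' \<union> Nw \<union> shift d ` Md \<union> Rt \<subseteq> D'" by (intro Un_least)
  show "D' \<subseteq> Lf \<union> Lm' \<union> Nw \<union> shift (d) ` Md \<union> Rt"
  proof
    fix v assume v: "v \<in> D'"
    then have vD: "v \<in> D" and lv: "fst v < m" using D'_D level_D' by auto
    consider "snd v \<le> a" | "a < snd v" "snd v < col r j (fst v)"
      | "col r j (fst v) \<le> snd v" "snd v < col r j (fst v) + d"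
      | "col r j (fst v) + d \<le> snd v" "snd v < col r' j' (fst v) + d"
      | "col r' j' (fst v) + d \<le> snd v" by linarith
    then show "v \<in> Lf \<union> Lm' \<union> Nw \<union> shift (d) ` Md \<union> Rt"
    proof cases
      case 4
      have "shift (- d) v \<in> Md" using 4 lv by (simp add: Md_def mem_Sigma_iff shift_def)
      then have "v \<in> shift (d) ` Md" by (rule rev_image_eqI) simp
      then show ?thesis by simp
    qed (use v vD lv in \<open>cases v; simp add: Lf_def Lm'_def Nw_def Rt_def\<close>)+
  qed
qed

section \<open>Factors of the regions\<close>

lemma wt_D: "wt c D f = pf Lf * pf Lm * pf Md *
    pf Rn * pf Rt"
  unfolding wt_def
proof (rule prod_five[OF finite_D D_split])
  show "Lf \<inter> Lm = {}" "(Lf \<union> Lm) \<inter> Md = {}"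
    using order by (auto simp: Lf_def Lm_def Md_def; smt (verit))+
  show "(Lf \<union> Lm \<union> Md) \<inter> Rn = {}"
    using order by (auto simp: Lf_def Lm_def Md_def Rn_def; smt (verit))
  show "(Lf \<union> Lm \<union> Md \<union> Rn) \<inter> Rt = {}"
    using order d by (auto simp: Lf_def Lm_def Md_def Rn_def Rt_def; smt (verit))
qed

lemma wt_D': "wt c D' g = pg Lf * pg Lm' * pg Nw *
    (\<Prod>v\<in>shift (d) ` Md. c v (g v)) * pg Rt"
  unfolding wt_def
proof (rule prod_five[OF finite_D' D'_split])
  show "Lf \<inter> Lm' = {}" by (auto simp: Lf_def Lm'_def)
  show "(Lf \<union> Lm') \<inter> Nw = {}"
    using order by (auto simp: Lf_def Lm'_def Nw_def; smt (verit))
  show "(Lf \<union> Lm' \<union> Nw) \<inter> shift (d) ` Md = {}"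
    using order d by (auto simp: Lf_def Lm'_def Md_def Nw_def shift_def; smt (verit))
  show "(Lf \<union> Lm' \<union> Nw \<union> shift (d) ` Md) \<inter> Rt = {}"
    using order d by (auto simp: Lf_def Lm'_def Md_def Nw_def Rt_def shift_def; smt (verit))
qed

lemma prod_Lf: "pg Lf = pf Lf"
  by (rule prod.cong) (auto simp: Lf_def splice_def)

lemma prod_Rt: "pg Rt = pf Rt"
  by (rule prod.cong) (use right_region in \<open>auto simp: Rt_def\<close>)

lemma prod_Md: "(\<Prod>v\<in>shift (d) ` Md. c v (g v)) = pf Md"
proof -
  have "inj_on (shift (d)) Md" by (auto simp: inj_on_def shift_def)
  then have "(\<Prod>v\<in>shift (d) ` Md. c v (g v)) = (\<Prod>v\<in>Md. c (shift (d) v) (g (shift (d) v)))"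
    by (simp add: prod.reindex)
  also have "\<dots> = pf Md"
  proof (rule prod.cong)
    fix v assume "v \<in> Md"
    then have "g (shift (d) v) = shift (d) (f v)"
      using mid_region[of v] by (auto simp: Md_def)
    then show "c (shift (d) v) (g (shift (d) v)) = c v (f v)" using c_shift[of s, folded d_eq] by simp
  qed simp
  finally show ?thesis .
qed

lemma prod_Rn: "pf Rn = (\<Prod>l<m. if l = j' - 1 then highp l else lowp l) ^ s"
proof -
  have "(\<Prod>i\<in>{col r' j' l..<col r' j' l + d}. c (l, i) (f (l, i))) =
    (if l = j' - 1 then highp l else lowp l) ^ s" if l: "l < m" for l
  proof -
    have fv: "f (l, i) = (Suc l, if l = j' - 1 then i - 1 else i)"
      if i: "i \<in> {col r' j' l..<col r' j' l + d}" for i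
    proof -
      \<comment> \<open>The top column of the path of the run that passes through (l, i).\<close>
      define b where "b = i - (if l < j' then 1 else 0)"
      have "tight m f b j'" by (rule run) (use i in \<open>auto simp: b_def col_def\<close>)
      moreover have "col b j' l = i" by (simp add: b_def col_def)
      ultimately have "f (l, i) = (Suc l, col b j' (Suc l))" using l unfolding tight_def by metis
      also have "col b j' (Suc l) = (if l = j' - 1 then i - 1 else i)"
        using j' by (auto simp: b_def col_def)
      finally show ?thesis .
    qed
    show ?thesis
    proof (cases "l = j' - 1")
      case True
      have "(\<Prod>i\<in>{col r' j' l..<col r' j' l + d}. c (l, i) (f (l, i))) =
        (\<Prod>i\<in>{col r' j' l..<col r' j' l + d}. c (l, i) (Suc l, i - 1))"
        by (rule prod.cong) (use fv True in auto)
      then show ?thesis using high_interval[where s = s, folded d_eq] True by simp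
    next
      case False
      have "(\<Prod>i\<in>{col r' j' l..<col r' j' l + d}. c (l, i) (f (l, i))) =
        (\<Prod>i\<in>{col r' j' l..<col r' j' l + d}. c (l, i) (Suc l, i))"
        by (rule prod.cong) (use fv False in auto)
      then show ?thesis using low_interval[where s = s, folded d_eq] False by simp
    qed
  qed
  then show ?thesis unfolding Rn_def prod_reg by (simp add: prod_power_distrib)
qed

lemma prod_Nw: "pg Nw = (\<Prod>l<m. if l = 0 then highp l else lowp l) ^ s"
proof -
  have "(\<Prod>i\<in>{col r j l..<col r j l + d}. c (l, i) (g (l, i))) =
    (if l = 0 then highp l else lowp l) ^ s" if l: "l < m" for l
  proof -
    have gv: "g (l, i) = upward m (l, i)" if i: "i \<in> {col r j l..<col r j l + d}" for i
      using i order(1)[of l] by (simp add: splice_def)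
    show ?thesis
    proof (cases "l = 0")
      case True
      have "(\<Prod>i\<in>{col r j l..<col r j l + d}. c (l, i) (g (l, i))) =
        (\<Prod>i\<in>{col r j l..<col r j l + d}. c (l, i) (Suc l, i - 1))"
        by (rule prod.cong) (use gv True l r j in \<open>auto simp: upward_def col_def\<close>)
      then show ?thesis using high_interval[where s = s, folded d_eq] True by simp
    next
      case False
      have "(\<Prod>i\<in>{col r j l..<col r j l + d}. c (l, i) (g (l, i))) =
        (\<Prod>i\<in>{col r j l..<col r j l + d}. c (l, i) (Suc l, i))"
        by (rule prod.cong) (use gv False l in \<open>auto simp: upward_def\<close>)
      then show ?thesis using low_interval[where s = s, folded d_eq] False by simp
    qed
  qed
  then show ?thesis unfolding Nw_def prod_reg by (simp add: prod_power_distrib)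
qed

lemma card_Lm: "card Lm \<le> N" "card Lm' \<le> N" "finite Lm" "finite Lm'"
proof -
  let ?B = "{..<m} \<times> {a<..r}"
  have sub: "Lm' \<subseteq> Lm" using D'_D by (auto simp: Lm_def Lm'_def)
  moreover have LB: "Lm \<subseteq> ?B"
  proof
    fix v assume "v \<in> Lm"
    then show "v \<in> ?B" using level[of v] col_bounds[of r j "fst v"] by (cases v) (auto simp: Lm_def)
  qed
  moreover have "card ?B \<le> N" using N by (simp add: card_cartesian_product)
  ultimately show "card Lm \<le> N" "card Lm' \<le> N" "finite Lm" "finite Lm'"
    using card_mono[of ?B Lm] card_mono[of ?B Lm'] finite_subset[of Lm ?B] finite_subset[of Lm' ?B]
      order_trans[OF sub LB] by auto
qed

text \<open>The factor (hi / lo) ^ N pays for the overwritten vertices alone; trading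
  \<open>Rn\<close> for \<open>Nw\<close> costs nothing, since R_1 is the largest radius.\<close>

lemma wt_splice: "wt c D f \<le> (hi / lo) ^ N * wt c D' g"
proof -
  have fb: "0 < c v (f v)" "c v (f v) \<le> hi" if "v \<in> D" for v
    using c_bounds[OF level[OF that] pointers_nb[OF ptr that]] lo by auto
  have gb: "lo \<le> c v (g v)" if "v \<in> D'" for v
    using c_bounds[OF level_D'[OF that] splice_nb[OF that]] by auto
  have 1: "pf Lm \<le> hi ^ N"
  proof -
    have "pf Lm \<le> (\<Prod>v\<in>Lm. hi)"
      by (rule prod_mono) (use fb in \<open>force simp: Lm_def less_imp_le\<close>)
    also have "\<dots> = hi ^ card Lm" by simp
    also have "\<dots> \<le> hi ^ N" using hi card_Lm by (intro power_increasing) auto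
    finally show ?thesis .
  qed
  have 2: "lo ^ N \<le> pg Lm'"
  proof -
    have "lo ^ N \<le> lo ^ card Lm'" using lo card_Lm by (intro power_decreasing) auto
    also have "\<dots> = (\<Prod>v\<in>Lm'. lo)" by simp
    also have "\<dots> \<le> pg Lm'"
      by (rule prod_mono) (use gb lo in \<open>auto simp: Lm'_def\<close>)
    finally show ?thesis .
  qed
  have 3: "pf Rn \<le> pg Nw"
    unfolding prod_Rn prod_Nw
  proof (rule power_mono)
    show "(\<Prod>l<m. if l = j' - 1 then highp l else lowp l) \<le> (\<Prod>l<m. if l = 0 then highp l else lowp l)"
      by (rule high_first_max) (use j' in auto)
    show "0 \<le> (\<Prod>l<m. if l = j' - 1 then highp l else lowp l)"
      by (rule prod_nonneg) (use highp_pos lowp_pos in \<open>auto simp: less_imp_le\<close>)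
  qed
  have nn: "0 \<le> pf A" if "A \<subseteq> D" for A
    by (rule prod_nonneg) (use fb that in \<open>force simp: less_imp_le\<close>)
  have sub: "Lf \<subseteq> D" "Lm \<subseteq> D" "Md \<subseteq> D" "Rn \<subseteq> D" "Rt \<subseteq> D" using D_split by auto
  define X where "X = pf Lf * pf Md * pf Rt"
  have X: "0 \<le> X" unfolding X_def using nn sub by simp
  have "wt c D f = X * (pf Lm * pf Rn)"
    unfolding wt_D X_def by (simp add: mult_ac)
  also have "\<dots> \<le> X * (hi ^ N * pg Nw)"
    by (intro mult_left_mono mult_mono 1 3 X nn sub) (use hi in simp)
  also have "\<dots> = (hi / lo) ^ N * (X * (lo ^ N * pg Nw))"
    using lo by (simp add: power_divide)
  also have "\<dots> \<le> (hi / lo) ^ N * (X * (pg Lm' * pg Nw))"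
  proof (intro mult_left_mono mult_right_mono 2 X)
    show "0 \<le> pg Nw" using 3 nn[OF sub(4)] by linarith
    show "0 \<le> (hi / lo) ^ N" using lo hi by simp
  qed
  also have "X * (pg Lm' * pg Nw) = wt c D' g"
    unfolding wt_D' prod_Lf prod_Rt prod_Md X_def by (simp add: mult_ac)
  finally show ?thesis .
qed

end

locale strip_window = strip_weights +
  fixes K :: nat and U :: "vertex set"
  assumes finU: "finite U" and U: "U \<subseteq> {0<..<m} \<times> UNIV" and window: "{0<..<m} \<times> {- int K..int K} \<subseteq> U"
begin

abbreviation "P\<tau> \<equiv> starts K - {(0, 1)}"

abbreviation "P\<sigma> \<equiv> starts K"

abbreviation "conf P \<equiv> rooted nbrs (target m) P U"

abbreviation "zs P \<equiv> zsum nbrs c (target m) P U"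

sublocale nbhd nbrs c
  by unfold_locales (rule finite_nbrs)

lemma finite_UP: "P = P\<sigma> \<or> P = P\<tau> \<Longrightarrow> finite (U \<union> P)"
  using finU by (auto simp: starts_def)

lemma level_UP: "P = P\<sigma> \<or> P = P\<tau> \<Longrightarrow> v \<in> U \<union> P \<Longrightarrow> fst v < m"
  using U m_ge by (auto simp: starts_def)

lemma wt_nonneg:
  assumes P: "P = P\<sigma> \<or> P = P\<tau>" and f: "f \<in> conf P"
  shows "0 \<le> wt c (U \<union> P) f"
  unfolding wt_def
proof (rule prod_nonneg)
  fix v assume v: "v \<in> U \<union> P"
  have "f v \<in> nbrs v" using f v by (auto simp: rooted_def pointers_def)
  then show "0 \<le> c v (f v)" using c_pos[OF level_UP[OF P v]] by (simp add: less_imp_le)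
qed

definition runs :: "vertex set \<Rightarrow> int \<Rightarrow> int \<Rightarrow> nat \<Rightarrow> int \<Rightarrow> nat \<Rightarrow> nat \<Rightarrow> (vertex \<Rightarrow> vertex) set" where
  "runs P a r j r' j' M = {f \<in> conf P.
     tight m f a 0 \<and> tight m f r j \<and> (\<forall>b\<in>{r'..r' + int M}. tight m f b j')}"

context
  fixes P :: "vertex set" and a r r' :: int and j j' S N :: nat
  assumes P: "P = P\<sigma> \<or> P = P\<tau>"
    and a: "a \<le> 0" "- int K \<le> a" and r: "1 \<le> r" "r < r'" "r' + int (n * S) \<le> int K - 1"
    and j: "j \<in> {2..m}" and j': "j' \<in> {1..m}" and N: "m * nat (r - a) \<le> N"
begin

abbreviation "X \<equiv> runs P a r j r' j' (n * S)"

abbreviation "spl s \<equiv> splice m a r j r' j' (int (n * s))"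

lemma weighted:
  assumes f: "f \<in> X" and s: "s \<le> S"
  shows "weighted_splicing n m K U P f a r r' (int (n * s)) j j' c lo hi N s"
proof -
  have sS: "n * s \<le> n * S" using s by (rule mult_le_mono2)
  have t: "tight m f b j'" if "r' \<le> b" "b \<le> r' + int (n * s)" for b
  proof -
    have "int (n * s) \<le> int (n * S)" using sS by (simp only: of_nat_le_iff)
    then have "b \<in> {r'..r' + int (n * S)}" using that by (intro atLeastAtMost_iff[THEN iffD2] conjI) linarith+
    then show ?thesis using f by (simp add: runs_def)
  qed
  have "r' + int (n * s) \<le> int K - 1" using r(3) sS by linarith
  then show ?thesis
    using f P a r j j' N finU U window m_ge t by unfold_locales (simp_all add: runs_def)
qed

text \<open>Splicing forgets \<open>f\<close> only on the box \<Lambda>: the outer parts and the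
  moved block can be read off, and the dropped paths are known to be straight of type
  \<open>j'\<close>. Recording \<open>f\<close> on \<Lambda>, with at most 5 values per vertex,
  restores injectivity.\<close>

lemma spl_sum:
  assumes s: "s \<le> S"
  shows "(\<Sum>f\<in>X. wt c (U \<union> P) f) \<le> (5 * (hi / lo)) ^ N * (\<Sum>g\<in>spl s ` X. wt c (U \<union> P\<tau>) g)"
proof -
  let ?\<Lambda> = "{..<m} \<times> {a<..r}"
  let ?C = "(hi / lo) ^ N"
  let ?E = "PiE ?\<Lambda> (\<lambda>v. insert v (nbrs v))"
  let ?\<Phi> = "\<lambda>f. (spl s f, restrict f ?\<Lambda>)"
  have finX: "finite X"
    by (rule finite_subset[OF _ finite_rooted[OF finite_UP[OF P], of "target m"]]) (auto simp: runs_def)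
  have finE: "finite ?E" by (rule finite_PiE) (auto simp: finite_nbrs)
  have spl_in: "spl s f \<in> conf P\<tau>" if "f \<in> X" for f
  proof -
    interpret weighted_splicing n m K U P f a r r' "int (n * s)" j j' c lo hi N s by (rule weighted[OF that s])
    show ?thesis by (rule splice_rooted)
  qed
  have gnn: "0 \<le> wt c (U \<union> P\<tau>) (spl s f)" if "f \<in> X" for f
    by (rule wt_nonneg[OF _ spl_in[OF that]]) simp
  have inj: "inj_on ?\<Phi> X"
  proof (rule inj_onI, rule ext)
    fix f f' :: "vertex \<Rightarrow> vertex" and v :: vertex
    assume f: "f \<in> X" and f': "f' \<in> X" and eq: "?\<Phi> f = ?\<Phi> f'"
    interpret A: weighted_splicing n m K U P f a r r' "int (n * s)" j j' c lo hi N s by (rule weighted[OF f s])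
    interpret B: weighted_splicing n m K U P f' a r r' "int (n * s)" j j' c lo hi N s by (rule weighted[OF f' s])
    have sp: "spl s f v = spl s f' v" for v using eq by (metis Pair_inject)
    have rs: "f v = f' v" if "v \<in> ?\<Lambda>" for v using eq that by (metis Pair_inject restrict_apply')
    note cb = col_bounds[of r j "fst v"] col_bounds[of r' j' "fst v"]
    show "f v = f' v"
    proof (cases "fst v < m")
      case False
      then show ?thesis using A.top[of v] B.top[of v] by simp
    next
      case lv: True
      consider "snd v \<le> a" | "a < snd v" "snd v < col r j (fst v)"
        | "col r j (fst v) \<le> snd v" "snd v \<le> col r' j' (fst v)"
        | "col r' j' (fst v) \<le> snd v" "snd v < col r' j' (fst v) + int (n * s)"
        | "col r' j' (fst v) + int (n * s) \<le> snd v" by linarith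
      then show ?thesis
      proof cases
        case 1
        then show ?thesis using A.left_region[of v] B.left_region[of v] sp[of v] by simp
      next
        case 2
        then have "snd v \<le> r" using cb by linarith
        then have "v \<in> ?\<Lambda>" using 2 lv by (simp add: mem_Times_iff)
        then show ?thesis by (rule rs)
      next
        case 3
        then have "shift (int (n * s)) (f v) = shift (int (n * s)) (f' v)"
          using A.mid_region[of v] B.mid_region[of v] sp[of "shift (int (n * s)) v"] by simp
        then show ?thesis by (simp add: shift_def prod_eq_iff)
      next
        case 4
        define b where "b = snd v - (if fst v < j' then 1 else 0)"
        have v: "v = (fst v, col b j' (fst v))" by (simp add: b_def col_def)
        have "r' \<le> b" "b \<le> r' + int (n * s)" using 4 by (auto simp: b_def col_def split: if_splits)
        then have "tight m f b j'" "tight m f' b j'" using A.run B.run by auto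
        then show ?thesis using lv v unfolding tight_def by metis
      next
        case 5
        then show ?thesis using A.right_region[of v] B.right_region[of v] sp[of v] by simp
      qed
    qed
  qed
  have "(\<Sum>f\<in>X. wt c (U \<union> P) f) \<le> (\<Sum>f\<in>X. ?C * wt c (U \<union> P\<tau>) (spl s f))"
  proof (rule sum_mono)
    fix f assume f: "f \<in> X"
    interpret weighted_splicing n m K U P f a r r' "int (n * s)" j j' c lo hi N s by (rule weighted[OF f s])
    show "wt c (U \<union> P) f \<le> ?C * wt c (U \<union> P\<tau>) (spl s f)" by (rule wt_splice)
  qed
  also have "\<dots> = (\<Sum>(g, h)\<in>?\<Phi> ` X. ?C * wt c (U \<union> P\<tau>) g)"
    unfolding sum.reindex[OF inj] by (simp only: o_def prod.case)
  also have "\<dots> \<le> (\<Sum>(g, h)\<in>(spl s ` X) \<times> ?E. ?C * wt c (U \<union> P\<tau>) g)"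
  proof (rule sum_mono2)
    show "finite ((spl s ` X) \<times> ?E)" using finX finE by simp
    show "?\<Phi> ` X \<subseteq> (spl s ` X) \<times> ?E"
    proof (rule image_subsetI)
      fix f assume f: "f \<in> X"
      then have pf: "f \<in> pointers nbrs (U \<union> P)" by (simp add: runs_def rooted_def)
      have "f v \<in> insert v (nbrs v)" for v
        using pointers_nb[OF pf, of v] pointers_out[OF pf, of v] by blast
      then have "restrict f ?\<Lambda> \<in> ?E" by simp
      then show "?\<Phi> f \<in> (spl s ` X) \<times> ?E" using f by simp
    qed
    fix x assume "x \<in> (spl s ` X) \<times> ?E - ?\<Phi> ` X"
    then obtain f h where "x = (spl s f, h)" "f \<in> X" by auto
    then show "0 \<le> (case x of (g, h) \<Rightarrow> ?C * wt c (U \<union> P\<tau>) g)" using gnn lo hi by simp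
  qed
  also have "\<dots> = real (card ?E) * ?C * (\<Sum>g\<in>spl s ` X. wt c (U \<union> P\<tau>) g)"
    unfolding sum.cartesian_product[symmetric] by (simp add: sum_distrib_left mult_ac)
  also have "\<dots> \<le> 5 ^ N * ?C * (\<Sum>g\<in>spl s ` X. wt c (U \<union> P\<tau>) g)"
  proof (intro mult_right_mono sum_nonneg)
    have "card ?E = (\<Prod>v\<in>?\<Lambda>. card (insert v (nbrs v)))" by (rule card_PiE) simp
    also have "\<dots> \<le> (\<Prod>v\<in>?\<Lambda>. 5)" by (rule prod_mono) (use card_nbrs in auto)
    also have "\<dots> = 5 ^ (m * nat (r - a))" by (simp add: card_cartesian_product)
    also have "\<dots> \<le> 5 ^ N" using N by (intro power_increasing) auto
    finally have "card ?E \<le> 5 ^ N" .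
    then have "real (card ?E) \<le> real (5 ^ N)" by (simp only: of_nat_le_iff)
    then show "real (card ?E) \<le> 5 ^ N" by simp
    show "0 \<le> ?C" using lo hi by simp
    show "0 \<le> wt c (U \<union> P\<tau>) g" if "g \<in> spl s ` X" for g using gnn that by auto
  qed
  finally show ?thesis by (simp only: power_mult_distrib)
qed

lemma spl_disjoint:
  assumes "s < s'" "s' \<le> S"
  shows "spl s ` X \<inter> spl s' ` X = {}"
proof (rule ccontr)
  assume "spl s ` X \<inter> spl s' ` X \<noteq> {}"
  then obtain f f' where f: "f \<in> X" "f' \<in> X" "spl s f = spl s' f'" by auto
  interpret A: weighted_splicing n m K U P f a r r' "int (n * s)" j j' c lo hi N s
    by (rule weighted[OF f(1)]) (use assms in simp)
  interpret B: weighted_splicing n m K U P f' a r r' "int (n * s')" j j' c lo hi N s'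
    by (rule weighted[OF f(2) assms(2)])
  have "n * s < n * s'" using assms(1) n_ge by simp
  then have "int (n * s) < int (n * s')" by (simp only: of_nat_less_iff)
  \<comment> \<open>At the first bottom vertex of the block moved by \<open>n * s\<close>, the
    longer insertion still shows an inserted path.\<close>
  then have "spl s' f' (0, r + int (n * s) + 1) = (1, r + int (n * s))"
    using r A.d by (intro B.splice_signature(2)) linarith+
  then show False using A.splice_signature(1) f(3) by simp
qed

text \<open>
  The \<open>S\<close> different insertions give disjoint sets of configurations: the number of inserted paths can be
  read off at the bottom boundary.
\<close>

lemma runs_bound:
  "real S * (\<Sum>f\<in>X. wt c (U \<union> P) f) \<le> (5 * (hi / lo)) ^ N * zs P\<tau>"
proof -
  have finX: "finite X"
    by (rule finite_subset[OF _ finite_rooted[OF finite_UP[OF P], of "target m"]]) (auto simp: runs_def)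
  have C: "0 \<le> (5 * (hi / lo)) ^ N" using lo hi by simp
  have "real S * (\<Sum>f\<in>X. wt c (U \<union> P) f) = (\<Sum>s\<in>{1..S}. \<Sum>f\<in>X. wt c (U \<union> P) f)" by simp
  also have "\<dots> \<le> (\<Sum>s\<in>{1..S}. (5 * (hi / lo)) ^ N * (\<Sum>g\<in>spl s ` X. wt c (U \<union> P\<tau>) g))"
    by (rule sum_mono) (use spl_sum in auto)
  also have "\<dots> = (5 * (hi / lo)) ^ N * (\<Sum>s\<in>{1..S}. \<Sum>g\<in>spl s ` X. wt c (U \<union> P\<tau>) g)"
    by (simp add: sum_distrib_left)
  also have "(\<Sum>s\<in>{1..S}. \<Sum>g\<in>spl s ` X. wt c (U \<union> P\<tau>) g) = (\<Sum>g\<in>(\<Union>s\<in>{1..S}. spl s ` X). wt c (U \<union> P\<tau>) g)"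
  proof (rule sum.UNION_disjoint[symmetric])
    show "\<forall>s\<in>{1..S}. \<forall>s'\<in>{1..S}. s \<noteq> s' \<longrightarrow> spl s ` X \<inter> spl s' ` X = {}"
      using spl_disjoint by (metis Int_commute atLeastAtMost_iff linorder_neqE_nat)
  qed (use finX in auto)
  also have "(5 * (hi / lo)) ^ N * (\<Sum>g\<in>(\<Union>s\<in>{1..S}. spl s ` X). wt c (U \<union> P\<tau>) g)
    \<le> (5 * (hi / lo)) ^ N * zs P\<tau>"
    unfolding zsum_def
  proof (intro mult_left_mono sum_mono2 C)
    show "finite (conf P\<tau>)" using finite_UP[of P\<tau>] by (intro finite_rooted) simp
    show "(\<Union>s\<in>{1..S}. spl s ` X) \<subseteq> conf P\<tau>"
    proof (clarify)
      fix s f assume sf: "s \<in> {1..S}" "f \<in> X"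
      interpret weighted_splicing n m K U P f a r r' "int (n * s)" j j' c lo hi N s
        by (rule weighted) (use sf in auto)
      show "spl s f \<in> conf P\<tau>" by (rule splice_rooted)
    qed
    show "0 \<le> wt c (U \<union> P\<tau>) b" if "b \<in> conf P\<tau> - (\<Union>s\<in>{1..S}. spl s ` X)" for b
      by (rule wt_nonneg) (use that in auto)
  qed
  finally show ?thesis .
qed

end

text \<open>
  In a good configuration the paths ending at $0'$ and $1'$ contain both neighbours of vertex $1$, so
  that vertex $1$ can join the part of $0$ only through its high edge.
\<close>

definition good :: "(vertex \<Rightarrow> vertex) \<Rightarrow> bool" where
  "good f \<longleftrightarrow> tight m f 0 0 \<and> tight m f 1 1"

text \<open>A bound on the number of data (a, r, j, q, j') times the cost of one splice. With B =
  \<open>defect_bound m\<close>, \<open>a \<ge> - B\<close> and \<open>r \<le> B + 1\<close> give at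
  most m(2B + 1) overwritten vertices.\<close>

definition bad_const :: real where
  "bad_const = real ((defect_bound m + 1) * (defect_bound m + 1) * m * ((defect_bound m + 1) * m) * m) *
    (5 * (hi / lo)) ^ (m * (2 * defect_bound m + 1))"

text \<open>A union bound over the data of \<open>bad_structure\<close>. The right side has
  \<open>zs P\<tau>\<close> for both choices of \<open>P\<close>, as every splice is a
  \<tau>-configuration; the factor S makes bad configurations negligible, uniformly in
  \<open>U\<close>.\<close>

lemma bad_bound:
  assumes P: "P = P\<sigma> \<or> P = P\<tau>"
    and K: "int (defect_bound m) + 2 + int ((defect_bound m + 1) * (m * (n * S + 1))) \<le> int K"
  shows "real S * (\<Sum>f\<in>{f \<in> conf P. \<not> good f}. wt c (U \<union> P) f)
    \<le> bad_const * zs P\<tau>"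
proof -
  define B where "B = defect_bound m"
  define Y where "Y q = int B + 2 + int (q * (n * S + 1))" for q
  define \<Theta> where "\<Theta> = {- int B..0} \<times> {1..int B + 1} \<times> {2..m} \<times> {..<(B + 1) * m} \<times> {1..m}"
  define XX where "XX = (\<lambda>(a, r, j, q, j'). runs P a r j (Y q) j' (n * S))"
  let ?bad = "{f \<in> conf P. \<not> good f}" and ?w = "wt c (U \<union> P)"
  let ?Z = "zs P\<tau>" and ?C = "(5 * (hi / lo)) ^ (m * (2 * B + 1))"
  have fin\<Theta>: "finite \<Theta>" by (simp add: \<Theta>_def)
  have finR: "finite (conf P)" by (rule finite_rooted[OF finite_UP[OF P]])
  have w0: "0 \<le> ?w f" if "f \<in> conf P" for f by (rule wt_nonneg[OF P that])
  have Z0: "0 \<le> ?Z" unfolding zsum_def by (rule sum_nonneg) (rule wt_nonneg, simp_all)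
  have cover: "\<exists>\<theta>\<in>\<Theta>. f \<in> XX \<theta>" if f: "f \<in> ?bad" for f
  proof -
    interpret G: strip_grove m K U P f
      using f P U window m_ge by unfold_locales auto
    have "\<exists>a\<in>{- int B..0}. \<exists>r\<in>{1..int B + 1}. \<exists>j\<in>{2..m}. \<exists>q<(B + 1) * m. \<exists>j'\<in>{1..m}.
      tight m f a 0 \<and> tight m f r j \<and> (\<forall>b\<in>{Y q..Y q + int (n * S)}. tight m f b j')"
      using G.bad_structure[of "n * S"] K f unfolding B_def Y_def good_def by auto
    then obtain a r j q j' where "a \<in> {- int B..0}" "r \<in> {1..int B + 1}" "j \<in> {2..m}" "q < (B + 1) * m" "j' \<in> {1..m}"
      "tight m f a 0" "tight m f r j" "\<forall>b\<in>{Y q..Y q + int (n * S)}. tight m f b j'"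
      by blast
    then have "(a, r, j, q, j') \<in> \<Theta>" "f \<in> XX (a, r, j, q, j')"
      using f by (simp_all add: \<Theta>_def XX_def runs_def)
    then show ?thesis by blast
  qed
  have each: "real S * (\<Sum>f\<in>XX \<theta>. ?w f) \<le> ?C * ?Z" if \<theta>: "\<theta> \<in> \<Theta>" for \<theta>
  proof -
    obtain a r j q j' where t: "\<theta> = (a, r, j, q, j')" by (cases \<theta>)
    have b: "a \<in> {- int B..0}" "r \<in> {1..int B + 1}" "j \<in> {2..m}" "q < (B + 1) * m" "j' \<in> {1..m}"
      using \<theta> unfolding t \<Theta>_def by auto
    \<comment> \<open>Even the last possible run ends at column K - 1 or before, as the splice
      requires.\<close>
    have "(q + 1) * (n * S + 1) \<le> (B + 1) * m * (n * S + 1)" using b(4) by (intro mult_le_mono1) simp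
    then have "q * (n * S + 1) + n * S + 1 \<le> (B + 1) * (m * (n * S + 1))" by (simp add: algebra_simps)
    then have "int (q * (n * S + 1)) + int (n * S) + 1 \<le> int ((B + 1) * (m * (n * S + 1)))"
      by linarith
    then have Yq: "Y q + int (n * S) \<le> int K - 1" using K unfolding Y_def B_def by linarith
    have KB: "int B + 2 \<le> int K" using K unfolding B_def by linarith
    have "real S * (\<Sum>f\<in>runs P a r j (Y q) j' (n * S). ?w f) \<le> ?C * ?Z"
    proof (rule runs_bound[OF P _ _ _ _ Yq b(3,5)])
      show "r < Y q" using b(2) unfolding Y_def by (simp only: atLeastAtMost_iff) linarith
      have "nat (r - a) \<le> 2 * B + 1" using b(1,2) by auto
      then show "m * nat (r - a) \<le> m * (2 * B + 1)" by (rule mult_le_mono2)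
    qed (use b KB in auto)
    then show ?thesis by (simp add: t XX_def)
  qed
  have "(\<Sum>f\<in>?bad. ?w f) \<le> (\<Sum>f\<in>?bad. \<Sum>\<theta>\<in>\<Theta>. if f \<in> XX \<theta> then ?w f else 0)"
  proof (rule sum_mono)
    fix f assume f: "f \<in> ?bad"
    then obtain \<theta> where \<theta>: "\<theta> \<in> \<Theta>" "f \<in> XX \<theta>" using cover by blast
    have "?w f = (if f \<in> XX \<theta> then ?w f else 0)" using \<theta> by simp
    also have "\<dots> \<le> (\<Sum>\<theta>\<in>\<Theta>. if f \<in> XX \<theta> then ?w f else 0)"
      by (rule member_le_sum[OF \<theta>(1)]) (use w0 f fin\<Theta> in auto)
    finally show "?w f \<le> (\<Sum>\<theta>\<in>\<Theta>. if f \<in> XX \<theta> then ?w f else 0)" .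
  qed
  also have "\<dots> = (\<Sum>\<theta>\<in>\<Theta>. \<Sum>f\<in>?bad. if f \<in> XX \<theta> then ?w f else 0)"
    by (rule sum.swap)
  also have "\<dots> \<le> (\<Sum>\<theta>\<in>\<Theta>. \<Sum>f\<in>XX \<theta>. ?w f)"
  proof (rule sum_mono)
    fix \<theta> assume "\<theta> \<in> \<Theta>"
    have sub: "XX \<theta> \<subseteq> conf P" by (cases \<theta>) (auto simp: XX_def runs_def)
    have "(\<Sum>f\<in>?bad. if f \<in> XX \<theta> then ?w f else 0) = (\<Sum>f\<in>?bad \<inter> XX \<theta>. ?w f)"
      by (rule sum.inter_restrict[symmetric]) (use finite_filter_set[OF finR] in simp)
    also have "\<dots> \<le> (\<Sum>f\<in>XX \<theta>. ?w f)"
      by (rule sum_mono2) (use sub finite_subset[OF sub finR] w0 in auto)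
    finally show "(\<Sum>f\<in>?bad. if f \<in> XX \<theta> then ?w f else 0) \<le> (\<Sum>f\<in>XX \<theta>. ?w f)" .
  qed
  finally have "real S * (\<Sum>f\<in>?bad. ?w f) \<le> real S * (\<Sum>\<theta>\<in>\<Theta>. \<Sum>f\<in>XX \<theta>. ?w f)"
    by (rule mult_left_mono) simp
  also have "\<dots> = (\<Sum>\<theta>\<in>\<Theta>. real S * (\<Sum>f\<in>XX \<theta>. ?w f))" by (rule sum_distrib_left)
  also have "\<dots> \<le> (\<Sum>\<theta>\<in>\<Theta>. ?C * ?Z)" by (rule sum_mono) (rule each)
  also have "\<dots> = real (card \<Theta>) * (?C * ?Z)" by simp
  also have "\<dots> \<le> real ((B + 1) * (B + 1) * m * ((B + 1) * m) * m) * (?C * ?Z)"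
  proof (rule mult_right_mono)
    have "card {- int B..0} = B + 1" "card {1..int B + 1} = B + 1" "card {2..m} = m - 1" by auto
    then have "card \<Theta> = (B + 1) * ((B + 1) * ((m - 1) * ((B + 1) * m * m)))"
      unfolding \<Theta>_def by (simp only: card_cartesian_product card_lessThan card_atLeastAtMost diff_Suc_1 add_diff_cancel_right')
    also have "\<dots> \<le> (B + 1) * ((B + 1) * (m * ((B + 1) * m * m)))"
      by (intro mult_le_mono2 mult_le_mono1) simp
    also have "\<dots> = (B + 1) * (B + 1) * m * ((B + 1) * m) * m" by (simp only: mult.assoc)
    finally show "real (card \<Theta>) \<le> real ((B + 1) * (B + 1) * m * ((B + 1) * m) * m)" by (simp only: of_nat_le_iff)
    show "0 \<le> ?C * ?Z" using Z0 lo hi by simp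
  qed
  finally show ?thesis by (simp add: bad_const_def B_def mult_ac)
qed

end

section \<open>Comparison of the two partition functions\<close>

context nbhd
begin

text \<open>Vertices of \<open>U' - U\<close> are added one at a time; restrictions of
  \<open>g\<close> supply the escape routes for the maximum principle at every intermediate
  stage.\<close>

lemma zsum_ratio_mono:
  assumes fin: "finite (U' \<union> P)" and UU': "U \<subseteq> U'" and disj: "U' \<inter> (P \<union> \<rho> ` P) = {}"
    and pos: "\<And>x u. x \<in> U' \<union> P \<Longrightarrow> u \<in> nb x \<Longrightarrow> c x u > 0"
    and g: "g \<in> pointers nb U'"
  shows "zsum nb c \<rho> P U / zsum nb c \<rho> {} U \<le> zsum nb c \<rho> P U' / zsum nb c \<rho> {} U'"
proof -
  have free_pos: "zsum nb c \<rho> {} W > 0" if "W \<subseteq> U'" for W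
  proof (rule zsum_pos)
    show "(\<lambda>v. if v \<in> W then g v else v) \<in> rooted nb \<rho> {} W"
      using restrict_pointers[OF g that] by (simp add: rooted_def)
    show "finite (W \<union> {})" using fin that finite_subset by auto
  qed (use that pos in auto)
  have "zsum nb c \<rho> P U / zsum nb c \<rho> {} U
    \<le> zsum nb c \<rho> P (U \<union> W) / zsum nb c \<rho> {} (U \<union> W)" if "W \<subseteq> U' - U" "finite W" for W
    using that(2,1)
  proof (induction W rule: finite_induct)
    case (insert v W)
    have W: "U \<union> W \<subseteq> U'" "insert v (U \<union> W) \<subseteq> U'" "v \<notin> U \<union> W" using insert.prems UU' insert.hyps by auto
    have v: "v \<notin> P" "v \<notin> \<rho> ` P" using insert.prems disj by auto
    have gW: "(\<lambda>v. if v \<in> U \<union> W then g v else v) \<in> pointers nb (U \<union> W)" by (rule restrict_pointers[OF g W(1)])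
    have "zsum nb c \<rho> P (U \<union> W) * zsum nb c \<rho> {} (insert v (U \<union> W))
      \<le> zsum nb c \<rho> P (insert v (U \<union> W)) * zsum nb c \<rho> {} (U \<union> W)"
    proof (rule zsum_ratio_insert[OF _ _ v(2) _ _ gW])
      show "finite (U \<union> W \<union> P)" using fin W(1) finite_subset by auto
      show "v \<notin> U \<union> W \<union> P" using W(3) v by auto
      show "(U \<union> W) \<inter> P = {}" using W(1) disj by auto
    qed (use pos W(2) in auto)
    then have "zsum nb c \<rho> P (U \<union> W) / zsum nb c \<rho> {} (U \<union> W)
      \<le> zsum nb c \<rho> P (insert v (U \<union> W)) / zsum nb c \<rho> {} (insert v (U \<union> W))"
      using free_pos[OF W(1)] free_pos[OF W(2)] by (simp add: frac_le_eq divide_simps mult_ac)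
    then show ?case using insert by simp
  qed simp
  from this[of "U' - U"] show ?thesis using UU' fin by (simp add: Un_absorb1)
qed

end

context strip_window
begin

section \<open>Positivity, and the comparison of good configurations\<close>

lemma P\<sigma>_insert: "1 \<le> K \<Longrightarrow> U \<union> P\<sigma> = insert (0, 1) (U \<union> P\<tau>)"
  by (auto simp: starts_def)

lemma not_01: "(0, 1) \<notin> U \<union> P\<tau>"
  using U by auto

text \<open>Provides a \<tau>-configuration and thereby nonzero denominators. The standard one works
  for every \<open>U\<close> containing the window: levels increase until the orbit leaves the
  domain.\<close>

lemma upward_pointers: "(\<lambda>v. if v \<in> U \<union> P\<tau> then upward m v else v) \<in> conf P\<tau>"
proof -
  let ?D = "U \<union> P\<tau>"
  define g where "g = (\<lambda>v. if v \<in> U \<union> P\<tau> then upward m v else v)"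
  have lv: "fst v < m" if "v \<in> ?D" for v using level_UP[of P\<tau> v] that by auto
  have n01: "v \<noteq> (0, 1)" if "v \<in> ?D" for v using not_01 that by auto
  have up: "fst (g v) = Suc (fst v)" if "v \<in> ?D" for v
    using that lv[OF that] n01[OF that] by (simp add: upward_def g_def)
  have "\<exists>i. (g ^^ i) v \<notin> ?D" for v
  proof (rule ccontr)
    assume "\<nexists>i. (g ^^ i) v \<notin> ?D"
    then have a: "(g ^^ i) v \<in> ?D" for i by blast
    have "fst ((g ^^ i) v) \<ge> i" for i
    proof (induction i)
      case (Suc i)
      then show ?case using up[OF a[of i]] by simp
    qed simp
    then show False using lv[OF a[of m]] by (meson not_less)
  qed
  moreover have "g v \<in> nbrs v" if "v \<in> ?D" for v
    using upward_nbrs[OF lv[OF that] n01[OF that]] that by (simp add: g_def)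
  ultimately have ptr: "g \<in> pointers nbrs ?D" by (simp add: pointers_def g_def)
  have fixm: "g (m, x) = (m, x)" for x using lv[of "(m, x)"] unfolding g_def by auto
  have inU: "(l, x) \<in> U" if "0 < l" "l < m" "\<bar>x\<bar> \<le> int K" for l x
    by (rule subsetD[OF window]) (use that in auto)
  have vert: "(g ^^ i) (l, x) = (l + i, x)" if "l + i \<le> m" "\<bar>x\<bar> \<le> int K" "1 \<le> l \<or> x \<le> 0" for l i x
    using that(1)
  proof (induction i)
    case (Suc i)
    have "(l + i, x) \<in> ?D"
      using inU[of "l + i" x] Suc.prems that by (cases "l + i = 0") (auto simp: starts_def)
    then have "g (l + i, x) = (Suc (l + i), x)"
      using Suc.prems that by (auto simp: upward_def g_def)
    then show ?case using Suc by simp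
  qed simp
  have "root_of g p = target m p" if p: "p \<in> P\<tau>" for p
  proof (rule root_of_eqI)
    show "g (target m p) = target m p" using fixm by (simp add: target_def)
    have p': "fst p = 0" "\<bar>snd p\<bar> \<le> int K" "snd p \<noteq> 1" using p by (auto simp: starts_def)
    show "reaches g p (target m p)"
    proof (cases "snd p \<le> 0")
      case True
      then have "(g ^^ m) p = (m, snd p)" using vert[of 0 m "snd p"] p' by (cases p) simp
      then show ?thesis using True unfolding reaches_def target_def by (intro exI[of _ m]) simp
    next
      case False
      have "g p = (1, snd p - 1)" using p p' False m_ge by (simp add: upward_def prod_eq_iff g_def)
      moreover have "(g ^^ (m - 1)) (1, snd p - 1) = (m, snd p - 1)"
        using vert[of 1 "m - 1" "snd p - 1"] p' False m_ge by simp
      then have "reaches g (1, snd p - 1) (m, snd p - 1)" unfolding reaches_def by blast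
      ultimately show ?thesis using reaches_from_step[of g p] False by (simp add: target_def)
    qed
  qed
  then show ?thesis using ptr by (simp add: rooted_def g_def)
qed

lemma zsum\<tau>_pos: "zs P\<tau> > 0"
  by (rule zsum_pos[OF finite_UP upward_pointers]) (use c_pos level_UP[of P\<tau>] in auto)

lemma free_pointers: "\<exists>g. g \<in> pointers nbrs U"
proof -
  have "(\<lambda>v. if v \<in> U \<union> P\<tau> then upward m v else v) \<in> pointers nbrs (U \<union> P\<tau>)"
    using upward_pointers by (simp add: rooted_def)
  from restrict_pointers[OF this, of U] show ?thesis by blast
qed

lemma zsum_free_pos: "zs {} > 0"
proof -
  obtain g where "g \<in> pointers nbrs U" using free_pointers by blast
  then have "g \<in> conf {}" by (simp add: rooted_def)
  then show ?thesis using finU c_pos level_UP[of P\<tau>] by (intro zsum_pos) auto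
qed

lemma good_reaches:
  assumes g: "good f" and P: "P = P\<sigma> \<or> P = P\<tau>" and f: "f \<in> pointers nbrs (U \<union> P)"
  shows "reaches f (0, 0) v \<Longrightarrow> snd v = 0" "root_of f (1, 0) = (m, 0)" "root_of f (1, 1) = (m, 1)"
proof -
  have t0: "f (l, 0) = (Suc l, 0)" if "l < m" for l
    using g that by (simp add: good_def tight_def col_def)
  have t1: "f (l, 1) = (Suc l, 1)" if "1 \<le> l" "l < m" for l
  proof -
    have "col 1 1 l = 1" "col 1 1 (Suc l) = 1" using that by (simp_all add: col_def)
    then show ?thesis using g that unfolding good_def tight_def by metis
  qed
  have fm: "f (m, x) = (m, x)" for x
    using pointers_out[OF f, of "(m, x)"] level_UP[OF P, of "(m, x)"] by auto
  have "snd (f v) = 0" if "snd v = 0" for v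
  proof (cases "fst v < m")
    case True
    then show ?thesis using t0[of "fst v"] that by (cases v) simp
  next
    case False
    then show ?thesis using pointers_out[OF f, of v] level_UP[OF P, of v] that by metis
  qed
  then have s0: "snd ((f ^^ i) (0, 0)) = 0" for i
    by (induction i) simp_all
  then show "reaches f (0, 0) v \<Longrightarrow> snd v = 0" by (auto simp: reaches_def)
  have 0: "1 + i \<le> m \<Longrightarrow> (f ^^ i) (1, 0) = (1 + i, 0)" for i
    by (induction i) (use t0 in auto)
  have 1: "1 + i \<le> m \<Longrightarrow> (f ^^ i) (1, 1) = (1 + i, 1)" for i
    by (induction i) (use t1 in auto)
  show "root_of f (1, 0) = (m, 0)"
    by (rule root_of_eqI[of f "(m, 0)", OF fm]) (use 0[of "m - 1"] m_ge in \<open>auto simp: reaches_def intro!: exI[of _ "m - 1"]\<close>)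
  show "root_of f (1, 1) = (m, 1)"
    by (rule root_of_eqI[of f "(m, 1)", OF fm]) (use 1[of "m - 1"] m_ge in \<open>auto simp: reaches_def intro!: exI[of _ "m - 1"]\<close>)
qed

lemma good_upd: "good (f((0, 1) := u)) \<longleftrightarrow> good f"
proof -
  have "tight m (f((0, 1) := u)) 0 0 \<longleftrightarrow> tight m f 0 0" by (simp add: tight_def col_def)
  moreover have "tight m (f((0, 1) := u)) 1 1 \<longleftrightarrow> tight m f 1 1"
    unfolding tight_def by (intro all_cong imp_cong refl) (auto simp: col_def)
  ultimately show ?thesis by (simp add: good_def)
qed

text \<open>The low edge at vertex 1 leads to (1, 1) and so to 1', the wrong root; hence the high
  edge. Deleting it changes no other prescribed root: another start whose path ran through (0, 1)
  would end at 0', hence be 0, and the path of 0 is vertical.\<close>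

lemma good_remove:
  assumes K: "1 \<le> K" and f: "f \<in> conf P\<sigma>" and g: "good f"
  shows "f (0, 1) = (1, 0)" "f((0, 1) := (0, 1)) \<in> conf P\<tau>"
proof -
  have fp: "f \<in> pointers nbrs (U \<union> P\<sigma>)" and root: "\<And>p. p \<in> P\<sigma> \<Longrightarrow> root_of f p = target m p" using f by (auto simp: rooted_def)
  have in01: "(0, 1) \<in> P\<sigma>" using K by (auto simp: starts_def)
  have r01: "root_of f (0, 1) = (m, 0)" using root[OF in01] by (simp add: target_def)
  have "f (0, 1) \<in> nbrs (0, 1)" using pointers_nb[OF fp, of "(0, 1)"] in01 by blast
  moreover have "f (0, 1) \<noteq> (1, 1)" using root_of_step[OF fp, of "(0, 1)"] r01 good_reaches(3)[OF g _ fp] by auto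
  ultimately show "f (0, 1) = (1, 0)" by auto
  let ?h = "f((0, 1) := (0, 1))"
  have "?h = (\<lambda>v. if v \<in> U \<union> P\<tau> then f v else v)"
  proof
    fix v show "?h v = (if v \<in> U \<union> P\<tau> then f v else v)"
      using pointers_out[OF fp, of v] not_01 by (cases "v = (0, 1)") auto
  qed
  then have hp: "?h \<in> pointers nbrs (U \<union> P\<tau>)" using restrict_pointers[OF fp, of "U \<union> P\<tau>"] by auto
  have "root_of ?h p = target m p" if p: "p \<in> P\<tau>" for p
  proof -
    have "\<not> reaches f p (0, 1)"
    proof
      assume r: "reaches f p (0, 1)"
      have "target m p = (m, 0)" using root_of_cong[OF fp r] r01 root[of p] p by auto
      then have "p = (0, 0)" using p by (auto simp: target_def starts_def split: if_splits)
      then show False using good_reaches(1)[OF g _ fp, of "(0, 1)"] r by auto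
    qed
    then show ?thesis using upd_root_of[OF fp, of p "(0, 1)" "(0, 1)"] p root[of p] by auto
  qed
  then show "?h \<in> conf P\<tau>" using hp by (simp add: rooted_def)
qed

text \<open>No cycle arises, since (1, 0) is rooted at 0' and so does not lead to the root (0,
  1).\<close>

lemma good_add:
  assumes K: "1 \<le> K" and h: "h \<in> conf P\<tau>" and g: "good h"
  shows "h((0, 1) := (1, 0)) \<in> conf P\<sigma>"
proof -
  have hp: "h \<in> pointers nbrs (U \<union> P\<tau>)" and root: "\<And>p. p \<in> P\<tau> \<Longrightarrow> root_of h p = target m p" using h by (auto simp: rooted_def)
  have h01: "h (0, 1) = (0, 1)" using pointers_out[OF hp not_01] .
  have nr: "\<not> reaches h v (0, 1)" if "fst (root_of h v) = m" for v
    using root_of_eqI[of h "(0, 1)" v] h01 that m_ge by auto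
  have r10: "root_of h (1, 0) = (m, 0)" using good_reaches(2)[OF g _ hp] by simp
  have n10: "\<not> reaches h (1, 0) (0, 1)" using nr[of "(1, 0)"] r10 by simp
  have "h((0, 1) := (1, 0)) \<in> pointers nbrs (insert (0, 1) (U \<union> P\<tau>))"
    by (rule upd_pointers[OF hp _ n10]) simp
  then have "h((0, 1) := (1, 0)) \<in> pointers nbrs (U \<union> P\<sigma>)" using P\<sigma>_insert[OF K] by simp
  moreover have "root_of (h((0, 1) := (1, 0))) p = target m p" if p: "p \<in> P\<sigma>" for p
  proof (cases "p = (0, 1)")
    case True
    then show ?thesis using upd_root_of_at[OF hp n10] r10 by (simp add: target_def)
  next
    case False
    then have p: "p \<in> P\<tau>" using p by simp
    have "\<not> reaches h p (0, 1)" using nr[of p] root[OF p] by (simp add: target_def)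
    then show ?thesis using upd_root_of[OF hp, of p "(0, 1)" "(1, 0)"] p root[OF p] by auto
  qed
  ultimately show ?thesis by (simp add: rooted_def)
qed

lemma good_sum:
  assumes K: "1 \<le> K"
  shows "(\<Sum>f\<in>{f \<in> conf P\<sigma>. good f}. wt c (U \<union> P\<sigma>) f) =
    c (0, 1) (1, 0) * (\<Sum>f\<in>{f \<in> conf P\<tau>. good f}. wt c (U \<union> P\<tau>) f)"
  unfolding sum_distrib_left
proof (rule sum.reindex_bij_witness[of _ "\<lambda>h. h((0, 1) := (1, 0))" "\<lambda>f. f((0, 1) := (0, 1))"])
  fix f assume f: "f \<in> {f \<in> conf P\<sigma>. good f}"
  then have f01: "f (0, 1) = (1, 0)" using good_remove(1)[OF K] by simp
  then show eq: "(f((0, 1) := (0, 1)))((0, 1) := (1, 0)) = f" by (simp add: fun_upd_idem)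
  show "f((0, 1) := (0, 1)) \<in> {f \<in> conf P\<tau>. good f}"
    using f good_remove(2)[OF K] good_upd by simp
  have "finite (U \<union> P\<tau>)" by (rule finite_UP) simp
  from wt_insert[OF this not_01, of "f((0, 1) := (0, 1))" "(1, 0)"]
  show "c (0, 1) (1, 0) * wt c (U \<union> P\<tau>) (f((0, 1) := (0, 1))) = wt c (U \<union> P\<sigma>) f"
    unfolding eq P\<sigma>_insert[OF K] by (simp add: mult.commute)
next
  fix h assume h: "h \<in> {f \<in> conf P\<tau>. good f}"
  then have "h (0, 1) = (0, 1)" using pointers_out[OF _ not_01, of h nbrs] by (simp add: rooted_def)
  then show "(h((0, 1) := (1, 0)))((0, 1) := (0, 1)) = h" by (simp add: fun_upd_idem)
  show "h((0, 1) := (1, 0)) \<in> {f \<in> conf P\<sigma>. good f}"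
    using h good_add[OF K] good_upd by simp
qed

lemma zsum_split:
  assumes "P = P\<sigma> \<or> P = P\<tau>"
  shows "zs P = (\<Sum>f\<in>{f \<in> conf P. good f}. wt c (U \<union> P) f) +
    (\<Sum>f\<in>{f \<in> conf P. \<not> good f}. wt c (U \<union> P) f)"
proof -
  have fin: "finite (conf P)" by (rule finite_rooted[OF finite_UP[OF assms]])
  have "zs P = (\<Sum>f\<in>{f \<in> conf P. good f} \<union> {f \<in> conf P. \<not> good f}. wt c (U \<union> P) f)"
    unfolding zsum_def by (rule sum.cong) auto
  also have "\<dots> = (\<Sum>f\<in>{f \<in> conf P. good f}. wt c (U \<union> P) f) +
    (\<Sum>f\<in>{f \<in> conf P. \<not> good f}. wt c (U \<union> P) f)"
    by (rule sum.union_disjoint) (use finite_filter_set[OF fin] in auto)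
  finally show ?thesis .
qed

text \<open>By \<open>good_sum\<close> the good parts cancel exactly in Z_\<sigma> - a Z_\<tau>,
  leaving only bad ones. The bound does not depend on \<open>U\<close>, which allows passing to the
  limit in N.\<close>

lemma ratio_close:
  assumes K: "int (defect_bound m) + 2 + int ((defect_bound m + 1) * (m * (n * S + 1))) \<le> int K" and S: "S \<ge> 1"
  shows "\<bar>zs P\<sigma> / zs P\<tau> - c (0, 1) (1, 0)\<bar>
    \<le> (1 + c (0, 1) (1, 0)) * bad_const / real S"
proof -
  have K1: "1 \<le> K" using K by linarith
  let ?\<sigma> = "zs P\<sigma>" and ?\<tau> = "zs P\<tau>" and ?a = "c (0, 1) (1, 0)"
  let ?b\<sigma> = "\<Sum>f\<in>{f \<in> conf P\<sigma>. \<not> good f}. wt c (U \<union> P\<sigma>) f"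
  let ?b\<tau> = "\<Sum>f\<in>{f \<in> conf P\<tau>. \<not> good f}. wt c (U \<union> P\<tau>) f"
  have a: "0 < ?a" by (rule c_pos) (use m_ge in auto)
  have b: "0 \<le> ?b\<sigma>" "0 \<le> ?b\<tau>" by (rule sum_nonneg, rule wt_nonneg, simp, simp)+
  have S0: "0 < real S" using S by simp
  have bS: "?b\<sigma> \<le> bad_const * ?\<tau> / real S" "?b\<tau> \<le> bad_const * ?\<tau> / real S"
    using bad_bound[OF _ K, of P\<sigma>] bad_bound[OF _ K, of P\<tau>] S0 by (simp_all add: field_simps)
  have eq: "?\<sigma> - ?a * ?\<tau> = ?b\<sigma> - ?a * ?b\<tau>"
    using zsum_split[of P\<sigma>] zsum_split[of P\<tau>] good_sum[OF K1] by (simp add: algebra_simps)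
  have ab: "?a * ?b\<tau> \<le> ?a * (bad_const * ?\<tau> / real S)" using bS(2) a by (intro mult_left_mono) auto
  have ab0: "0 \<le> ?a * ?b\<tau>" using a b by simp
  have "\<bar>?\<sigma> - ?a * ?\<tau>\<bar> \<le> bad_const * ?\<tau> / real S + ?a * (bad_const * ?\<tau> / real S)"
    unfolding eq using bS(1) ab ab0 b(1) by linarith
  also have "\<dots> = (1 + ?a) * bad_const / real S * ?\<tau>" by (simp add: add_divide_distrib algebra_simps)
  finally have "\<bar>?\<sigma> - ?a * ?\<tau>\<bar> / ?\<tau> \<le> (1 + ?a) * bad_const / real S"
    using zsum\<tau>_pos by (simp add: pos_divide_le_eq)
  moreover have "?\<sigma> / ?\<tau> - ?a = (?\<sigma> - ?a * ?\<tau>) / ?\<tau>" using zsum\<tau>_pos by (simp add: diff_divide_distrib)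
  then have "\<bar>?\<sigma> / ?\<tau> - ?a\<bar> = \<bar>?\<sigma> - ?a * ?\<tau>\<bar> / ?\<tau>" using zsum\<tau>_pos by (simp add: abs_divide)
  ultimately show ?thesis by simp
qed

end

section \<open>Truncations of the universal cover\<close>

lemma pointers_cong: "(\<And>v. v \<in> D \<Longrightarrow> nb v = nb' v) \<Longrightarrow> pointers nb D = pointers nb' D"
  by (auto simp: pointers_def)

lemma zsum_cong:
  assumes nb: "\<And>v. v \<in> U \<union> P \<Longrightarrow> nb v = nb' v"
    and c: "\<And>v u. v \<in> U \<union> P \<Longrightarrow> u \<in> nb v \<Longrightarrow> c v u = c' v u"
  shows "zsum nb c \<rho> P U = zsum nb' c' \<rho> P U"
  unfolding zsum_def
proof (rule sum.cong)
  show "rooted nb \<rho> P U = rooted nb' \<rho> P U"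
    unfolding rooted_def using pointers_cong[of "U \<union> P" nb nb'] nb by auto
  fix f assume "f \<in> rooted nb' \<rho> P U"
  then have "f v \<in> nb v" if "v \<in> U \<union> P" for v using nb that by (auto simp: rooted_def pointers_def)
  then show "wt c (U \<union> P) f = wt c' (U \<union> P) f"
    unfolding wt_def by (intro prod.cong) (use c in auto)
qed

text \<open>\<open>High k i\<close> joins columns i and i - 1, so its index is the larger column. On
  neighbouring vertices this inverts \<open>cover_ends\<close>.\<close>

definition cover_edge :: "vertex \<Rightarrow> vertex \<Rightarrow> edge" where
  "cover_edge v u = (let k = min (fst v) (fst u) in
     if snd u = snd v then Low k (snd v) else High k (max (snd v) (snd u)))"

definition cover_cond :: "nat \<Rightarrow> (edge \<Rightarrow> real) \<Rightarrow> vertex \<Rightarrow> vertex \<Rightarrow> real" where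
  "cover_cond n w v u = w (proj_edge n (cover_edge v u))"

lemma cover_edge_ends: "u \<in> nbrs v \<Longrightarrow> cover_ends (cover_edge v u) = {v, u}"
  by (cases v) (auto simp: cover_edge_def split: if_splits)

lemma cover_edge_cases:
  "u \<in> nbrs v \<Longrightarrow> \<exists>k i. cover_edge v u \<in> {Low k i, High k i} \<and> k \<le> fst v \<and> (k = fst v \<or> Suc k = fst v)"
  by (cases v) (auto simp: cover_edge_def split: if_splits)

lemma cover_cond_up: "cover_cond n w (l, i) (Suc l, i) = w (proj_edge n (Low l i))"
  "cover_cond n w (l, i) (Suc l, i - 1) = w (proj_edge n (High l i))"
  by (simp_all add: cover_cond_def cover_edge_def)

lemma cover_cond_periodic:
  "cover_cond n w (l, i + int n) (l', i' + int n) = cover_cond n w (l, i) (l', i')"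
proof -
  have "max (i + int n) (i' + int n) = max i i' + int n" by simp
  then show ?thesis by (simp add: cover_cond_def cover_edge_def Let_def)
qed

lemma cover_ends_inj: "cover_ends e = cover_ends e' \<Longrightarrow> e = e'"
  by (cases e; cases e') (auto simp: doubleton_eq_iff)

lemma cover_ends_nbrs: "cover_ends e = {v, u} \<Longrightarrow> v \<noteq> u \<Longrightarrow> u \<in> nbrs v"
  by (cases e; cases v; cases u) (auto simp: doubleton_eq_iff)

lemma cover_ends_distinct: "\<exists>x y. x \<noteq> y \<and> cover_ends e = {x, y}"
proof (cases e)
  case (Low k i)
  then show ?thesis by (intro exI[of _ "(k, i)"] exI[of _ "(k + 1, i)"]) simp
next
  case (High k i)
  then show ?thesis by (intro exI[of _ "(k, i)"] exI[of _ "(k + 1, i - 1)"]) simp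
qed

lemma edges_cover: "e \<in> edges (universal_cover n m w) \<longleftrightarrow> (case e of Low k i \<Rightarrow> k < m | High k i \<Rightarrow> k < m)"
  by (cases e) (auto simp: universal_cover_def)

lemma cover_simps [simp]:
  "ends (universal_cover n m w) = cover_ends"
  "verts (universal_cover n m w) = {0..m} \<times> UNIV"
  "bdry (universal_cover n m w) = {0, m} \<times> UNIV"
  "cond (universal_cover n m w) = (\<lambda>e. w (proj_edge n e))"
  by (simp_all add: universal_cover_def)

lemma cover_edge_mem: "fst v < m \<Longrightarrow> u \<in> nbrs v \<Longrightarrow> cover_edge v u \<in> edges (universal_cover n m w)"
  using cover_edge_cases[of u v] unfolding edges_cover by (auto split: edge.splits)

locale finite_truncation =
  fixes n m :: nat and w :: "edge \<Rightarrow> real" and V :: "vertex set"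
  assumes m: "m \<ge> 1" and finV: "finite V" and V: "V \<subseteq> {0..m} \<times> UNIV"
begin

abbreviation "H \<equiv> truncation (universal_cover n m w) V"

definition "U = V \<inter> ({0<..<m} \<times> UNIV)"

lemma H_edges: "edges H = {e \<in> edges (universal_cover n m w). cover_ends e \<inter> V \<noteq> {}}"
  and H_ends: "ends H = cover_ends"
  and H_cond: "cond H = (\<lambda>e. w (proj_edge n e))"
  and H_verts: "verts H = V \<union> (\<Union>e\<in>edges H. cover_ends e)"
  and H_bdry: "bdry H = verts H - (V - {0, m} \<times> UNIV)"
  by (simp_all add: truncation_def Let_def)

text \<open>A truncation also contains neighbours of \<open>V\<close> outside \<open>V\<close>; they
  count as boundary, whatever their level.\<close>

lemma interior: "verts H - bdry H = U"
  using V by (auto simp: H_bdry H_verts U_def)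

lemma finite_H_edges: "finite (edges H)"
proof (rule finite_subset)
  show "edges H \<subseteq> (\<Union>(k, i)\<in>V. {Low k i, Low (k - 1) i, High k i, High (k - 1) (i + 1)})"
  proof
    fix e assume "e \<in> edges H"
    then obtain v where "v \<in> V" "v \<in> cover_ends e" by (auto simp: H_edges)
    from this(2) show "e \<in> (\<Union>(k, i)\<in>V. {Low k i, Low (k - 1) i, High k i, High (k - 1) (i + 1)})"
      by (intro UN_I[OF \<open>v \<in> V\<close>]) (cases e; cases v; auto)
  qed
qed (use finV in auto)

sublocale simple_network H
proof
  show "finite (edges H)" by (rule finite_H_edges)
  have "finite (cover_ends e)" for e by (cases e) auto
  then show "finite (verts H)" using finV finite_H_edges unfolding H_verts by blast
  show "\<exists>x\<in>verts H. \<exists>y\<in>verts H. x \<noteq> y \<and> ends H e = {x, y}" if "e \<in> edges H" for e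
  proof -
    obtain x y where xy: "x \<noteq> y" "cover_ends e = {x, y}" using cover_ends_distinct by blast
    then have "x \<in> verts H" "y \<in> verts H" using that unfolding H_verts by blast+
    then show ?thesis using xy H_ends by auto
  qed
  show "inj_on (ends H) (edges H)" unfolding H_ends using cover_ends_inj by (auto intro: inj_onI)
  show "bdry H \<subseteq> verts H" unfolding H_bdry by blast
qed

lemma net_nb_H:
  assumes v: "v \<in> V" "fst v < m"
  shows "net_nb H v = nbrs v"
proof
  show "net_nb H v \<subseteq> nbrs v"
  proof
    fix u assume "u \<in> net_nb H v"
    then obtain e where e: "e \<in> edges H" "cover_ends e = {v, u}" by (auto simp: net_nb_def H_ends)
    then have "v \<noteq> u" using cover_ends_distinct[of e] by auto
    then show "u \<in> nbrs v" using cover_ends_nbrs e(2) by blast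
  qed
  show "nbrs v \<subseteq> net_nb H v"
  proof
    fix u assume u: "u \<in> nbrs v"
    have "cover_edge v u \<in> edges H"
      using cover_edge_mem[OF v(2) u] cover_edge_ends[OF u] v(1) by (simp add: H_edges)
    then show "u \<in> net_nb H v" using cover_edge_ends[OF u] by (auto simp: net_nb_def H_ends)
  qed
qed

lemma cond_edge_between:
  assumes v: "v \<in> V" "fst v < m" "u \<in> nbrs v"
  shows "cond H (edge_between H v u) = cover_cond n w v u"
proof -
  have "cover_edge v u \<in> edges H"
    using cover_edge_mem[OF v(2,3)] cover_edge_ends[OF v(3)] v(1) by (simp add: H_edges)
  then have "edge_between H v u = cover_edge v u"
    by (rule edge_between_eq) (simp add: H_ends cover_edge_ends[OF v(3)])
  then show ?thesis by (simp add: H_cond cover_cond_def)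
qed

text \<open>Pointers start only at vertices of \<open>V\<close> below level m, and these have all
  their edges in the truncation; so its neighbourhoods may be replaced by those of the infinite
  strip.\<close>

lemma Z_zsum:
  assumes A: "A \<subseteq> V \<inter> ({0} \<times> UNIV)" and \<rho>: "\<rho> ` A \<subseteq> V \<inter> ({m} \<times> UNIV)"
  shows "Z H (root_partition H A \<rho>) = zsum nbrs (cover_cond n w) \<rho> A U"
proof -
  have "Z H (root_partition H A \<rho>) = zsum (net_nb H) (\<lambda>v u. cond H (edge_between H v u)) \<rho> A (verts H - bdry H)"
  proof (rule Z_root_partition)
    have b: "x \<in> bdry H" if "x \<in> V" "x \<in> {0, m} \<times> UNIV" for x
      using that unfolding H_bdry H_verts by blast
    have "V \<inter> ({0} \<times> UNIV) \<subseteq> bdry H" "V \<inter> ({m} \<times> UNIV) \<subseteq> bdry H" using b by blast+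
    moreover have "A \<inter> \<rho> ` A = {}" using A \<rho> m by fastforce
    ultimately show "A \<subseteq> bdry H" "\<rho> ` A \<subseteq> bdry H - A" using A \<rho> by blast+
  qed
  also have "\<dots> = zsum nbrs (cover_cond n w) \<rho> A U"
    unfolding interior
  proof (rule zsum_cong)
    have vV: "v \<in> V \<and> fst v < m" if "v \<in> U \<union> A" for v using that A m by (auto simp: U_def)
    show "net_nb H v = nbrs v" if "v \<in> U \<union> A" for v using net_nb_H vV[OF that] by blast
    then show "cond H (edge_between H v u) = cover_cond n w v u" if "v \<in> U \<union> A" "u \<in> net_nb H v" for v u
      using cond_edge_between vV[OF that(1)] that by blast
  qed
  finally show ?thesis .
qed

lemma sing_root: "sing H = root_partition H {} \<rho>"
  by (simp add: sing_def root_partition_def)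

context
  fixes K :: nat
  assumes K: "K \<ge> 1" and win: "{0..m} \<times> {- int K..int K} \<subseteq> V"
begin

lemma bdry_win: "\<bar>x\<bar> \<le> int K \<Longrightarrow> (0, x) \<in> bdry H" "\<bar>x\<bar> \<le> int K \<Longrightarrow> (m, x) \<in> bdry H"
proof -
  assume "\<bar>x\<bar> \<le> int K"
  then have "(0, x) \<in> V" "(m, x) \<in> V" by (auto intro!: subsetD[OF win])
  then show "(0, x) \<in> bdry H" "(m, x) \<in> bdry H" unfolding H_bdry H_verts by blast+
qed

section \<open>\<tau> and \<sigma> as root partitions\<close>

lemma mem_tau_pairs: "X \<in> tau_pairs m K \<longleftrightarrow> (\<exists>k. X = {(0, k), (m, k - 1)} \<and> 2 \<le> k \<and> k \<le> int K) \<or>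
    (\<exists>k. X = {(0, k), (m, k)} \<and> - int K \<le> k \<and> k \<le> 0)"
  by (simp only: tau_pairs_def Un_iff mem_Collect_eq)

lemma Union_tau_pairs: "\<Union> (tau_pairs m K) = (starts K - {(0, 1)}) \<union> {m} \<times> {- int K..int K - 1}"
proof
  show "\<Union> (tau_pairs m K) \<subseteq> (starts K - {(0, 1)}) \<union> {m} \<times> {- int K..int K - 1}"
    using m K by (auto simp: tau_pairs_def starts_def)
  show "(starts K - {(0, 1)}) \<union> {m} \<times> {- int K..int K - 1} \<subseteq> \<Union> (tau_pairs m K)"
  proof
    fix v assume v: "v \<in> (starts K - {(0, 1)}) \<union> {m} \<times> {- int K..int K - 1}"
    obtain l x where lx: "v = (l, x)" by (cases v)
    consider "l = 0" "- int K \<le> x" "x \<le> 0" | "l = 0" "2 \<le> x" "x \<le> int K"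
      | "l = m" "- int K \<le> x" "x \<le> 0" | "l = m" "2 \<le> x + 1" "x + 1 \<le> int K"
      using v lx by (force simp: starts_def)
    then show "v \<in> \<Union> (tau_pairs m K)"
    proof cases
      case 1
      then show ?thesis using lx unfolding tau_pairs_def by blast
    next
      case 2
      then show ?thesis using lx unfolding tau_pairs_def by blast
    next
      case 3
      then show ?thesis using lx unfolding tau_pairs_def by blast
    next
      case 4
      have "{(0, x + 1), (m, x + 1 - 1)} \<in> tau_pairs m K" using 4 unfolding tau_pairs_def by blast
      then show ?thesis using lx 4 by auto
    qed
  qed
qed

text \<open>Only 0' has two starts over it, 0 and 1; whether (0, 1) is kept in
  \<open>starts K\<close> is thus all that separates \<sigma> from \<tau>.\<close>

lemma fiber_low: "- int K \<le> x \<Longrightarrow> x < 0 \<Longrightarrow> {p \<in> starts K. target m p = (m, x)} = {(0, x)}"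
  and fiber_high: "1 \<le> x \<Longrightarrow> x \<le> int K - 1 \<Longrightarrow> {p \<in> starts K. target m p = (m, x)} = {(0, x + 1)}"
  and fiber_zero: "{p \<in> starts K. target m p = (m, 0)} = {(0, 0), (0, 1)}"
  and fiber_none: "r \<notin> {m} \<times> {- int K..int K - 1} \<Longrightarrow> {p \<in> starts K. target m p = r} = {}"
  using K by (auto simp: starts_def target_def split: if_splits)

lemma fiber_minus: "{p \<in> starts K - {(0, 1)}. target m p = r} = {p \<in> starts K. target m p = r} - {(0, 1)}"
  by auto

lemma root_partition_tau: "root_partition H (starts K - {(0, 1)}) (target m) = tau m K H" (is "?L = ?R")
proof
  let ?A = "starts K - {(0, 1)}" and ?part = "\<lambda>r. {r} \<union> {p \<in> starts K - {(0, 1)}. target m p = r}"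
  show "?L \<subseteq> ?R"
  proof
    fix X assume "X \<in> ?L"
    then obtain r where r: "r \<in> bdry H" "r \<notin> ?A" and X: "X = ?part r" by (auto simp: root_partition_def)
    show "X \<in> ?R"
    proof (cases "r \<in> {m} \<times> {- int K..int K - 1}")
      case True
      then obtain x where x: "r = (m, x)" "- int K \<le> x" "x \<le> int K - 1" by auto
      have "X \<in> tau_pairs m K"
      proof (cases "x \<le> 0")
        case True
        have "{p \<in> ?A. target m p = r} = {(0, x)}"
          using True x(2) unfolding fiber_minus x(1) by (cases "x = 0") (simp_all add: fiber_low fiber_zero insert_Diff_if)
        then have "X = {(0, x), (m, x)}" unfolding X x(1) by auto
        then show ?thesis using True x(2) unfolding tau_pairs_def by blast
      next
        case False
        have "{p \<in> ?A. target m p = r} = {(0, x + 1)}"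
          using False x(3) unfolding fiber_minus x(1) by (simp add: fiber_high)
        then have "X = {(0, x + 1), (m, x + 1 - 1)}" unfolding X x(1) by auto
        moreover have "2 \<le> x + 1" "x + 1 \<le> int K" using False x(3) by auto
        ultimately show ?thesis unfolding tau_pairs_def by blast
      qed
      then show ?thesis by (simp add: tau_def)
    next
      case False
      then have "X = {r}" unfolding X fiber_minus fiber_none[OF False] by simp
      then show ?thesis using r False unfolding tau_def Union_tau_pairs by blast
    qed
  qed
  show "?R \<subseteq> ?L"
  proof
    fix X assume "X \<in> ?R"
    then have "X \<in> tau_pairs m K \<or> (\<exists>b. X = {b} \<and> b \<in> bdry H - \<Union> (tau_pairs m K))"
      by (simp only: tau_def Un_iff mem_Collect_eq)
    then consider k where "X = {(0, k), (m, k - 1)}" "2 \<le> k" "k \<le> int K"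
      | k where "X = {(0, k), (m, k)}" "- int K \<le> k" "k \<le> 0"
      | b where "X = {b}" "b \<in> bdry H" "b \<notin> \<Union> (tau_pairs m K)"
      unfolding mem_tau_pairs Diff_iff by metis
    then have "\<exists>r\<in>bdry H - ?A. X = ?part r"
    proof cases
      case 1
      have "{p \<in> ?A. target m p = (m, k - 1)} = {(0, k)}"
        using 1 unfolding fiber_minus by (subst fiber_high) auto
      then have "X = ?part (m, k - 1)" using 1 by auto
      moreover have "(m, k - 1) \<in> bdry H - ?A" using 1 bdry_win(2)[of "k - 1"] m by (auto simp: starts_def)
      ultimately show ?thesis by blast
    next
      case 2
      have "{p \<in> ?A. target m p = (m, k)} = {(0, k)}"
        using 2 unfolding fiber_minus by (cases "k = 0") (simp_all add: fiber_low fiber_zero insert_Diff_if)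
      then have "X = ?part (m, k)" using 2 by auto
      moreover have "(m, k) \<in> bdry H - ?A" using 2 bdry_win(2)[of k] m by (auto simp: starts_def)
      ultimately show ?thesis by blast
    next
      case 3
      then have "b \<notin> ?A" "b \<notin> {m} \<times> {- int K..int K - 1}" unfolding Union_tau_pairs by auto
      then have "X = ?part b" unfolding fiber_minus using 3(1) by (subst fiber_none) auto
      then show ?thesis using 3(2) \<open>b \<notin> ?A\<close> by blast
    qed
    then show "X \<in> ?L" unfolding root_partition_def by blast
  qed
qed

text \<open>Starting from \<tau>, the parts of (0, 1) and (m, 0) are replaced by one;
  \<open>notin\<close> shows that the set difference in \<open>sigma\<close> removes no other
  part.\<close>

lemma root_partition_sigma: "root_partition H (starts K) (target m) = sigma m K H"
proof -
  let ?A = "starts K - {(0, 1)}"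
  let ?pt = "\<lambda>r. {r} \<union> {p \<in> ?A. target m p = r}" and ?ps = "\<lambda>r. {r} \<union> {p \<in> starts K. target m p = r}"
  let ?B = "bdry H - starts K - {(m, 0)}"
  have m0: "(m, 0) \<in> bdry H - starts K" using bdry_win(2)[of 0] m by (auto simp: starts_def)
  have b01: "(0, 1) \<in> bdry H" using bdry_win(1)[of 1] K by auto
  have in01: "(0, 1) \<in> starts K" using K by (auto simp: starts_def)
  have "tau m K H = ?pt ` (bdry H - ?A)" unfolding root_partition_tau[symmetric] root_partition_def ..
  also have "bdry H - ?A = insert (0, 1) (insert (m, 0) ?B)" using m0 b01 in01 by auto
  finally have tau: "tau m K H = insert (?pt (0, 1)) (insert (?pt (m, 0)) (?pt ` ?B))"
    by (simp only: image_insert)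
  have p01: "?pt (0, 1) = {(0, 1)}" unfolding fiber_minus using m by (subst fiber_none) auto
  have pm0: "?pt (m, 0) = {(0, 0), (m, 0)}" unfolding fiber_minus fiber_zero using m by auto
  have notin: "{(0, 1)} \<notin> ?pt ` ?B" "{(0, 0), (m, 0)} \<notin> ?pt ` ?B"
  proof -
    show "{(0, 1)} \<notin> ?pt ` ?B" using in01 by auto
    show "{(0, 0), (m, 0)} \<notin> ?pt ` ?B"
    proof
      assume "{(0, 0), (m, 0)} \<in> ?pt ` ?B"
      then obtain r where r: "r \<in> ?B" "{(0, 0), (m, 0)} = ?pt r" by blast
      have "(m, 0) \<in> ?pt r" unfolding r(2)[symmetric] by simp
      then show False using r(1) m by (auto simp: starts_def)
    qed
  qed
  have eq: "?pt ` ?B = ?ps ` ?B"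
  proof (rule image_cong[OF refl])
    fix r assume "r \<in> ?B"
    then have "target m (0, 1) \<noteq> r" by (auto simp: target_def)
    then show "?pt r = ?ps r" by auto
  qed
  have "sigma m K H = insert {(0, 1), (0, 0), (m, 0)} (?pt ` ?B)"
    unfolding sigma_def tau p01 pm0 using notin by auto
  also have "{(0, 1), (0, 0), (m, 0)} = ?ps (m, 0)" unfolding fiber_zero by auto
  also have "insert (?ps (m, 0)) (?pt ` ?B) = ?ps ` (bdry H - starts K)"
    unfolding eq using m0 by auto
  finally show ?thesis unfolding root_partition_def by simp
qed

lemma win_A: "starts K \<subseteq> V \<inter> ({0} \<times> UNIV)" "target m ` starts K \<subseteq> V \<inter> ({m} \<times> UNIV)"
proof -
  show "starts K \<subseteq> V \<inter> ({0} \<times> UNIV)" using win by (auto simp: starts_def)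
  have "target m p \<in> {0..m} \<times> {- int K..int K}" if "p \<in> starts K" for p
    using that by (auto simp: starts_def target_def)
  then show "target m ` starts K \<subseteq> V \<inter> ({m} \<times> UNIV)" using win by (auto simp: target_def)
qed

abbreviation "zc P \<equiv> zsum nbrs (cover_cond n w) (target m) P"

lemma Prbar_tau: "Prbar H (tau m K H) =
    zc (starts K - {(0, 1)}) U / zc {} U"
  and Prbar_sigma: "Prbar H (sigma m K H) =
    zc (starts K) U / zc {} U"
proof -
  have s: "Z H (sing H) = zc {} U"
    unfolding sing_root[of "target m"] by (rule Z_zsum) auto
  have "Z H (tau m K H) = zc (starts K - {(0, 1)}) U"
    unfolding root_partition_tau[symmetric] by (rule Z_zsum) (use win_A in auto)
  then show "Prbar H (tau m K H) =
    zc (starts K - {(0, 1)}) U / zc {} U"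
    by (simp add: Prbar_def s)
  have "Z H (sigma m K H) = zc (starts K) U"
    unfolding root_partition_sigma[symmetric] by (rule Z_zsum) (use win_A in auto)
  then show "Prbar H (sigma m K H) =
    zc (starts K) U / zc {} U"
    by (simp add: Prbar_def s)
qed

end

end

section \<open>The iterated limit\<close>

context strip_window
begin

lemma ratio_mono:
  assumes P: "P = P\<sigma> \<or> P = P\<tau>" and U0: "U0 \<subseteq> U"
  shows "zsum nbrs c (target m) P U0 / zsum nbrs c (target m) {} U0 \<le> zs P / zs {}"
proof -
  obtain g where g: "g \<in> pointers nbrs U" using free_pointers by blast
  have "U \<inter> (P \<union> target m ` P) = {}" using P U by (auto simp: starts_def target_def)
  then show ?thesis
    by (rule zsum_ratio_mono[OF finite_UP[OF P] U0 _ _ g]) (use c_pos level_UP[OF P] in auto)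
qed

lemma ratio_bounded:
  assumes P: "P = P\<sigma> \<or> P = P\<tau>"
  shows "zs P / zs {} \<le> (\<Prod>p\<in>P. \<Sum>u\<in>nbrs p. c p u)"
proof -
  have "U \<inter> P = {}" using P U by (auto simp: starts_def)
  then have "zs P \<le> (\<Prod>p\<in>P. \<Sum>u\<in>nbrs p. c p u) * zs {}"
    by (rule zsum_bounded[OF finite_UP[OF P]]) (use c_pos level_UP[OF P] in auto)
  then show ?thesis using zsum_free_pos by (simp add: pos_divide_le_eq)
qed

end

section \<open>Convergence, exhaustion, and constants of the cylinder\<close>

lemma eventually_mono_convergent:
  fixes x :: "nat \<Rightarrow> real"
  assumes mono: "\<And>N. N \<ge> N0 \<Longrightarrow> x N \<le> x (Suc N)" and bound: "\<And>N. N \<ge> N0 \<Longrightarrow> x N \<le> b"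
  shows "\<exists>l. x \<longlonglongrightarrow> l \<and> x N0 \<le> l"
proof -
  have inc: "incseq (\<lambda>N. x (N + N0))"
    by (rule incseq_SucI) (use mono in simp)
  obtain l where l: "(\<lambda>N. x (N + N0)) \<longlonglongrightarrow> l" "\<forall>i. x (i + N0) \<le> l"
    by (rule incseq_convergent[OF inc, of b]) (use bound in auto)
  have "x \<longlonglongrightarrow> l" by (rule LIMSEQ_offset[OF l(1)])
  then show ?thesis using l(2)[rule_format, of 0] by auto
qed

lemma finite_subset_exhaustion:
  fixes V :: "nat \<Rightarrow> 'a set"
  assumes mono: "\<And>N. N \<ge> 1 \<Longrightarrow> V N \<subseteq> V (N + 1)" and F: "finite F" "F \<subseteq> (\<Union>N\<in>{1..}. V N)"
  shows "\<exists>N0\<ge>1. \<forall>N\<ge>N0. F \<subseteq> V N"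
  using F
proof (induction F rule: finite_induct)
  case (insert x F)
  then obtain N0 where N0: "N0 \<ge> 1" "\<forall>N\<ge>N0. F \<subseteq> V N" by auto
  obtain N1 where N1: "N1 \<ge> 1" "x \<in> V N1" using insert.prems by auto
  have "x \<in> V N" if "N \<ge> N1" for N
    using that
  proof (induction N rule: dec_induct)
    case (step N)
    then show ?case using mono[of N] N1(1) by auto
  qed (rule N1(2))
  then show ?case using N0 by (intro exI[of _ "max N0 N1"]) auto
qed auto

lemma cylinder_weight_bounds:
  assumes pos: "\<forall>e\<in>edges (cylinder n m w). cond (cylinder n m w) e > 0" and n: "n \<ge> 1"
  obtains lo hi where "0 < lo" "lo \<le> 1" "1 \<le> hi"
    "\<And>v u. fst v < m \<Longrightarrow> u \<in> nbrs v \<Longrightarrow> lo \<le> cover_cond n w v u \<and> cover_cond n w v u \<le> hi"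
proof -
  let ?E = "edges (cylinder n m w)"
  \<comment> \<open>Inserting 1 forces \<open>lo \<le> 1 \<le> hi\<close>.\<close>
  define lo where "lo = Min (insert 1 (w ` ?E))"
  define hi where "hi = Max (insert 1 (w ` ?E))"
  have "?E \<subseteq> (\<lambda>(k, i). Low k i) ` ({..<m} \<times> {0..<int n}) \<union> (\<lambda>(k, i). High k i) ` ({..<m} \<times> {0..<int n})"
    unfolding cylinder_def by auto
  then have fin: "finite ?E" by (rule finite_subset) auto
  have wpos: "0 < w e" if "e \<in> ?E" for e using pos that by (simp add: cylinder_def)
  have "0 < lo" unfolding lo_def using fin wpos by (subst Min_gr_iff) auto
  moreover have "lo \<le> 1" "1 \<le> hi" unfolding lo_def hi_def using fin by auto
  moreover have "lo \<le> cover_cond n w v u \<and> cover_cond n w v u \<le> hi" if vu: "fst v < m" "u \<in> nbrs v" for v u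
  proof -
    have "proj_edge n (cover_edge v u) \<in> ?E"
      using cover_edge_mem[OF vu] n unfolding edges_cover
      by (cases "cover_edge v u") (auto simp: cylinder_def)
    then show ?thesis unfolding cover_cond_def lo_def hi_def using fin by auto
  qed
  ultimately show thesis by (rule that)
qed

lemma radius_cross:
  assumes pos: "\<And>v u. fst v < m \<Longrightarrow> u \<in> nbrs v \<Longrightarrow> 0 < cover_cond n w v u"
    and mono: "\<forall>k. 1 \<le> k \<and> k < m \<longrightarrow> radius n w k \<ge> radius n w (k + 1)" and l: "l < m"
  shows "(\<Prod>i = 1..int n. cover_cond n w (l, i) (Suc l, i - 1)) * (\<Prod>i = 1..int n. cover_cond n w (0, i) (1, i))
      \<le> (\<Prod>i = 1..int n. cover_cond n w (0, i) (1, i - 1)) * (\<Prod>i = 1..int n. cover_cond n w (l, i) (Suc l, i))"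
proof -
  have rad: "radius n w (Suc l) = (\<Prod>i = 1..int n. cover_cond n w (l, i) (Suc l, i - 1)) /
      (\<Prod>i = 1..int n. cover_cond n w (l, i) (Suc l, i))" for l
    unfolding radius_def cover_cond_up by simp
  have low: "0 < (\<Prod>i = 1..int n. cover_cond n w (l, i) (Suc l, i))" if "l < m" for l
    by (rule prod_pos) (use pos that in auto)
  have "radius n w (Suc l) \<le> radius n w (Suc 0)"
    using l
  proof (induction l)
    case (Suc l)
    then have "radius n w (Suc (Suc l)) \<le> radius n w (Suc l)" using mono by simp
    then show ?case using Suc by simp
  qed simp
  then show ?thesis
    unfolding rad using low[OF l] low[of 0] l by (simp add: divide_simps mult_ac)
qed

theorem theorem5p9:
  fixes n m :: nat
    and w :: "edge \<Rightarrow> real"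
    and V :: "nat \<Rightarrow> vertex set"
    and G :: "nat \<Rightarrow> (vertex, edge) network"
  assumes "n \<ge> 1" and "m \<ge> 1"
    and "\<forall>e \<in> edges (cylinder n m w). cond (cylinder n m w) e > 0"
    and "\<forall>k. 1 \<le> k \<and> k < m \<longrightarrow> radius n w k \<ge> radius n w (k + 1)"
    and "\<forall>N\<ge>1. finite (V N) \<and> V N \<subseteq> verts (universal_cover n m w)"
    and "\<forall>N\<ge>1. V N \<subseteq> V (N + 1)"
    and "(\<Union>N\<in>{1..}. V N) = verts (universal_cover n m w)"
    and "\<forall>N\<ge>1. G N = truncation (universal_cover n m w) (V N)"
    and "\<forall>N\<ge>1. \<forall>i \<in> {- int N..int N}. (0, i) \<in> verts (G N) \<and> (m, i) \<in> verts (G N)"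
  shows "\<exists>L :: nat \<Rightarrow> real.
           (\<forall>K\<ge>1. (\<lambda>N. Prbar (G N) (sigma m K (G N)) / Prbar (G N) (tau m K (G N)))
                    \<longlonglongrightarrow> L K) \<and>
           L \<longlonglongrightarrow> cond (universal_cover n m w) (High 0 1)"
proof -
  define c where "c = cover_cond n w"
  define U where "U N = V N \<inter> ({0<..<m} \<times> UNIV)" for N
  define R where "R P N = zsum nbrs c (target m) P (U N) / zsum nbrs c (target m) {} (U N)" for P N
  let ?\<sigma> = "\<lambda>K. starts K" and ?\<tau> = "\<lambda>K. starts K - {(0, 1)}"
  let ?ratio = "\<lambda>K N. Prbar (G N) (sigma m K (G N)) / Prbar (G N) (tau m K (G N))"
  obtain lo hi where b: "0 < lo" "lo \<le> 1" "1 \<le> hi"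
    "\<And>v u. fst v < m \<Longrightarrow> u \<in> nbrs v \<Longrightarrow> lo \<le> c v u \<and> c v u \<le> hi"
    using cylinder_weight_bounds[OF assms(3,1)] unfolding c_def by metis
  interpret W: strip_weights n m c lo hi
  proof
    show "(\<Prod>i = 1..int n. c (l, i) (Suc l, i - 1)) * (\<Prod>i = 1..int n. c (0, i) (1, i))
      \<le> (\<Prod>i = 1..int n. c (0, i) (1, i - 1)) * (\<Prod>i = 1..int n. c (l, i) (Suc l, i))" if "l < m" for l
      unfolding c_def
    proof (rule radius_cross[OF _ assms(4) that])
      show "0 < cover_cond n w v u" if "fst v < m" "u \<in> nbrs v" for v u
        using b(1) b(4)[OF that] unfolding c_def by linarith
    qed
  qed (use assms(1,2) b in \<open>auto simp: c_def cover_cond_periodic\<close>)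
  have trunc: "finite_truncation m (V N)" if "N \<ge> 1" for N
    using assms(2,5) that by unfold_locales auto
  have finU: "finite (U N)" if "N \<ge> 1" for N using assms(5) that by (simp add: U_def)
  have Umono: "U N \<subseteq> U (Suc N)" if "N \<ge> 1" for N using assms(6) that by (auto simp: U_def)
  have ex: "\<exists>N0\<ge>1. \<forall>N\<ge>N0. {0..m} \<times> {- int K..int K} \<subseteq> V N" for K
    by (rule finite_subset_exhaustion) (use assms(6,7) in auto)
  then obtain N0 where N0: "\<And>K. N0 K \<ge> 1" "\<And>K N. N \<ge> N0 K \<Longrightarrow> {0..m} \<times> {- int K..int K} \<subseteq> V N"
    by metis
  have window: "strip_window n m c lo hi K (U N)" if "N \<ge> N0 K" for K N
  proof
    show "finite (U N)" using finU N0(1)[of K] that by simp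
    show "{0<..<m} \<times> {- int K..int K} \<subseteq> U N"
      using N0(2)[OF that] by (auto simp: U_def)
  qed (auto simp: U_def)
  have Rpos: "R (?\<tau> K) N > 0" if "N \<ge> N0 K" for K N
    unfolding R_def using strip_window.zsum\<tau>_pos[OF window[OF that]] strip_window.zsum_free_pos[OF window[OF that]]
    by simp
  have Pr: "?ratio K N = R (?\<sigma> K) N / R (?\<tau> K) N" if "K \<ge> 1" "N \<ge> N0 K" for K N
  proof -
    have N: "N \<ge> 1" using N0(1)[of K] that by simp
    interpret T: finite_truncation n m w "V N" by (rule trunc[OF N])
    have GN: "G N = T.H" using assms(8) N by simp
    have TU: "T.U = U N" by (simp add: T.U_def U_def)
    show ?thesis
      unfolding GN R_def
      using T.Prbar_tau[OF that(1) N0(2)[OF that(2)]] T.Prbar_sigma[OF that(1) N0(2)[OF that(2)]]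
      by (simp add: TU c_def)
  qed
  have conv: "\<exists>l. R P \<longlonglongrightarrow> l \<and> R P (N0 K) \<le> l" if P: "P = ?\<sigma> K \<or> P = ?\<tau> K" for P K
  proof (rule eventually_mono_convergent)
    fix N assume N: "N \<ge> N0 K"
    show "R P N \<le> R P (Suc N)"
      unfolding R_def using N N0(1)[of K]
      by (intro strip_window.ratio_mono[OF window[of K "Suc N"] P] Umono) auto
    show "R P N \<le> (\<Prod>p\<in>P. \<Sum>u\<in>nbrs p. c p u)"
      unfolding R_def by (rule strip_window.ratio_bounded[OF window[OF N] P])
  qed
  have lim: "\<exists>l. ?ratio K \<longlonglongrightarrow> l" if K: "K \<ge> 1" for K
  proof -
    obtain s where s: "R (?\<sigma> K) \<longlonglongrightarrow> s" using conv[of "?\<sigma> K" K] by auto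
    obtain t where t: "R (?\<tau> K) \<longlonglongrightarrow> t" "R (?\<tau> K) (N0 K) \<le> t" using conv[of "?\<tau> K" K] by auto
    \<comment> \<open>The quotient for \<tau> is positive at \<open>N0 K\<close> and bounded by its
      limit from there, so the limit of the ratio is the ratio of the limits.\<close>
    have "t > 0" using Rpos[of K "N0 K"] t(2) by simp
    then have "(\<lambda>N. R (?\<sigma> K) N / R (?\<tau> K) N) \<longlonglongrightarrow> s / t" by (intro tendsto_divide s t) simp
    moreover have "\<forall>\<^sub>F N in sequentially. R (?\<sigma> K) N / R (?\<tau> K) N = ?ratio K N"
      using Pr[OF K] by (intro eventually_sequentiallyI[of "N0 K"]) simp
    ultimately have "?ratio K \<longlonglongrightarrow> s / t" by (rule Lim_transform_eventually)
    then show ?thesis by blast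
  qed
  define L where "L K = lim (?ratio K)" for K
  have L: "?ratio K \<longlonglongrightarrow> L K" if "K \<ge> 1" for K
    using lim[OF that] unfolding L_def convergent_LIMSEQ_iff[symmetric] convergent_def .
  define a where "a = c (0, 1) (1, 0)"
  have a: "a = cond (universal_cover n m w) (High 0 1)"
    by (simp add: a_def c_def cover_cond_def cover_edge_def)
  have "L \<longlonglongrightarrow> a"
  proof (rule LIMSEQ_I)
    fix \<epsilon> :: real assume \<epsilon>: "\<epsilon> > 0"
    \<comment> \<open>The number \<open>S'\<close> of splices is chosen first, to push the error
      below \<open>\<epsilon>\<close>; \<open>K0\<close> then makes room for that many
      periods.\<close>
    define B where "B = (1 + a) * strip_window.bad_const m lo hi"
    obtain S :: nat where S: "B / \<epsilon> < real S" using reals_Archimedean2 by blast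
    define S' where "S' = Suc S"
    have "B < real S * \<epsilon>" using S \<epsilon> by (simp add: pos_divide_less_eq)
    also have "\<dots> \<le> real S' * \<epsilon>" using \<epsilon> by (intro mult_right_mono) (simp_all add: S'_def)
    finally have S': "B / real S' < \<epsilon>" by (simp add: S'_def pos_divide_less_eq mult.commute)
    define K0 where "K0 = defect_bound m + 2 + (defect_bound m + 1) * (m * (n * S' + 1))"
    have "norm (L K - a) < \<epsilon>" if K: "K \<ge> K0" for K
    proof -
      have K1: "K \<ge> 1" using K by (simp add: K0_def)
      have "\<bar>?ratio K N - a\<bar> \<le> B / real S'" if N: "N \<ge> N0 K" for N
      proof -
        interpret SW: strip_window n m c lo hi K "U N" by (rule window[OF N])
        have "?ratio K N = zsum nbrs c (target m) (?\<sigma> K) (U N) / zsum nbrs c (target m) (?\<tau> K) (U N)"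
          unfolding Pr[OF K1 N] R_def using SW.zsum_free_pos by simp
        moreover have "\<bar>zsum nbrs c (target m) (?\<sigma> K) (U N) / zsum nbrs c (target m) (?\<tau> K) (U N) - c (0, 1) (1, 0)\<bar>
          \<le> (1 + c (0, 1) (1, 0)) * SW.bad_const / real S'"
        proof (rule SW.ratio_close)
          show "int (defect_bound m) + 2 + int ((defect_bound m + 1) * (m * (n * S' + 1))) \<le> int K"
            using K unfolding K0_def by linarith
        qed (simp add: S'_def)
        ultimately show ?thesis by (simp add: a_def B_def)
      qed
      \<comment> \<open>The estimate holds for all N from \<open>N0 K\<close> on with the same right
        side, so it survives the inner limit.\<close>
      then have "\<bar>L K - a\<bar> \<le> B / real S'"
        by (intro LIMSEQ_le_const2[OF tendsto_rabs[OF tendsto_diff[OF L[OF K1] tendsto_const]]]) blast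
      then show ?thesis using S' by simp
    qed
    then show "\<exists>K0. \<forall>K\<ge>K0. norm (L K - a) < \<epsilon>" by blast
  qed
  then show ?thesis using L a by blast
qed

end
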